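(* Let $d\in\mathbb N^*$ and let $\chi\in\mathcal C^\infty_c(\mathbb R^d;\mathbb R)$ be even. Let $(w,\alpha)$ be a smooth rapidly decreasing solution of the Moyal--Klein--Gordon system with initial data $(w_0,\alpha_0)$, where $w_0=(2\pi)^{-d}\mathcal F_{x,\xi}\mathrm W(u_0)$ for some $u_0\in\mathcal S(\mathbb R^d;\mathbb C)$. Then the following quantities are constant in time: - for all $t\in\mathbb R$, $\displaystyle\int_{\mathbb R^d}\!\int_{\mathbb R^d}|w(t,k,\eta)|^2\,dk\,d\eta=\int_{\mathbb R^d}\!\int_{\mathbb R^d}|w_0(k,\eta)|^2\,dk\,d\eta=(2\pi)^d\|u_0\|_{L^2}^4$; - for all $t\in\mathbb R$, $w(t,0,0)=w_0(0,0)=\|u_0\|_{L^2}^2$; - for all $t\in\mathbb R$, $\tilde{\mathcal E}_\chi(t)=\tilde{\mathcal E}_\chi(0)$, where $$\tilde{\mathcal E}_\chi(t):=-\frac12(\Delta_\eta w)(t,0,0)+\frac1{(2\pi)^{d/2}}\int_{\mathbb R^d}w(t,-k,0)\,\langle k\rangle^{-1/2}\chi(k)\,\mathcal I\alpha(t,k)\,dk+\frac12\int_{\mathbb R^d}\langle k\rangle\,|\alpha(t,k)|^2\,dk .$$ Moreover, $\tilde{\mathcal E}_\chi(t)$ is the total energy of the Schrödinger--Klein--Gordon system $\mathrm{SKG}_\chi$ rewritten in the variables $(w,\alpha)$: if $(w,\alpha)$ comes from a smooth rapidly decreasing solution $(u,A)$ of $\mathrm{SKG}_\chi$, then $\tilde{\mathcal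 E}_\chi(t)=\mathcal E_\chi(t)$, where $$\mathcal E_\chi(t):=\frac12\Bigl(\|\nabla_xu(t,\cdot)\|_{L^2}^2+\|A(t,\cdot)\|_{L^2}^2+\|\nabla_xA(t,\cdot)\|_{L^2}^2+\|\partial_tA(t,\cdot)\|_{L^2}^2\Bigr)+\int_{\mathbb R^d}\chi(D)A(t,x)\,|u(t,x)|^2\,dx .$$
   Context: Notation: $\langle k\rangle:=(1+|k|^2)^{1/2}$; $\mathcal F u(k)=\int e^{-ik\cdot x}u(x)\,dx$; $\chi(D)A=\mathcal F^{-1}(\chi\mathcal FA)$; for a function $\alpha$ of $k$, $\mathcal I\alpha(k)=\frac12[\alpha(k)+\overline\alpha(-k)]$; for $w(k,\eta)$, $\mathcal I w(k,\eta)=\frac12[w(k,\eta)+\overline w(-k,-\eta)]$. "Smooth rapidly decreasing" means smooth in time with values in the Schwartz space ($\mathcal S(\mathbb R^d\times\mathbb R^d)$ for $w$, $\mathcal S(\mathbb R^d)$ for $\alpha,u,A,\partial_tA$). Wigner transform: $\mathrm W(u)(x,\xi)=\int_{\mathbb R^d}e^{-i\xi\cdot y}u(x+\frac y2)\overline u(x-\frac y2)\,dy$; equivalently $(2\pi)^{-d}\mathcal F_{x,\xi}\mathrm W(u)(k,\eta)=\int_{\mathbb R^d}e^{-ik\cdot x}u(x-\frac\eta2)\overline u(x+\frac\eta2)\,dx$. Yukawa bilinear map: $$\mathcal B_{\chi}[w_1,w_2](k,\eta):=\frac{2}{(2\pi)^d}\int_{\mathbb R^d}\sin(\tilde k\cdot\eta/2)\,\chi(\tilde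 k)\,\mathcal I w_1(\tilde k,0)\,\mathcal I w_2(k-\tilde k,\eta)\,d\tilde k ,$$ a function of $k$ alone being regarded as constant in $\eta$. Moyal--Klein--Gordon system: $$\partial_tw-(k\cdot\nabla_\eta)w+(2\pi)^{d/2}\mathcal B_\chi[\langle k\rangle^{-1/2}\alpha,w]=0,\qquad \partial_t\alpha+i\langle k\rangle\alpha+i(2\pi)^{-d/2}\langle k\rangle^{-1/2}\chi(k)\,w(t,k,0)=0,$$ with $w(0,\cdot)=w_0$, $\alpha(0,\cdot)=\alpha_0$. $\mathrm{SKG}_\chi$ system ($u$ complex-valued, $A$ real-valued): $$i\partial_tu=-\tfrac12\Delta u+(\chi(D)A)\,u,\qquad (\partial_{tt}^2-\Delta_x+1)A=-\mathcal F^{-1}(\chi)*|u|^2 .$$ "$(w,\alpha)$ comes from $(u,A)$" means $w(t,\cdot)=(2\pi)^{-d}\mathcal F_{x,\xi}\mathrm W(u(t,\cdot))$ and $\alpha(t,k)=(2\pi)^{-d/2}[\langle k\rangle^{1/2}\mathcal F_x(A(t,\cdot))(k)+i\langle k\rangle^{-1/2}\mathcal F_x(\partial_tA(t,\cdot))(k)]$. *)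

theory Defs
  imports "HOL-Analysis.Analysis"
begin

definition dir_deriv ::
    "'a::euclidean_space \<Rightarrow> ('a \<Rightarrow> 'b::real_normed_vector) \<Rightarrow> 'a \<Rightarrow> 'b" where
  "dir_deriv b f x = frechet_derivative f (at x) b"

text \<open>A list \<open>bs\<close> of basis vectors plays the role of a multi-index:
  \<open>foldr dir_deriv [b1, b2, \<dots>] f\<close> is the iterated partial derivative in these directions.\<close>

definition smooth :: "('a::euclidean_space \<Rightarrow> 'b::real_normed_vector) \<Rightarrow> bool" where
  "smooth f \<longleftrightarrow> (\<forall>bs x. set bs \<subseteq> Basis \<longrightarrow> foldr dir_deriv bs f differentiable (at x))"

definition test_function :: "('a::euclidean_space \<Rightarrow> real) \<Rightarrow> bool" where
  "test_function f \<longleftrightarrow> smooth f \<and> compact (closure {x. f x \<noteq> 0})"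

definition schwartz :: "('a::euclidean_space \<Rightarrow> 'b::real_normed_vector) \<Rightarrow> bool" where
  "schwartz f \<longleftrightarrow> smooth f \<and>
     (\<forall>m bs. set bs \<subseteq> Basis \<longrightarrow>
        bdd_above (range (\<lambda>x. (1 + norm x) ^ m * norm (foldr dir_deriv bs f x))))"

text \<open>The supremum is only meaningful for Schwartz functions; it is applied to no others.\<close>

definition schwartz_seminorm ::
    "nat \<Rightarrow> 'a::euclidean_space list \<Rightarrow> ('a \<Rightarrow> 'b::real_normed_vector) \<Rightarrow> real" where
  "schwartz_seminorm m bs f = (SUP x. (1 + norm x) ^ m * norm (foldr dir_deriv bs f x))"

text \<open>Differentiability of a curve in the topology given by all the seminorms.\<close>

definition has_schwartz_derivative ::
    "(real \<Rightarrow> 'a::euclidean_space \<Rightarrow> 'b::real_normed_vector) \<Rightarrow> ('a \<Rightarrow> 'b) \<Rightarrow> real \<Rightarrow> bool" where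
  "has_schwartz_derivative F g t \<longleftrightarrow>
     (\<forall>m bs. set bs \<subseteq> Basis \<longrightarrow>
        ((\<lambda>h. schwartz_seminorm m bs (\<lambda>x. (F (t + h) x - F t x) /\<^sub>R h - g x)) \<longlongrightarrow> 0) (at 0))"

text \<open>Smooth in time (on the whole real line) with values in the Schwartz space;
  \<open>G n\<close> is the \<open>n\<close>-th time derivative.\<close>

definition smooth_rapidly_decreasing ::
    "(real \<Rightarrow> 'a::euclidean_space \<Rightarrow> 'b::real_normed_vector) \<Rightarrow> bool" where
  "smooth_rapidly_decreasing F \<longleftrightarrow>
     (\<exists>G :: nat \<Rightarrow> real \<Rightarrow> 'a \<Rightarrow> 'b. G 0 = F \<and>
        (\<forall>n t. schwartz (G n t) \<and> has_schwartz_derivative (G n) (G (Suc n) t) t))"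

definition dt :: "(real \<Rightarrow> 'a \<Rightarrow> 'b::real_normed_vector) \<Rightarrow> real \<Rightarrow> 'a \<Rightarrow> 'b" where
  "dt F t x = vector_derivative (\<lambda>s. F s x) (at t)"

definition grad :: "(real^'n \<Rightarrow> 'b::real_normed_vector) \<Rightarrow> real^'n \<Rightarrow> 'b^'n" where
  "grad f x = (\<chi> j. dir_deriv (axis j 1) f x)"

definition laplacian :: "(real^'n \<Rightarrow> 'b::real_normed_vector) \<Rightarrow> real^'n \<Rightarrow> 'b" where
  "laplacian f x = (\<Sum>j\<in>UNIV. dir_deriv (axis j 1) (dir_deriv (axis j 1) f) x)"

definition L2norm :: "('a::euclidean_space \<Rightarrow> 'b::real_normed_vector) \<Rightarrow> real" where
  "L2norm f = sqrt (LINT x|lborel. (norm (f x))\<^sup>2)"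

definition bracket :: "'a::real_normed_vector \<Rightarrow> real" where
  "bracket k = sqrt (1 + (norm k)\<^sup>2)"

definition fourier :: "('a::euclidean_space \<Rightarrow> complex) \<Rightarrow> 'a \<Rightarrow> complex" where
  "fourier f k = (LINT x|lborel. exp (- \<i> * of_real (k \<bullet> x)) * f x)"

definition fourier_inv :: "('a::euclidean_space \<Rightarrow> complex) \<Rightarrow> 'a \<Rightarrow> complex" where
  "fourier_inv g x =
     of_real (1 / (2 * pi) ^ DIM('a)) * (LINT k|lborel. exp (\<i> * of_real (k \<bullet> x)) * g k)"

definition convol ::
    "('a::euclidean_space \<Rightarrow> complex) \<Rightarrow> ('a \<Rightarrow> complex) \<Rightarrow> 'a \<Rightarrow> complex" where
  "convol f g x = (LINT y|lborel. f (x - y) * g y)"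

text \<open>The Fourier multiplier \<open>X(D)\<close> acting on a real-valued function; the result is kept as a
  complex-valued function (it is real-valued when \<open>X\<close> is real and even).\<close>

definition fourier_mult ::
    "('a::euclidean_space \<Rightarrow> real) \<Rightarrow> ('a \<Rightarrow> real) \<Rightarrow> 'a \<Rightarrow> complex" where
  "fourier_mult X A = fourier_inv (\<lambda>k. of_real (X k) * fourier (\<lambda>x. of_real (A x)) k)"

definition wigner :: "(real^'n \<Rightarrow> complex) \<Rightarrow> (real^'n) \<times> (real^'n) \<Rightarrow> complex" where
  "wigner u = (\<lambda>(x, \<xi>). LINT y|lborel.
     exp (- \<i> * of_real (\<xi> \<bullet> y)) * u (x + y /\<^sub>R 2) * cnj (u (x - y /\<^sub>R 2)))"

definition fourier_wigner :: "(real^'n \<Rightarrow> complex) \<Rightarrow> (real^'n) \<times> (real^'n) \<Rightarrow> complex" where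
  "fourier_wigner u p = of_real (1 / (2 * pi) ^ CARD('n)) * fourier (wigner u) p"

text \<open>The operator \<open>\<I>\<close>. Negation on pairs is componentwise, so this covers both functions
  of \<open>k\<close> and functions of \<open>(k, \<eta>)\<close>.\<close>

definition herm :: "('a::ab_group_add \<Rightarrow> complex) \<Rightarrow> 'a \<Rightarrow> complex" where
  "herm f p = (f p + cnj (f (- p))) / 2"

definition yukawa ::
    "(real^'n \<Rightarrow> real) \<Rightarrow> ((real^'n) \<times> (real^'n) \<Rightarrow> complex) \<Rightarrow>
     ((real^'n) \<times> (real^'n) \<Rightarrow> complex) \<Rightarrow> (real^'n) \<times> (real^'n) \<Rightarrow> complex" where
  "yukawa X w1 w2 = (\<lambda>(k, \<eta>). of_real (2 / (2 * pi) ^ CARD('n)) *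
     (LINT q|lborel. of_real (sin ((q \<bullet> \<eta>) / 2)) * of_real (X q) *
        herm w1 (q, 0) * herm w2 (k - q, \<eta>)))"

definition mkg_system ::
    "(real^'n \<Rightarrow> real) \<Rightarrow> (real \<Rightarrow> (real^'n) \<times> (real^'n) \<Rightarrow> complex) \<Rightarrow>
     (real \<Rightarrow> real^'n \<Rightarrow> complex) \<Rightarrow> bool" where
  "mkg_system X w \<alpha> \<longleftrightarrow>
     (\<forall>t k \<eta>.
        dt w t (k, \<eta>)
        - (\<Sum>j\<in>UNIV. of_real (k $ j) * grad (\<lambda>\<eta>. w t (k, \<eta>)) \<eta> $ j)
        + of_real ((2 * pi) powr (real CARD('n) / 2)) *
          yukawa X (\<lambda>(k, _). of_real (bracket k powr (- 1 / 2)) * \<alpha> t k) (w t) (k, \<eta>) = 0) \<and>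
     (\<forall>t k.
        dt \<alpha> t k + \<i> * of_real (bracket k) * \<alpha> t k
        + \<i> * of_real ((2 * pi) powr (- real CARD('n) / 2)) * of_real (bracket k powr (- 1 / 2)) *
          of_real (X k) * w t (k, 0) = 0)"

definition mkg_energy ::
    "(real^'n \<Rightarrow> real) \<Rightarrow> (real \<Rightarrow> (real^'n) \<times> (real^'n) \<Rightarrow> complex) \<Rightarrow>
     (real \<Rightarrow> real^'n \<Rightarrow> complex) \<Rightarrow> real \<Rightarrow> complex" where
  "mkg_energy X w \<alpha> t =
     - (1 / 2) * laplacian (\<lambda>\<eta>. w t (0, \<eta>)) 0
     + of_real (1 / (2 * pi) powr (real CARD('n) / 2)) *
       (LINT k|lborel. w t (- k, 0) * of_real (bracket k powr (- 1 / 2)) * of_real (X k) *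
          herm (\<alpha> t) k)
     + of_real (1 / 2 * (LINT k|lborel. bracket k * (norm (\<alpha> t k))\<^sup>2))"

definition skg_system ::
    "(real^'n \<Rightarrow> real) \<Rightarrow> (real \<Rightarrow> real^'n \<Rightarrow> complex) \<Rightarrow> (real \<Rightarrow> real^'n \<Rightarrow> real) \<Rightarrow> bool" where
  "skg_system X u A \<longleftrightarrow>
     (\<forall>t x. \<i> * dt u t x = - (1 / 2) * laplacian (u t) x + fourier_mult X (A t) x * u t x) \<and>
     (\<forall>t x. of_real (dt (dt A) t x - laplacian (A t) x + A t x) =
        - convol (fourier_inv (\<lambda>k. of_real (X k))) (\<lambda>y. of_real ((norm (u t y))\<^sup>2)) x)"

definition skg_energy ::
    "(real^'n \<Rightarrow> real) \<Rightarrow> (real \<Rightarrow> real^'n \<Rightarrow> complex) \<Rightarrow> (real \<Rightarrow> real^'n \<Rightarrow> real) \<Rightarrow>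
     real \<Rightarrow> complex" where
  "skg_energy X u A t =
     of_real (1 / 2 * ((L2norm (grad (u t)))\<^sup>2 + (L2norm (A t))\<^sup>2 + (L2norm (grad (A t)))\<^sup>2
                       + (L2norm (dt A t))\<^sup>2))
     + (LINT x|lborel. fourier_mult X (A t) x * of_real ((norm (u t x))\<^sup>2))"

definition comes_from ::
    "(real \<Rightarrow> (real^'n) \<times> (real^'n) \<Rightarrow> complex) \<Rightarrow> (real \<Rightarrow> real^'n \<Rightarrow> complex) \<Rightarrow>
     (real \<Rightarrow> real^'n \<Rightarrow> complex) \<Rightarrow> (real \<Rightarrow> real^'n \<Rightarrow> real) \<Rightarrow> bool" where
  "comes_from w \<alpha> u A \<longleftrightarrow>
     (\<forall>t. w t = fourier_wigner (u t)) \<and>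
     (\<forall>t k. \<alpha> t k = of_real ((2 * pi) powr (- real CARD('n) / 2)) *
        (of_real (bracket k powr (1 / 2)) * fourier (\<lambda>x. of_real (A t x)) k
         + \<i> * of_real (bracket k powr (- 1 / 2)) * fourier (\<lambda>x. of_real (dt A t x)) k))"

end

theory Submission
  imports Defs "HOL-Probability.Characteristic_Functions" "HOL-Probability.Sinc_Integral"
begin

text \<open>
  The conservation laws express symmetries of the two terms of the equation for \<open>w\<close>. The transport
  term \<open>k \<cdot> \<nabla>\<^sub>\<eta> w\<close> is a divergence, hence antisymmetric in \<open>L\<^sup>2\<close> (\<open>transport_antisymmetric\<close>). The force
  term is, for each \<open>\<eta>\<close>, convolution in \<open>k\<close> with the function \<open>b(q) = sin (q \<cdot> \<eta> / 2) a(q)\<close>, where \<open>a\<close> is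
  the hermitian coupling of the field. The sine is odd and \<open>a\<close> is hermitian, so the adjoint kernel is
  \<open>cnj (b(- q)) = - b(q)\<close>, and the force term is antisymmetric as well (\<open>convolution_antisymmetric\<close>).
  This gives the conservation of the \<open>L\<^sup>2\<close> norm. At the origin both terms vanish, which gives the
  conservation of the mass.

  The equation applies the force only to the hermitian part of \<open>w\<close>, so one first has to know that
  \<open>w\<close> remains hermitian. Its anti-hermitian part obeys the free transport equation, whose \<open>L\<^sup>2\<close> norm is
  constant, and this norm is zero initially (\<open>w_hermitian\<close>).

  For the energy, the second \<open>\<eta>\<close>-derivative of the force at \<open>(0, 0)\<close> only sees the mixed terms, in which
  one derivative falls on the sine (\<open>second_dir_deriv_oscillatory_sin\<close>). Consequently the kinetic
  energy changes at the rate \<open>- \<integral> a(k) \<partial>\<^sub>t w(- k, 0) dk\<close>, up to the normalising factor (\<open>laplacian_dt_w\<close>),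
  and this cancels the part of the derivative of the interaction energy in which \<open>w\<close> is
  differentiated. The other part and the derivative of the field energy add up to an integrand of
  the form \<open>M(- k) - M(k)\<close>, which integrates to zero (\<open>energy_conserved\<close>).

  The initial values and the comparison with the Schroedinger--Klein--Gordon energy come from the
  formula \<open>w(k, \<eta>) = \<integral> exp (- \<i> k \<cdot> x) u(x - \<eta> / 2) cnj (u(x + \<eta> / 2)) dx\<close> (\<open>fourier_wigner_eq\<close>) and Plancherel's
  theorem. The former is Fourier inversion in the velocity variable; it needs the Wigner function
  to be integrable in both variables jointly. The comparison of energies is an identity at each
  fixed time (\<open>energy_in_wigner_variables\<close>).

  Two devices keep the analysis short. The Schwartz property is established by coinduction, on
  families of functions that are closed under partial derivatives up to linear combinations
  (\<open>schwartz_coinduct\<close>). Time derivatives of quadratic quantities are computed in the class of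
  curves whose difference quotients converge in all polynomially weighted sup norms (\<open>rapid_curve\<close>):
  it is closed under products and restrictions, and the integral is differentiable along it.
\<close>

section \<open>Schwartz functions\<close>

text \<open>Measurability is part of the notion because these functions are to be integrated, and
  continuity would not survive multiplication by measurable weights.\<close>

definition rapid :: "('a::euclidean_space \<Rightarrow> 'b::real_normed_vector) \<Rightarrow> bool" where
  "rapid f \<longleftrightarrow> f \<in> borel_measurable borel \<and>
     (\<forall>m::nat. \<exists>C. \<forall>x. (1 + norm x) ^ m * norm (f x) \<le> C)"

lemma rapidI:
  assumes "f \<in> borel_measurable borel"
    and "\<And>m. \<exists>C. \<forall>x. (1 + norm x) ^ m * norm (f x) \<le> C"
  shows "rapid f"
  using assms by (auto simp: rapid_def)

lemma rapid_bound:
  assumes "rapid f"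
  obtains C where "C > 0" "\<And>x. (1 + norm x) ^ m * norm (f x) \<le> C"
proof -
  obtain C where C: "\<And>x. (1 + norm x) ^ m * norm (f x) \<le> C"
    using assms by (auto simp: rapid_def)
  show ?thesis
    by (rule that[of "max 1 C"]) (use C in \<open>auto simp: max_def intro: order_trans[of _ C]\<close>)
qed

lemma rapid_measurable[measurable_dest]:
  "rapid f \<Longrightarrow> f \<in> borel_measurable borel"
  by (simp add: rapid_def)

lemma one_plus_norm_pos: "0 < 1 + norm x"
  by (simp add: add_pos_nonneg)

lemma one_plus_norm_power_pos: "0 < (1 + norm x) ^ m"
  by (simp add: add_pos_nonneg)

lemma dir_deriv_eqI: "(f has_derivative f') (at x) \<Longrightarrow> dir_deriv b f x = f' b"
  unfolding dir_deriv_def by (simp add: frechet_derivative_at[symmetric])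

lemma frechet_derivativeI:
  "f differentiable (at x) \<Longrightarrow> (f has_derivative frechet_derivative f (at x)) (at x)"
  by (simp add: frechet_derivative_works[symmetric])

lemma has_derivative_dir_deriv:
  assumes "f differentiable (at x)"
  shows "(f has_derivative (\<lambda>v. \<Sum>b\<in>Basis. (v \<bullet> b) *\<^sub>R dir_deriv b f x)) (at x)"
proof -
  have D: "(f has_derivative frechet_derivative f (at x)) (at x)"
    using assms by (intro frechet_derivativeI; simp)
  interpret linear "frechet_derivative f (at x)"
    using D by (simp add: has_derivative_def bounded_linear.linear)
  have "frechet_derivative f (at x) v = (\<Sum>b\<in>Basis. (v \<bullet> b) *\<^sub>R dir_deriv b f x)" for v
  proof -
    have "frechet_derivative f (at x) v = frechet_derivative f (at x) (\<Sum>b\<in>Basis. (v \<bullet> b) *\<^sub>R b)"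
      by (simp add: euclidean_representation)
    also have "\<dots> = (\<Sum>b\<in>Basis. (v \<bullet> b) *\<^sub>R dir_deriv b f x)"
      unfolding sum scale by (simp add: dir_deriv_def)
    finally show ?thesis .
  qed
  then have "frechet_derivative f (at x) = (\<lambda>v. \<Sum>b\<in>Basis. (v \<bullet> b) *\<^sub>R dir_deriv b f x)"
    by blast
  with D show ?thesis by simp
qed

lemma schwartz_differentiable: "schwartz f \<Longrightarrow> f differentiable (at x)"
  unfolding schwartz_def smooth_def by (auto dest!: spec[where x = "[]"])

lemma schwartz_has_derivative:
  "schwartz f \<Longrightarrow> (f has_derivative (\<lambda>v. \<Sum>b\<in>Basis. (v \<bullet> b) *\<^sub>R dir_deriv b f x)) (at x)"
  by (intro has_derivative_dir_deriv schwartz_differentiable)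

lemma schwartz_dir_deriv:
  assumes "schwartz f" "b \<in> Basis"
  shows "schwartz (dir_deriv b f)"
proof -
  have *: "foldr dir_deriv bs (dir_deriv b f) = foldr dir_deriv (bs @ [b]) f" for bs
    by simp
  show ?thesis
    unfolding schwartz_def smooth_def *
  proof (intro conjI allI impI)
    fix bs :: "'a list" and x assume "set bs \<subseteq> Basis"
    then have "set (bs @ [b]) \<subseteq> Basis" using assms(2) by simp
    then show "foldr dir_deriv (bs @ [b]) f differentiable at x"
      using assms(1) unfolding schwartz_def smooth_def by blast
  next
    fix bs :: "'a list" and m assume "set bs \<subseteq> Basis"
    then have "set (bs @ [b]) \<subseteq> Basis" using assms(2) by simp
    then show "bdd_above (range (\<lambda>x. (1 + norm x) ^ m * norm (foldr dir_deriv (bs @ [b]) f x)))"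
      by (rule assms(1)[unfolded schwartz_def, THEN conjunct2, rule_format])
  qed
qed

lemma schwartz_foldr_dir_deriv: "schwartz f \<Longrightarrow> set bs \<subseteq> Basis \<Longrightarrow> schwartz (foldr dir_deriv bs f)"
  by (induction bs) (auto intro: schwartz_dir_deriv)

lemma schwartz_continuous: "schwartz f \<Longrightarrow> continuous_on A f"
  by (simp add: continuous_at_imp_continuous_on differentiable_imp_continuous_within
      schwartz_differentiable)

lemma schwartz_rapid:
  assumes "schwartz f"
  shows "rapid f"
proof (rule rapidI)
  show "f \<in> borel_measurable borel"
    by (intro borel_measurable_continuous_onI schwartz_continuous assms)
  fix m
  have "bdd_above (range (\<lambda>x. (1 + norm x) ^ m * norm (foldr dir_deriv [] f x)))"
    using assms unfolding schwartz_def by (auto dest!: spec[where x = m] spec[where x = "[]"])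
  then show "\<exists>C. \<forall>x. (1 + norm x) ^ m * norm (f x) \<le> C"
    by (auto simp: bdd_above_def)
qed

text \<open>A partial derivative of a product or of a composition is a sum of functions of the same shape.
  Closing a family of shapes under linear combinations makes it stable under differentiation.\<close>

inductive linear_combination ::
    "(('a \<Rightarrow> 'b::real_vector) \<Rightarrow> bool) \<Rightarrow> ('a \<Rightarrow> 'b) \<Rightarrow> bool" for P where
  base: "P g \<Longrightarrow> linear_combination P g"
| add: "linear_combination P g \<Longrightarrow> linear_combination P h \<Longrightarrow> linear_combination P (\<lambda>x. g x + h x)"
| scale: "linear_combination P g \<Longrightarrow> linear_combination P (\<lambda>x. c *\<^sub>R g x)"

lemma weighted_bound_add:
  assumes "\<exists>C. \<forall>x. (1 + norm x) ^ m * norm (f x) \<le> C" "\<exists>C. \<forall>x. (1 + norm x) ^ m * norm (g x) \<le> C"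
  shows "\<exists>C. \<forall>x. (1 + norm x) ^ m * norm (f x + g x) \<le> C"
proof -
  obtain C D where C: "\<forall>x. (1 + norm x) ^ m * norm (f x) \<le> C"
    and D: "\<forall>x. (1 + norm x) ^ m * norm (g x) \<le> D" using assms by blast
  have "(1 + norm x) ^ m * norm (f x + g x) \<le> C + D" for x
  proof -
    have "(1 + norm x) ^ m * norm (f x + g x) \<le> (1 + norm x) ^ m * (norm (f x) + norm (g x))"
      by (intro mult_left_mono norm_triangle_ineq) auto
    also have "\<dots> \<le> C + D"
      using C[rule_format, of x] D[rule_format, of x] by (simp add: distrib_left)
    finally show ?thesis .
  qed
  then show ?thesis by blast
qed

lemma linear_combination_sum:
  assumes "finite I" "I \<noteq> {}" "\<And>i. i \<in> I \<Longrightarrow> linear_combination P (g i)"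
  shows "linear_combination P (\<lambda>x. \<Sum>i\<in>I. g i x)"
  using assms by (induction rule: finite_ne_induct) (auto intro: linear_combination.add)

text \<open>Coinduction for Schwartz functions: since the iterated partial derivatives of members of the
  family never leave its linear span, their differentiability and decay need only be checked on
  the family itself, where first-order product and chain rules suffice.\<close>

lemma schwartz_coinduct:
  fixes P :: "('a::euclidean_space \<Rightarrow> 'b::real_normed_vector) \<Rightarrow> bool"
  assumes "linear_combination P f"
    and diff: "\<And>g x. P g \<Longrightarrow> g differentiable (at x)"
    and bound: "\<And>g m. P g \<Longrightarrow> \<exists>C. \<forall>x. (1 + norm x) ^ m * norm (g x) \<le> C"
    and deriv: "\<And>g b. P g \<Longrightarrow> b \<in> Basis \<Longrightarrow> linear_combination P (dir_deriv b g)"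
  shows "schwartz f"
proof -
  let ?L = "linear_combination P"
  have diffL: "g differentiable (at x)" if "?L g" for g x
    using that by induction (auto intro!: diff derivative_intros differentiable_scaleR)
  have boundL: "\<exists>C. \<forall>x. (1 + norm x) ^ m * norm (g x) \<le> C" if "?L g" for g m
    using that
  proof induction
    case (add g h)
    show ?case by (rule weighted_bound_add[OF add.IH])
  next
    case (scale g c)
    then obtain C where C: "\<forall>x. (1 + norm x) ^ m * norm (g x) \<le> C" by blast
    have "(1 + norm x) ^ m * norm (c *\<^sub>R g x) \<le> \<bar>c\<bar> * C" for x
      using mult_left_mono[OF C[rule_format, of x], of "\<bar>c\<bar>"] by (simp add: mult_ac)
    then show ?case by blast
  qed (auto intro: bound)
  have derivL: "?L (dir_deriv b g)" if "?L g" "b \<in> Basis" for g b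
    using that
  proof induction
    case (add g h)
    have "dir_deriv b (\<lambda>x. g x + h x) = (\<lambda>x. dir_deriv b g x + dir_deriv b h x)"
    proof
      fix x
      have "(g has_derivative frechet_derivative g (at x)) (at x)"
           "(h has_derivative frechet_derivative h (at x)) (at x)"
        by (intro frechet_derivativeI diffL add.hyps)+
      from has_derivative_add[OF this]
      show "dir_deriv b (\<lambda>x. g x + h x) x = dir_deriv b g x + dir_deriv b h x"
        by (subst dir_deriv_eqI) (auto simp: dir_deriv_def)
    qed
    with add show ?case by (auto intro: linear_combination.add)
  next
    case (scale g c)
    have "dir_deriv b (\<lambda>x. c *\<^sub>R g x) = (\<lambda>x. c *\<^sub>R dir_deriv b g x)"
    proof
      fix x
      have "(g has_derivative frechet_derivative g (at x)) (at x)"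
        by (intro frechet_derivativeI diffL scale.hyps)
      from has_derivative_scaleR_right[OF this]
      show "dir_deriv b (\<lambda>x. c *\<^sub>R g x) x = c *\<^sub>R dir_deriv b g x"
        by (subst dir_deriv_eqI) (auto simp: dir_deriv_def)
    qed
    with scale show ?case by (auto intro: linear_combination.scale)
  qed (auto intro: deriv)
  have fold: "?L (foldr dir_deriv bs f)" if "set bs \<subseteq> Basis" for bs
    using that assms(1) by (induction bs) (auto intro: derivL)
  show ?thesis
    unfolding schwartz_def smooth_def
  proof (intro conjI allI impI)
    fix bs :: "'a list" and x assume "set bs \<subseteq> Basis"
    then show "foldr dir_deriv bs f differentiable at x" using fold diffL by blast
  next
    fix bs :: "'a list" and m :: nat assume "set bs \<subseteq> Basis"
    then show "bdd_above (range (\<lambda>x. (1 + norm x) ^ m * norm (foldr dir_deriv bs f x)))"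
      using boundL[OF fold, of bs m] by (auto simp: bdd_above_def)
  qed
qed

lemma schwartz_bound:
  assumes "schwartz f"
  shows "\<exists>C. \<forall>x. (1 + norm x) ^ m * norm (f x) \<le> C"
  using schwartz_rapid[OF assms] by (auto simp: rapid_def)

lemma schwartz_linear_combination: "linear_combination schwartz f \<Longrightarrow> schwartz f"
  by (erule schwartz_coinduct, rule schwartz_differentiable, assumption, rule schwartz_bound, assumption,
      rule linear_combination.base, rule schwartz_dir_deriv)

lemma schwartz_add: "schwartz f \<Longrightarrow> schwartz g \<Longrightarrow> schwartz (\<lambda>x. f x + g x)"
  by (rule schwartz_linear_combination[OF linear_combination.add[OF linear_combination.base linear_combination.base]])

lemma schwartz_scaleR: "schwartz f \<Longrightarrow> schwartz (\<lambda>x. c *\<^sub>R f x)"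
  by (rule schwartz_linear_combination[OF linear_combination.scale[OF linear_combination.base]])

lemma schwartz_diff: "schwartz f \<Longrightarrow> schwartz g \<Longrightarrow> schwartz (\<lambda>x. f x - g x)"
  using schwartz_add[of f "\<lambda>x. (-1) *\<^sub>R g x"] schwartz_scaleR[of g "-1"] by simp

lemma dir_deriv_lincomb:
  assumes "f differentiable (at x)" "g differentiable (at x)"
  shows "dir_deriv b (\<lambda>x. c *\<^sub>R f x + d *\<^sub>R g x) x = c *\<^sub>R dir_deriv b f x + d *\<^sub>R dir_deriv b g x"
proof -
  have "(f has_derivative frechet_derivative f (at x)) (at x)"
       "(g has_derivative frechet_derivative g (at x)) (at x)"
    using assms by (intro frechet_derivativeI; simp)+
  then have "((\<lambda>x. c *\<^sub>R f x + d *\<^sub>R g x) has_derivative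
     (\<lambda>v. c *\<^sub>R frechet_derivative f (at x) v + d *\<^sub>R frechet_derivative g (at x) v)) (at x)"
    by (intro derivative_intros)
  from dir_deriv_eqI[OF this] show ?thesis by (simp add: dir_deriv_def)
qed

lemma foldr_dir_deriv_lincomb:
  assumes "schwartz f" "schwartz g" "set bs \<subseteq> Basis"
  shows "foldr dir_deriv bs (\<lambda>x. c *\<^sub>R f x + d *\<^sub>R g x) =
         (\<lambda>x. c *\<^sub>R foldr dir_deriv bs f x + d *\<^sub>R foldr dir_deriv bs g x)"
  using assms(3)
proof (induction bs)
  case (Cons b bs)
  then show ?case
    using assms
    by (auto intro!: dir_deriv_lincomb schwartz_differentiable schwartz_foldr_dir_deriv)
qed auto

lemma dir_deriv_bounded_linear:
  assumes "bounded_linear T" "f differentiable (at x)"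
  shows "dir_deriv b (\<lambda>x. T (f x)) x = T (dir_deriv b f x)"
proof -
  have "(f has_derivative frechet_derivative f (at x)) (at x)"
    using assms by (intro frechet_derivativeI; simp)
  from bounded_linear.has_derivative[OF assms(1) this] show ?thesis
    by (subst dir_deriv_eqI) (auto simp: dir_deriv_def)
qed

lemma schwartz_bounded_linear:
  fixes f :: "'a::euclidean_space \<Rightarrow> 'b::real_normed_vector" and T :: "'b \<Rightarrow> 'c::real_normed_vector"
  assumes T: "bounded_linear T" and f: "schwartz f"
  shows "schwartz (\<lambda>x. T (f x))"
proof -
  let ?P = "\<lambda>g :: 'a \<Rightarrow> 'c. \<exists>f :: 'a \<Rightarrow> 'b. schwartz f \<and> g = (\<lambda>x. T (f x))"
  show ?thesis
  proof (rule schwartz_coinduct[where P = ?P])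
    show "linear_combination ?P (\<lambda>x. T (f x))"
      using f by (intro linear_combination.base) auto
  next
    fix g :: "'a \<Rightarrow> 'c" and x assume "?P g"
    then obtain f where f: "schwartz f" "g = (\<lambda>x. T (f x))" by blast
    show "g differentiable (at x)"
      unfolding f differentiable_def
      by (intro exI) (rule bounded_linear.has_derivative[OF T schwartz_has_derivative[OF f(1)]])
  next
    fix g :: "'a \<Rightarrow> 'c" and m assume "?P g"
    then obtain f where f: "schwartz f" "g = (\<lambda>x. T (f x))" by blast
    obtain C where C: "\<And>x. (1 + norm x) ^ m * norm (f x) \<le> C" using schwartz_bound[OF f(1)] by blast
    obtain K where K: "K > 0" "\<And>y. norm (T y) \<le> norm y * K" using bounded_linear.pos_bounded[OF T] by blast
    have "(1 + norm x) ^ m * norm (g x) \<le> C * K" for x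
    proof -
      have "(1 + norm x) ^ m * norm (g x) \<le> (1 + norm x) ^ m * (norm (f x) * K)"
        unfolding f by (intro mult_left_mono K) auto
      also have "\<dots> \<le> C * K" using mult_right_mono[OF C[of x], of K] K(1) by (simp add: mult_ac)
      finally show ?thesis .
    qed
    then show "\<exists>C. \<forall>x. (1 + norm x) ^ m * norm (g x) \<le> C" by blast
  next
    fix g :: "'a \<Rightarrow> 'c" and b :: 'a assume "?P g" and b: "b \<in> Basis"
    then obtain f where f: "schwartz f" "g = (\<lambda>x. T (f x))" by blast
    have "dir_deriv b g = (\<lambda>x. T (dir_deriv b f x))"
      unfolding f using dir_deriv_bounded_linear[OF T schwartz_differentiable[OF f(1)]] by blast
    then show "linear_combination ?P (dir_deriv b g)"
      using schwartz_dir_deriv[OF f(1) b] by (intro linear_combination.base) auto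
  qed
qed
text \<open>An injective linear map is bounded below, so composing with it does not destroy polynomial
  weights; this also covers restriction to a subspace and to a diagonal.\<close>

lemma one_plus_norm_affine_le:
  fixes L :: "'a::euclidean_space \<Rightarrow> 'b::euclidean_space"
  assumes "linear L" "inj L"
  obtains K where "K > 0" "\<And>x. 1 + norm x \<le> K * (1 + norm (a + L x))"
proof -
  obtain B where B: "B > 0" "\<And>x. B * norm x \<le> norm (L x)"
    using linear_inj_bounded_below_pos[OF assms] by blast
  have "1 + norm x \<le> (1 + (1 + norm a) / B) * (1 + norm (a + L x))" for x
  proof -
    have "B * norm x \<le> norm (L x)" by (rule B)
    also have "norm (L x) \<le> norm (a + L x) + norm a"
      using norm_triangle_ineq4[of "a + L x" a] by simp
    finally have "norm x \<le> (norm (a + L x) + norm a) / B"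
      using B(1) by (simp add: field_simps)
    also have "\<dots> \<le> (1 + norm a) / B * (1 + norm (a + L x))"
      using B(1) by (simp add: field_simps)
    finally have "norm x \<le> (1 + norm a) / B * (1 + norm (a + L x))" .
    moreover have "1 \<le> 1 + norm (a + L x)" by simp
    ultimately have "1 + norm x \<le> (1 + norm (a + L x)) + (1 + norm a) / B * (1 + norm (a + L x))"
      by (rule add_mono[rotated])
    then show ?thesis by (simp only: distrib_right mult_1)
  qed
  then show ?thesis using B(1) by (intro that[of "1 + (1 + norm a) / B"]) (auto simp: add_pos_nonneg)
qed

lemma rapid_bound_affine:
  fixes L :: "'a::euclidean_space \<Rightarrow> 'b::euclidean_space"
  assumes L: "linear L" "inj L" and f: "\<exists>C. \<forall>x. (1 + norm x) ^ m * norm (f x) \<le> C"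
  shows "\<exists>C. \<forall>x. (1 + norm x) ^ m * norm (f (a + L x)) \<le> C"
proof -
  obtain K where K: "K > 0" "\<And>x. 1 + norm x \<le> K * (1 + norm (a + L x))"
    using one_plus_norm_affine_le[OF L, of a] by blast
  obtain C where C: "\<And>x. (1 + norm x) ^ m * norm (f x) \<le> C" using f by blast
  have "(1 + norm x) ^ m * norm (f (a + L x)) \<le> K ^ m * C" for x
  proof -
    have "(1 + norm x) ^ m \<le> (K * (1 + norm (a + L x))) ^ m"
      by (intro power_mono K) simp
    then have "(1 + norm x) ^ m * norm (f (a + L x)) \<le> (K * (1 + norm (a + L x))) ^ m * norm (f (a + L x))"
      by (intro mult_right_mono) auto
    also have "\<dots> \<le> K ^ m * C"
      using mult_left_mono[OF C[of "a + L x"], of "K ^ m"] K(1)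
      by (simp add: power_mult_distrib mult_ac)
    finally show ?thesis .
  qed
  then show ?thesis by blast
qed

lemma has_derivative_compose_affine:
  fixes L :: "'a::euclidean_space \<Rightarrow> 'b::euclidean_space"
  assumes "linear L" "(f has_derivative f') (at (a + L x))"
  shows "((\<lambda>x. f (a + L x)) has_derivative (\<lambda>v. f' (L v))) (at x)"
proof -
  have "(L has_derivative L) (at x)"
    using assms(1) by (simp add: linear_conv_bounded_linear bounded_linear_imp_has_derivative)
  then have "((\<lambda>x. a + L x) has_derivative (\<lambda>v. L v)) (at x)" by (auto intro!: derivative_eq_intros)
  from diff_chain_at[OF this] show ?thesis using assms(2) by (simp add: o_def)
qed

lemma schwartz_compose_affine:
  fixes L :: "'a::euclidean_space \<Rightarrow> 'b::euclidean_space"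
    and f :: "'b \<Rightarrow> 'c::real_normed_vector"
  assumes L: "linear L" "inj L" and f: "schwartz f"
  shows "schwartz (\<lambda>x. f (a + L x))"
proof -
  let ?P = "\<lambda>g :: 'a \<Rightarrow> 'c. \<exists>f :: 'b \<Rightarrow> 'c. schwartz f \<and> g = (\<lambda>x. f (a + L x))"
  show ?thesis
  proof (rule schwartz_coinduct[where P = ?P])
    show "linear_combination ?P (\<lambda>x. f (a + L x))"
      using f by (intro linear_combination.base) auto
  next
    fix g :: "'a \<Rightarrow> 'c" and x assume "?P g"
    then obtain f where f: "schwartz f" "g = (\<lambda>x. f (a + L x))" by blast
    show "g differentiable (at x)"
      unfolding f differentiable_def
      by (intro exI) (rule has_derivative_compose_affine[OF L(1) schwartz_has_derivative[OF f(1)]])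
  next
    fix g :: "'a \<Rightarrow> 'c" and m assume "?P g"
    then obtain f where f: "schwartz f" "g = (\<lambda>x. f (a + L x))" by blast
    show "\<exists>C. \<forall>x. (1 + norm x) ^ m * norm (g x) \<le> C"
      unfolding f by (rule rapid_bound_affine[OF L schwartz_bound[OF f(1)]])
  next
    fix g :: "'a \<Rightarrow> 'c" and b :: 'a
    assume b: "b \<in> Basis" and "?P g"
    then obtain f where f: "schwartz f" "g = (\<lambda>x. f (a + L x))" by blast
    have "dir_deriv b g = (\<lambda>x. \<Sum>c\<in>Basis. (L b \<bullet> c) *\<^sub>R dir_deriv c f (a + L x))"
      unfolding f by (rule ext, rule dir_deriv_eqI,
        rule has_derivative_compose_affine[OF L(1) schwartz_has_derivative[OF f(1)]])
    moreover have "linear_combination ?P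
       (\<lambda>x. \<Sum>c\<in>Basis. (L b \<bullet> c) *\<^sub>R dir_deriv c f (a + L x))"
      by (rule linear_combination_sum, simp, simp, rule linear_combination.scale,
          rule linear_combination.base) (use schwartz_dir_deriv[OF f(1)] in blast)
    ultimately show "linear_combination ?P (dir_deriv b g)"
      by simp
  qed
qed
lemma one_plus_norm_Pair_le: "1 + norm (x, y) \<le> (1 + norm x) * (1 + norm y)"
proof -
  have "norm (x, y) \<le> norm x + norm y" by (rule norm_Pair_le)
  also have "\<dots> \<le> norm x + norm y + norm x * norm y" by simp
  finally show ?thesis by (simp add: algebra_simps)
qed

lemma schwartz_tensor:
  fixes f :: "'a::euclidean_space \<Rightarrow> 'c::real_normed_algebra" and g :: "'b::euclidean_space \<Rightarrow> 'c"
  assumes "schwartz f" "schwartz g"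
  shows "schwartz (\<lambda>p. f (fst p) * g (snd p))"
proof -
  let ?P = "\<lambda>h. \<exists>(f::'a \<Rightarrow> 'c) (g::'b \<Rightarrow> 'c). schwartz f \<and> schwartz g \<and> h = (\<lambda>p. f (fst p) * g (snd p))"
  show ?thesis
  proof (rule schwartz_coinduct[where P = ?P])
    show "linear_combination ?P
       (\<lambda>p. f (fst p) * g (snd p))"
      using assms by (intro linear_combination.base) auto
  next
    fix h :: "'a \<times> 'b \<Rightarrow> 'c" and p
    assume "?P h"
    then obtain f g where h: "schwartz (f::'a \<Rightarrow> 'c)" "schwartz (g::'b \<Rightarrow> 'c)" "h = (\<lambda>p. f (fst p) * g (snd p))"
      by blast
    have "(f \<circ> fst) differentiable (at p)" "(g \<circ> snd) differentiable (at p)"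
      by (intro differentiable_chain_at bounded_linear_imp_differentiable bounded_linear_fst
          bounded_linear_snd schwartz_differentiable h)+
    then have "(\<lambda>p. f (fst p)) differentiable (at p)" "(\<lambda>p. g (snd p)) differentiable (at p)"
      by (simp_all add: o_def)
    then show "h differentiable (at p)" unfolding h by (rule differentiable_mult)
  next
    fix h :: "'a \<times> 'b \<Rightarrow> 'c" and m
    assume "?P h"
    then obtain f g where h: "schwartz (f::'a \<Rightarrow> 'c)" "schwartz (g::'b \<Rightarrow> 'c)" "h = (\<lambda>p. f (fst p) * g (snd p))"
      by blast
    obtain C where C: "\<And>x. (1 + norm x) ^ m * norm (f x) \<le> C" using schwartz_bound[OF h(1)] by blast
    obtain D where D: "\<And>x. (1 + norm x) ^ m * norm (g x) \<le> D" using schwartz_bound[OF h(2)] by blast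
    have "(1 + norm p) ^ m * norm (h p) \<le> C * D" for p
    proof -
      obtain x y where p: "p = (x, y)" by fastforce
      have "(1 + norm p) ^ m * norm (h p) \<le> ((1 + norm x) * (1 + norm y)) ^ m * (norm (f x) * norm (g y))"
        unfolding p h by (intro mult_mono power_mono one_plus_norm_Pair_le)
          (auto intro: norm_mult_ineq)
      also have "\<dots> = ((1 + norm x) ^ m * norm (f x)) * ((1 + norm y) ^ m * norm (g y))"
        by (simp add: power_mult_distrib mult_ac)
      also have "\<dots> \<le> C * D"
        by (intro mult_mono C D mult_nonneg_nonneg order_trans[OF _ C[of x]]) auto
      finally show ?thesis .
    qed
    then show "\<exists>C. \<forall>p. (1 + norm p) ^ m * norm (h p) \<le> C" by blast
  next
    fix h :: "'a \<times> 'b \<Rightarrow> 'c" and b :: "'a \<times> 'b"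
    assume "?P h" and b: "b \<in> Basis"
    then obtain f g where h: "schwartz (f::'a \<Rightarrow> 'c)" "schwartz (g::'b \<Rightarrow> 'c)" "h = (\<lambda>p. f (fst p) * g (snd p))"
      by blast
    have D: "dir_deriv b h p = f (fst p) * frechet_derivative g (at (snd p)) (snd b)
         + frechet_derivative f (at (fst p)) (fst b) * g (snd p)" for p
      unfolding h
    proof (rule dir_deriv_eqI)
      have f: "(f has_derivative frechet_derivative f (at (fst p))) (at (fst p))"
       and g: "(g has_derivative frechet_derivative g (at (snd p))) (at (snd p))"
        by (intro frechet_derivativeI schwartz_differentiable h)+
      have f': "((\<lambda>p. f (fst p)) has_derivative (\<lambda>v. frechet_derivative f (at (fst p)) (fst v))) (at p)"
        using diff_chain_at[OF bounded_linear_imp_has_derivative[OF bounded_linear_fst] f] by (simp add: o_def)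
      have g': "((\<lambda>p. g (snd p)) has_derivative (\<lambda>v. frechet_derivative g (at (snd p)) (snd v))) (at p)"
        using diff_chain_at[OF bounded_linear_imp_has_derivative[OF bounded_linear_snd] g] by (simp add: o_def)
      show "((\<lambda>p. f (fst p) * g (snd p)) has_derivative (\<lambda>v. f (fst p) * frechet_derivative g (at (snd p)) (snd v)
         + frechet_derivative f (at (fst p)) (fst v) * g (snd p))) (at p)"
        by (rule has_derivative_mult[OF f' g'])
    qed
    have lin: "linear (frechet_derivative f (at x))" "linear (frechet_derivative g (at y))" for x y
      by (intro linear_frechet_derivative schwartz_differentiable h)+
    show "linear_combination ?P (dir_deriv b h)"
      using b unfolding Basis_prod_def
    proof
      assume "b \<in> (\<lambda>u. (u, 0)) ` Basis"
      then obtain c where c: "c \<in> Basis" "b = (c, 0)" by blast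
      have "dir_deriv b h = (\<lambda>p. dir_deriv c f (fst p) * g (snd p))"
        unfolding D by (rule ext) (simp add: D c linear_0[OF lin(2)] dir_deriv_def)
      then show ?thesis using h c by (auto intro!: linear_combination.base exI[of _ "dir_deriv c f"]
          exI[of _ g] schwartz_dir_deriv)
    next
      assume "b \<in> Pair 0 ` Basis"
      then obtain c where c: "c \<in> Basis" "b = (0, c)" by blast
      have "dir_deriv b h = (\<lambda>p. f (fst p) * dir_deriv c g (snd p))"
        unfolding D by (rule ext) (simp add: D c linear_0[OF lin(1)] dir_deriv_def)
      then show ?thesis using h c by (auto intro!: linear_combination.base exI[of _ "dir_deriv c g"]
          exI[of _ f] schwartz_dir_deriv)
    qed
  qed
qed

text \<open>A product is the tensor product restricted to the diagonal.\<close>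

lemma schwartz_mult:
  fixes f g :: "'a::euclidean_space \<Rightarrow> 'c::real_normed_algebra"
  assumes "schwartz f" "schwartz g"
  shows "schwartz (\<lambda>x. f x * g x)"
proof -
  have "linear (\<lambda>x::'a. (x, x))" by (rule linearI) auto
  moreover have "inj (\<lambda>x::'a. (x, x))" by (rule injI) simp
  ultimately show ?thesis
    using schwartz_compose_affine[OF _ _ schwartz_tensor[OF assms], of "\<lambda>x. (x, x)" 0] by simp
qed

lemma schwartz_cnj: "schwartz f \<Longrightarrow> schwartz (\<lambda>x. cnj (f x))"
  by (rule schwartz_bounded_linear[OF bounded_linear_cnj])

lemma schwartz_of_real: "schwartz f \<Longrightarrow> schwartz (\<lambda>x. complex_of_real (f x))"
  by (rule schwartz_bounded_linear[OF bounded_linear_of_real])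

lemma schwartz_shift_scale:
  fixes f :: "'a::euclidean_space \<Rightarrow> 'b::real_normed_vector"
  assumes "schwartz f" "c \<noteq> 0"
  shows "schwartz (\<lambda>x. f (a + c *\<^sub>R x))"
  using assms by (intro schwartz_compose_affine) (auto simp: inj_def intro!: linearI simp: algebra_simps)

section \<open>Rapidly decreasing functions\<close>

lemma rapid_mult_growth:
  fixes f g :: "'a::euclidean_space \<Rightarrow> 'c::{real_normed_field,second_countable_topology}"
  assumes f: "rapid f" and g[measurable]: "g \<in> borel_measurable borel"
    and K: "\<And>x. norm (g x) \<le> K * (1 + norm x) ^ N"
  shows "rapid (\<lambda>x. g x * f x)"
proof (rule rapidI)
  have [measurable]: "f \<in> borel_measurable borel" by (rule rapid_measurable[OF f])
  show "(\<lambda>x. g x * f x) \<in> borel_measurable borel" by measurable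
  fix m
  obtain C where C: "C > 0" "\<And>x. (1 + norm x) ^ (m + N) * norm (f x) \<le> C"
    using rapid_bound[OF f] by blast
  have K0: "0 \<le> K" using order_trans[OF norm_ge_zero K[of 0]] by simp
  have "(1 + norm x) ^ m * norm (g x * f x) \<le> K * C" for x
  proof -
    have "(1 + norm x) ^ m * norm (g x * f x) \<le> (1 + norm x) ^ m * (K * (1 + norm x) ^ N * norm (f x))"
      unfolding norm_mult by (intro mult_left_mono mult_right_mono K) auto
    also have "\<dots> = K * ((1 + norm x) ^ (m + N) * norm (f x))"
      by (simp add: power_add mult_ac)
    also have "\<dots> \<le> K * C" by (intro mult_left_mono C K0)
    finally show ?thesis .
  qed
  then show "\<exists>C. \<forall>x. (1 + norm x) ^ m * norm (g x * f x) \<le> C" by blast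
qed

lemma rapid_bounded: "rapid f \<Longrightarrow> \<exists>K. \<forall>x. norm (f x) \<le> K"
  by (rule rapid_bound[of f 0]) auto

lemma rapid_mult:
  fixes f g :: "'a::euclidean_space \<Rightarrow> 'c::{real_normed_field,second_countable_topology}"
  assumes f: "rapid f" and g: "rapid g"
  shows "rapid (\<lambda>x. f x * g x)"
proof -
  obtain K where "\<And>x. norm (f x) \<le> K" using rapid_bounded[OF f] by blast
  then show ?thesis
    using rapid_mult_growth[OF g rapid_measurable[OF f], of K 0] by simp
qed

lemma borel_measurable_cnj[measurable]: "cnj \<in> borel_measurable borel"
  by (intro borel_measurable_continuous_onI continuous_intros)

lemma rapid_cnj: "rapid f \<Longrightarrow> rapid (\<lambda>x. cnj (f x))"
  unfolding rapid_def by (auto intro: measurable_compose[OF _ borel_measurable_cnj])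

lemma rapid_norm_power2:
  fixes f :: "'a::euclidean_space \<Rightarrow> complex"
  assumes "rapid f"
  shows "rapid (\<lambda>x. (norm (f x))\<^sup>2)"
  using rapid_mult[OF assms assms] rapid_measurable[OF assms]
  unfolding rapid_def by (auto simp: norm_mult power2_eq_square)

lemma rapid_add:
  fixes f g :: "'a::euclidean_space \<Rightarrow> 'b::{real_normed_vector,second_countable_topology}"
  assumes "rapid f" "rapid g"
  shows "rapid (\<lambda>x. f x + g x)"
  using assms by (auto simp: rapid_def intro!: weighted_bound_add)

lemma rapid_diff:
  fixes f g :: "'a::euclidean_space \<Rightarrow> 'b::{real_normed_vector,second_countable_topology}"
  assumes f: "rapid f" and g: "rapid g"
  shows "rapid (\<lambda>x. f x - g x)"
proof -
  have "rapid (\<lambda>x. - g x)" using g by (auto simp: rapid_def)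
  from rapid_add[OF f this] show ?thesis by simp
qed

lemma rapid_compose_affine:
  fixes L :: "'a::euclidean_space \<Rightarrow> 'b::euclidean_space"
  assumes L: "linear L" "inj L" and f: "rapid f"
  shows "rapid (\<lambda>x. f (a + L x))"
proof (rule rapidI)
  have "L \<in> borel_measurable borel"
    by (intro borel_measurable_continuous_onI linear_continuous_on)
       (use L in \<open>simp add: linear_conv_bounded_linear\<close>)
  then show "(\<lambda>x. f (a + L x)) \<in> borel_measurable borel"
    using rapid_measurable[OF f] by measurable
  show "\<exists>C. \<forall>x. (1 + norm x) ^ m * norm (f (a + L x)) \<le> C" for m
    using f by (intro rapid_bound_affine[OF L]) (auto simp: rapid_def)
qed

lemma rapid_uminus:
  fixes f :: "'a::euclidean_space \<Rightarrow> 'b::real_normed_vector"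
  shows "rapid f \<Longrightarrow> rapid (\<lambda>x. f (- x))"
  using rapid_compose_affine[of uminus f 0] by (simp add: linear_uminus)

section \<open>Integration on Euclidean spaces\<close>

text \<open>Lebesgue measure is the image of the product measure over the basis under
  \<open>f \<mapsto> \<Sum>b\<in>Basis. f b *\<^sub>R b\<close>, so products of functions of single coordinates reduce to one dimension.\<close>

lemma
  fixes f :: "'a::euclidean_space \<Rightarrow> real \<Rightarrow> 'b::{real_normed_field,banach,second_countable_topology}"
  assumes "\<And>b. b \<in> Basis \<Longrightarrow> integrable lborel (f b)"
  shows integrable_prod_Basis: "integrable lborel (\<lambda>x::'a. \<Prod>b\<in>Basis. f b (x \<bullet> b))" (is ?I)
    and integral_prod_Basis: "(LINT x|lborel. (\<Prod>b\<in>Basis. f b (x \<bullet> b))) = (\<Prod>b\<in>Basis. (LINT s|lborel. f b s))" (is ?E)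
proof -
  interpret product_sigma_finite "\<lambda>_::'a. lborel :: real measure" ..
  have f[measurable]: "f b \<in> borel_measurable borel" if "b \<in> Basis" for b
    using borel_measurable_integrable[OF assms[OF that]] by simp
  have m: "(\<lambda>x::'a. \<Prod>b\<in>Basis. f b (x \<bullet> b)) \<in> borel_measurable borel"
    by (intro borel_measurable_prod measurable_compose[OF _ f]) auto
  have e: "(\<Prod>b\<in>Basis. f b ((\<Sum>c\<in>Basis. g c *\<^sub>R c) \<bullet> b)) = (\<Prod>b\<in>Basis. f b (g b))" for g :: "'a \<Rightarrow> real"
    by (intro prod.cong refl arg_cong[where f = "f _"]) (simp add: inner_sum_left_Basis)
  have s: "(\<lambda>g. \<Sum>c\<in>Basis. g c *\<^sub>R c) \<in> measurable (\<Pi>\<^sub>M b\<in>(Basis::'a set). lborel) borel" by measurable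
  show ?I
    by (subst lborel_eq, subst integrable_distr_eq[OF s m], unfold e)
       (intro product_integrable_prod assms finite_Basis)
  show ?E
    by (subst lborel_eq, subst integral_distr[OF s m], unfold e)
       (intro product_integral_prod assms finite_Basis)
qed

text \<open>The exponent \<open>2 * DIM('a)\<close> lets one factor \<open>(1 + norm x)\<^sup>2\<close> dominate each \<open>1 + (x \<bullet> b)\<^sup>2\<close>.\<close>

lemma integrable_inverse_polynomial:
  "integrable lborel (\<lambda>x::'a::euclidean_space. 1 / (1 + norm x) ^ (2 * DIM('a)))"
proof (rule Bochner_Integration.integrable_bound)
  have "integrable lborel (\<lambda>s::real. inverse (1 + s\<^sup>2))"
    using integrable_inverse_1_plus_square by (simp add: set_integrable_def einterval_def)
  then show "integrable lborel (\<lambda>x::'a. \<Prod>b\<in>Basis. inverse (1 + (x \<bullet> b)\<^sup>2))"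
    by (intro integrable_prod_Basis)
  have "1 / (1 + norm x) ^ (2 * DIM('a)) \<le> (\<Prod>b\<in>Basis. inverse (1 + (x \<bullet> b)\<^sup>2))" for x :: 'a
  proof -
    have "1 / (1 + norm x) ^ (2 * DIM('a)) = (\<Prod>b\<in>(Basis::'a set). inverse ((1 + norm x)\<^sup>2))"
      by (simp add: power_mult inverse_eq_divide power_divide power_one_over)
    also have "\<dots> \<le> (\<Prod>b\<in>Basis. inverse (1 + (x \<bullet> b)\<^sup>2))"
    proof (intro prod_mono conjI le_imp_inverse_le)
      fix b :: 'a assume "b \<in> Basis"
      then have "\<bar>x \<bullet> b\<bar> \<le> norm x" by (rule Basis_le_norm)
      then have "\<bar>x \<bullet> b\<bar>\<^sup>2 \<le> (norm x)\<^sup>2" by (intro power_mono) auto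
      then have "(x \<bullet> b)\<^sup>2 \<le> (norm x)\<^sup>2" by simp
      then show "1 + (x \<bullet> b)\<^sup>2 \<le> (1 + norm x)\<^sup>2"
        using norm_ge_zero[of x] by (simp only: power2_sum one_power2 mult_1_right mult_1 power_one; linarith)
    qed (auto intro: add_pos_nonneg)
    finally show ?thesis .
  qed
  then have "norm (1 / (1 + norm x) ^ (2 * DIM('a))) \<le> norm (\<Prod>b\<in>Basis. inverse (1 + (x \<bullet> b)\<^sup>2))"
    for x :: 'a
    by (simp only: real_norm_def) (rule abs_le_iff[THEN iffD2], auto intro: order_trans[OF _ abs_ge_self]
        order_trans[of _ 0])
  then show "AE x in (lborel :: 'a measure). norm (1 / (1 + norm x) ^ (2 * DIM('a)))
      \<le> norm (\<Prod>b\<in>Basis. inverse (1 + (x \<bullet> b)\<^sup>2))"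
    by (intro AE_I2)
qed auto

lemma integrable_of_bound:
  fixes f :: "'a::euclidean_space \<Rightarrow> 'b::{banach,second_countable_topology}"
  assumes "f \<in> borel_measurable borel" and "\<And>x. (1 + norm x) ^ (2 * DIM('a)) * norm (f x) \<le> C"
  shows "integrable lborel f"
proof (rule Bochner_Integration.integrable_bound)
  show "integrable lborel (\<lambda>x::'a. C * (1 / (1 + norm x) ^ (2 * DIM('a))))"
    by (intro integrable_mult_right integrable_inverse_polynomial)
  have "norm (f x) \<le> C * (1 / (1 + norm x) ^ (2 * DIM('a)))" for x
    using assms(2)[of x] one_plus_norm_power_pos[of x "2 * DIM('a)"] by (simp add: field_simps)
  then show "AE x in lborel. norm (f x) \<le> norm (C * (1 / (1 + norm x) ^ (2 * DIM('a))))"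
    by (intro AE_I2) (metis abs_ge_self order_trans real_norm_def)
qed (use assms in auto)

lemma rapid_integrable:
  fixes f :: "'a::euclidean_space \<Rightarrow> 'b::{banach,second_countable_topology}"
  assumes "rapid f"
  shows "integrable lborel f"
proof -
  obtain C where "\<And>x. (1 + norm x) ^ (2 * DIM('a)) * norm (f x) \<le> C"
    using rapid_bound[OF assms] by blast
  then show ?thesis by (rule integrable_of_bound[OF rapid_measurable[OF assms]])
qed

lemma schwartz_integrable:
  fixes f :: "'a::euclidean_space \<Rightarrow> 'b::{banach,second_countable_topology}"
  shows "schwartz f \<Longrightarrow> integrable lborel f"
  by (intro rapid_integrable schwartz_rapid)

lemma
  fixes f :: "'a::euclidean_space \<times> 'b::euclidean_space \<Rightarrow> 'c::{banach,second_countable_topology}"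
  assumes "integrable lborel f"
  shows lborel_integral_fst: "(LINT x|lborel. LINT y|lborel. f (x, y)) = integral\<^sup>L lborel f"
    and lborel_integral_snd: "(LINT y|lborel. LINT x|lborel. f (x, y)) = integral\<^sup>L lborel f"
    and lborel_integral_swap: "(LINT x|lborel. LINT y|lborel. f (x, y)) = (LINT y|lborel. LINT x|lborel. f (x, y))"
    and lborel_integrable_fst: "integrable lborel (\<lambda>x. LINT y|lborel. f (x, y))"
proof -
  have i: "integrable (lborel \<Otimes>\<^sub>M lborel) f" using assms by (simp add: lborel_prod)
  show 1: "(LINT x|lborel. LINT y|lborel. f (x, y)) = integral\<^sup>L lborel f"
    using lborel_pair.integral_fst'[OF i] by (simp add: lborel_prod)
  show 2: "(LINT y|lborel. LINT x|lborel. f (x, y)) = integral\<^sup>L lborel f"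
    using lborel_pair.integral_snd[of "\<lambda>x y. f (x, y)"] i by (simp add: lborel_prod)
  show "(LINT x|lborel. LINT y|lborel. f (x, y)) = (LINT y|lborel. LINT x|lborel. f (x, y))"
    using 1 2 by simp
  show "integrable lborel (\<lambda>x. LINT y|lborel. f (x, y))"
    by (rule lborel_pair.integrable_fst'[OF i])
qed

lemma integrable_tensor:
  fixes f :: "'a::euclidean_space \<Rightarrow> 'c::{real_normed_field,banach,second_countable_topology}"
    and g :: "'b::euclidean_space \<Rightarrow> 'c"
  assumes f: "integrable lborel f" and g: "integrable lborel g"
  shows "integrable lborel (\<lambda>p. f (fst p) * g (snd p))"
proof -
  have [measurable]: "f \<in> borel_measurable borel" "g \<in> borel_measurable borel"
    using f g borel_measurable_integrable by force+
  have "integrable (lborel \<Otimes>\<^sub>M lborel) (\<lambda>p. f (fst p) * g (snd p))"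
  proof (rule lborel_pair.Fubini_integrable)
    show "integrable lborel (\<lambda>x. LINT y|lborel. norm (f (fst (x, y)) * g (snd (x, y))))"
      using f g by (simp add: norm_mult)
  qed (use f g in auto)
  then show ?thesis by (simp add: lborel_prod)
qed

lemma
  fixes f :: "'a::euclidean_space \<Rightarrow> 'b::{banach,second_countable_topology}"
  assumes c: "c \<noteq> 0" and f[measurable]: "f \<in> borel_measurable borel"
  shows lborel_integral_affine: "(LINT x|lborel. f x) = \<bar>c\<bar> ^ DIM('a) *\<^sub>R (LINT x|lborel. f (t + c *\<^sub>R x))"
    and lborel_integrable_affine: "integrable lborel (\<lambda>x. f (t + c *\<^sub>R x)) \<longleftrightarrow> integrable lborel f"
proof -
  have "(LINT x|lborel. f x) = (LINT x|density (distr lborel borel (\<lambda>x. t + c *\<^sub>R x)) (\<lambda>_. \<bar>c\<bar> ^ DIM('a)). f x)"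
    by (simp only: lborel_affine[OF c, of t, symmetric])
  also have "\<dots> = \<bar>c\<bar> ^ DIM('a) *\<^sub>R (LINT x|lborel. f (t + c *\<^sub>R x))"
    by (subst integral_density) (auto simp: integral_distr)
  finally show "(LINT x|lborel. f x) = \<bar>c\<bar> ^ DIM('a) *\<^sub>R (LINT x|lborel. f (t + c *\<^sub>R x))" .
  have "integrable lborel f \<longleftrightarrow> integrable (density (distr lborel borel (\<lambda>x. t + c *\<^sub>R x)) (\<lambda>_. \<bar>c\<bar> ^ DIM('a))) f"
    by (simp only: lborel_affine[OF c, of t, symmetric])
  also have "\<dots> \<longleftrightarrow> integrable lborel (\<lambda>x. f (t + c *\<^sub>R x))"
  proof (subst integrable_density)
    have "integrable lborel (\<lambda>x. f (t + c *\<^sub>R x))" if "integrable lborel (\<lambda>x. \<bar>c\<bar> ^ DIM('a) *\<^sub>R f (t + c *\<^sub>R x))"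
      using integrable_scaleR_right[OF that, of "inverse (\<bar>c\<bar> ^ DIM('a))"] c by simp
    then show "integrable (distr lborel borel (\<lambda>x. t + c *\<^sub>R x)) (\<lambda>x. \<bar>c\<bar> ^ DIM('a) *\<^sub>R f x)
        \<longleftrightarrow> integrable lborel (\<lambda>x. f (t + c *\<^sub>R x))"
      by (auto simp: integrable_distr_eq)
  qed auto
  finally show "integrable lborel (\<lambda>x. f (t + c *\<^sub>R x)) \<longleftrightarrow> integrable lborel f" by simp
qed

lemma lborel_integral_shift:
  fixes f :: "'a::euclidean_space \<Rightarrow> 'b::{banach,second_countable_topology}"
  assumes "f \<in> borel_measurable borel"
  shows "(LINT x|lborel. f (t + x)) = (LINT x|lborel. f x)"
  using lborel_integral_affine[OF _ assms, of 1 t] by simp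

lemma lborel_integral_uminus:
  fixes f :: "'a::euclidean_space \<Rightarrow> 'b::{banach,second_countable_topology}"
  assumes "f \<in> borel_measurable borel"
  shows "(LINT x|lborel. f (- x)) = (LINT x|lborel. f x)"
  using lborel_integral_affine[OF _ assms, of "-1" 0] by simp

lemma lborel_integral_midpoint:
  fixes f :: "'a::euclidean_space \<Rightarrow> 'a \<Rightarrow> 'b::{banach,second_countable_topology}"
  assumes "(\<lambda>x. f (x - \<eta> /\<^sub>R 2) (x + \<eta> /\<^sub>R 2)) \<in> borel_measurable borel"
  shows "(LINT x|lborel. f (x - \<eta> /\<^sub>R 2) (x + \<eta> /\<^sub>R 2)) = (LINT x|lborel. f x (x + \<eta>))"
proof -
  have "\<eta> /\<^sub>R 2 + \<eta> /\<^sub>R 2 = \<eta>" by (simp flip: scaleR_add_left)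
  then have "(\<eta> /\<^sub>R 2 + x) + \<eta> /\<^sub>R 2 = x + \<eta>" for x
    by (metis add.assoc add.commute)
  then show ?thesis
    using lborel_integral_shift[OF assms, of "\<eta> /\<^sub>R 2"] by (simp only: add_diff_cancel_left')
qed

text \<open>The derivative is the integral of the derivatives, as a total derivative in the parameter: the
  mean value inequality bounds the normalised remainders by \<open>2 * B\<close>, and dominated convergence
  applies along any sequence tending to the base point.\<close>

lemma has_derivative_integral:
  fixes f :: "'a::{real_normed_vector,perfect_space} \<Rightarrow> 'b \<Rightarrow> 'c::{banach,second_countable_topology}"
  assumes "e > 0" and B: "integrable M B"
    and deriv: "\<And>\<eta> x. \<eta> \<in> ball \<eta>0 e \<Longrightarrow> x \<in> space M \<Longrightarrow> ((\<lambda>\<eta>. f \<eta> x) has_derivative f' \<eta> x) (at \<eta>)"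
    and bound: "\<And>\<eta> x v. \<eta> \<in> ball \<eta>0 e \<Longrightarrow> x \<in> space M \<Longrightarrow> norm (f' \<eta> x v) \<le> B x * norm v"
    and int: "\<And>\<eta>. \<eta> \<in> ball \<eta>0 e \<Longrightarrow> integrable M (f \<eta>)"
    and meas: "\<And>v. (\<lambda>x. f' \<eta>0 x v) \<in> borel_measurable M"
  shows "((\<lambda>\<eta>. LINT x|M. f \<eta> x) has_derivative (\<lambda>v. LINT x|M. f' \<eta>0 x v)) (at \<eta>0)"
proof -
  have \<eta>0: "\<eta>0 \<in> ball \<eta>0 e" using assms by simp
  have lin: "bounded_linear (f' \<eta>0 x)" if "x \<in> space M" for x
    using deriv[OF \<eta>0 that] by (rule has_derivative_bounded_linear)
  have intf': "integrable M (\<lambda>x. f' \<eta>0 x v)" for v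
  proof (rule Bochner_Integration.integrable_bound)
    show "integrable M (\<lambda>x. B x * norm v)" using B by simp
    show "AE x in M. norm (f' \<eta>0 x v) \<le> norm (B x * norm v)"
      using bound[OF \<eta>0, of _ v] by (intro AE_I2) (metis abs_ge_self order_trans real_norm_def)
  qed (rule meas)
  have bl: "bounded_linear (\<lambda>v. LINT x|M. f' \<eta>0 x v)"
  proof (rule bounded_linear_intro)
    show "(LINT x|M. f' \<eta>0 x (v + w)) = (LINT x|M. f' \<eta>0 x v) + (LINT x|M. f' \<eta>0 x w)" for v w
      by (subst Bochner_Integration.integral_add[symmetric, OF intf' intf'])
         (auto intro!: Bochner_Integration.integral_cong simp: linear_add[OF bounded_linear.linear[OF lin]])
    show "(LINT x|M. f' \<eta>0 x (r *\<^sub>R v)) = r *\<^sub>R (LINT x|M. f' \<eta>0 x v)" for r v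
      unfolding integral_scaleR_right[symmetric]
      by (intro Bochner_Integration.integral_cong refl linear_scale[OF bounded_linear.linear[OF lin]])
    show "norm (LINT x|M. f' \<eta>0 x v) \<le> norm v * (LINT x|M. B x)" for v
    proof -
      have "norm (LINT x|M. f' \<eta>0 x v) \<le> (LINT x|M. B x * norm v)"
        by (rule order_trans[OF integral_norm_bound integral_mono]) (use intf' B bound[OF \<eta>0] in auto)
      then show ?thesis by (simp add: mult.commute)
    qed
  qed
  \<comment> \<open>The remainder of the linear approximation, normalised by the increment.\<close>
  define r where "r = (\<lambda>\<eta> x. (f \<eta> x - f \<eta>0 x - f' \<eta>0 x (\<eta> - \<eta>0)) /\<^sub>R norm (\<eta> - \<eta>0))"
  have rlim: "((\<lambda>\<eta>. LINT x|M. r \<eta> x) \<longlongrightarrow> 0) (at \<eta>0)"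
    unfolding tendsto_at_iff_sequentially comp_def
  proof (intro allI impI)
    fix X assume X: "\<forall>i. X i \<in> UNIV - {\<eta>0}" "X \<longlonglongrightarrow> \<eta>0"
    from X(2) \<open>e > 0\<close> obtain N where N: "\<And>n. n \<ge> N \<Longrightarrow> X n \<in> ball \<eta>0 e"
      unfolding lim_sequentially by (auto simp: dist_commute)
    define Y where "Y = (\<lambda>n. X (n + N))"
    have Y: "Y n \<in> ball \<eta>0 e" "Y n \<noteq> \<eta>0" for n using N[of "n + N"] X(1) by (auto simp: Y_def)
    have Ylim: "Y \<longlonglongrightarrow> \<eta>0" unfolding Y_def using X(2) by (rule LIMSEQ_ignore_initial_segment)
    have "(\<lambda>n. LINT x|M. r (Y n) x) \<longlonglongrightarrow> (LINT x|M. 0)"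
    proof (rule integral_dominated_convergence[where w = "\<lambda>x. 2 * B x"])
      show "(\<lambda>x. r (Y n) x) \<in> borel_measurable M" for n
        unfolding r_def using int[OF Y(1)[of n]] int[OF \<eta>0] meas
        by (intro borel_measurable_scaleR borel_measurable_diff borel_measurable_const meas)
           (auto intro: borel_measurable_integrable)
      show "AE x in M. (\<lambda>n. r (Y n) x) \<longlonglongrightarrow> 0"
      proof (rule AE_I2)
        fix x assume x: "x \<in> space M"
        have "((\<lambda>\<eta>. norm (f \<eta> x - f \<eta>0 x - f' \<eta>0 x (\<eta> - \<eta>0)) / norm (\<eta> - \<eta>0)) \<longlongrightarrow> 0) (at \<eta>0)"
          using deriv[OF \<eta>0 x] unfolding has_derivative_iff_norm by simp
        then have "(\<lambda>n. norm (f (Y n) x - f \<eta>0 x - f' \<eta>0 x (Y n - \<eta>0)) / norm (Y n - \<eta>0)) \<longlonglongrightarrow> 0"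
          unfolding tendsto_at_iff_sequentially comp_def using Y Ylim by simp
        then show "(\<lambda>n. r (Y n) x) \<longlonglongrightarrow> 0"
          by (subst tendsto_norm_zero_iff[symmetric]) (simp add: r_def divide_inverse_commute)
      qed
      show "AE x in M. norm (r (Y n) x) \<le> 2 * B x" for n
      proof (rule AE_I2)
        fix x assume x: "x \<in> space M"
        have B0: "onorm (f' \<eta> x) \<le> B x" if "\<eta> \<in> ball \<eta>0 e" for \<eta>
          by (rule onorm_le) (rule bound[OF that x])
        have "norm (f (Y n) x - f \<eta>0 x) \<le> B x * norm (Y n - \<eta>0)"
          by (rule differentiable_bound[of "ball \<eta>0 e" _ "\<lambda>\<eta>. f' \<eta> x"])
             (use x Y \<eta>0 B0 in \<open>auto intro: has_derivative_at_withinI[OF deriv]\<close>)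
        moreover have "norm (f' \<eta>0 x (Y n - \<eta>0)) \<le> B x * norm (Y n - \<eta>0)"
          using bound[OF \<eta>0 x] .
        ultimately have "norm (f (Y n) x - f \<eta>0 x - f' \<eta>0 x (Y n - \<eta>0)) \<le> 2 * B x * norm (Y n - \<eta>0)"
          using norm_triangle_ineq4[of "f (Y n) x - f \<eta>0 x" "f' \<eta>0 x (Y n - \<eta>0)"] by linarith
        then show "norm (r (Y n) x) \<le> 2 * B x"
          using Y(2)[of n] by (simp add: r_def divide_inverse_commute[symmetric] pos_divide_le_eq)
      qed
    qed (use B in auto)
    then show "(\<lambda>n. LINT x|M. r (X n) x) \<longlonglongrightarrow> 0"
      unfolding Y_def by (simp add: LIMSEQ_offset[of "\<lambda>n. LINT x|M. r (X n) x"])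
  qed
  have ev: "\<forall>\<^sub>F \<eta> in at \<eta>0. \<eta> \<in> ball \<eta>0 e"
    using \<open>e > 0\<close> by (auto simp: eventually_at dist_commute)
  have "((\<lambda>\<eta>. norm ((LINT x|M. f \<eta> x) - (LINT x|M. f \<eta>0 x) - (LINT x|M. f' \<eta>0 x (\<eta> - \<eta>0))) / norm (\<eta> - \<eta>0))
     \<longlongrightarrow> 0) (at \<eta>0)"
  proof (rule Lim_transform_eventually[OF tendsto_norm_zero[OF rlim]])
    show "\<forall>\<^sub>F \<eta> in at \<eta>0. norm (LINT x|M. r \<eta> x) =
        norm ((LINT x|M. f \<eta> x) - (LINT x|M. f \<eta>0 x) - (LINT x|M. f' \<eta>0 x (\<eta> - \<eta>0))) / norm (\<eta> - \<eta>0)"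
      using ev
    proof eventually_elim
      case (elim \<eta>)
      have "(LINT x|M. r \<eta> x) = ((LINT x|M. f \<eta> x) - (LINT x|M. f \<eta>0 x) - (LINT x|M. f' \<eta>0 x (\<eta> - \<eta>0))) /\<^sub>R norm (\<eta> - \<eta>0)"
        unfolding r_def using int[OF elim] int[OF \<eta>0] intf' by simp
      then show ?case by (simp add: divide_inverse_commute)
    qed
  qed
  then show ?thesis unfolding has_derivative_iff_norm using bl by simp
qed

lemma one_plus_norm_shift_le:
  assumes "norm v \<le> 1"
  shows "1 + norm x \<le> 2 * (1 + norm (x + v))"
proof -
  have "norm x \<le> norm (x + v) + norm v" using norm_triangle_ineq4[of "x + v" v] by simp
  then show ?thesis using assms norm_ge_zero[of "x + v"] unfolding distrib_left by linarith
qed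

text \<open>The integral of \<open>f (s *\<^sub>R b + x)\<close> over \<open>x\<close> does not depend on \<open>s\<close>; its derivative in \<open>s\<close> at zero
  is the integral of the directional derivative.\<close>

lemma integral_derivative_eq_0:
  fixes f :: "'a::euclidean_space \<Rightarrow> 'b::{banach,second_countable_topology}"
  assumes deriv: "\<And>x. (f has_derivative D x) (at x)"
    and f: "rapid f" and D: "rapid (\<lambda>x. D x b)"
  shows "(LINT x|lborel. D x b) = 0"
proof (cases "b = 0")
  case True
  then show ?thesis
    using linear_0[OF has_derivative_linear[OF deriv]] by simp
next
  case b: False
  let ?N = "2 * DIM('a)" and ?e = "1 / norm b"
  obtain C where C: "C > 0" "\<And>x. (1 + norm x) ^ ?N * norm (D x b) \<le> C"
    using rapid_bound[OF D] by blast
  have fm: "f \<in> borel_measurable borel" using f by (rule rapid_measurable)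
  have "((\<lambda>s::real. LINT x|lborel. f (s *\<^sub>R b + x)) has_derivative (\<lambda>r. LINT x|lborel. r *\<^sub>R D (0 *\<^sub>R b + x) b)) (at 0)"
  proof (rule has_derivative_integral[where e = ?e and B = "\<lambda>x. 2 ^ ?N * C * (1 / (1 + norm x) ^ ?N)"
        and f' = "\<lambda>s x r. r *\<^sub>R D (s *\<^sub>R b + x) b"])
    show "integrable lborel (\<lambda>x::'a. 2 ^ ?N * C * (1 / (1 + norm x) ^ ?N))"
      by (intro integrable_mult_right integrable_inverse_polynomial)
    show "((\<lambda>s. f (s *\<^sub>R b + x)) has_derivative (\<lambda>r. r *\<^sub>R D (s *\<^sub>R b + x) b)) (at s)" for s x
    proof -
      have "((\<lambda>s. s *\<^sub>R b + x) has_derivative (\<lambda>r. r *\<^sub>R b)) (at s)"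
        by (auto intro!: derivative_eq_intros)
      from diff_chain_at[OF this deriv] show ?thesis
        by (simp add: o_def linear_scale[OF has_derivative_linear[OF deriv]])
    qed
    show "norm (r *\<^sub>R D (s *\<^sub>R b + x) b) \<le> 2 ^ ?N * C * (1 / (1 + norm x) ^ ?N) * norm r"
      if "s \<in> ball 0 ?e" for s x r
    proof -
      have "norm (s *\<^sub>R b) \<le> 1" using that b by (simp add: field_simps)
      then have "1 + norm x \<le> 2 * (1 + norm (s *\<^sub>R b + x))"
        using one_plus_norm_shift_le[of "s *\<^sub>R b" x] by (simp add: add.commute)
      then have "(1 + norm x) ^ ?N \<le> 2 ^ ?N * (1 + norm (s *\<^sub>R b + x)) ^ ?N"
        unfolding power_mult_distrib[symmetric] by (intro power_mono) auto
      then have "(1 + norm x) ^ ?N * norm (D (s *\<^sub>R b + x) b)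
          \<le> 2 ^ ?N * (1 + norm (s *\<^sub>R b + x)) ^ ?N * norm (D (s *\<^sub>R b + x) b)"
        by (rule mult_right_mono) simp
      also have "\<dots> \<le> 2 ^ ?N * C"
        using C(2)[of "s *\<^sub>R b + x"] by simp
      finally have "norm (D (s *\<^sub>R b + x) b) \<le> 2 ^ ?N * C * (1 / (1 + norm x) ^ ?N)"
        using one_plus_norm_power_pos[of x ?N] by (simp add: field_simps)
      from mult_right_mono[OF this, of "norm r"] show ?thesis by (simp add: mult_ac)
    qed
    show "integrable lborel (\<lambda>x. f (s *\<^sub>R b + x))" for s
      using lborel_integrable_affine[of 1 f "s *\<^sub>R b"] fm rapid_integrable[OF f] by simp
    show "(\<lambda>x. r *\<^sub>R D (0 *\<^sub>R b + x) b) \<in> borel_measurable lborel" for r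
      using rapid_measurable[OF D] by simp
  qed (use b in auto)
  moreover have "(\<lambda>s::real. LINT x|lborel. f (s *\<^sub>R b + x)) = (\<lambda>s. LINT x|lborel. f x)"
    using lborel_integral_shift[OF fm] by blast
  ultimately have "((\<lambda>s::real. LINT x|lborel. f x) has_derivative (\<lambda>r. LINT x|lborel. r *\<^sub>R D x b)) (at 0)"
    by simp
  moreover have "((\<lambda>s::real. LINT x|lborel. f x) has_derivative (\<lambda>r. 0)) (at 0)" by simp
  ultimately have "(\<lambda>r::real. LINT x|lborel. r *\<^sub>R D x b) = (\<lambda>r. 0)"
    by (rule has_derivative_unique)
  from fun_cong[OF this, of 1] show ?thesis by simp
qed

section \<open>The Fourier transform of Schwartz functions\<close>

lemma borel_measurable_cis[measurable]: "cis \<in> borel_measurable borel"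
proof -
  have "continuous_on UNIV cis"
    unfolding cis_conv_exp by (intro continuous_intros)
  then show ?thesis by (rule borel_measurable_continuous_onI)
qed

lemma fourier_eq_cis: "fourier f k = (LINT x|lborel. cis (- (k \<bullet> x)) * f x)"
  unfolding fourier_def cis_conv_exp by simp

lemma fourier_inv_eq_cis:
  "fourier_inv g (x::'a::euclidean_space) =
     of_real (1 / (2 * pi) ^ DIM('a)) * (LINT k|lborel. cis (k \<bullet> x) * g k)"
  unfolding fourier_inv_def cis_conv_exp by simp

lemma integrable_cis_mult:
  assumes "integrable M f" "\<phi> \<in> borel_measurable M"
  shows "integrable M (\<lambda>x. cis (\<phi> x) * f x)"
proof (rule Bochner_Integration.integrable_bound[OF assms(1)])
  show "(\<lambda>x. cis (\<phi> x) * f x) \<in> borel_measurable M"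
    using assms borel_measurable_integrable by (intro borel_measurable_times) (auto intro: measurable_compose)
qed (simp add: norm_mult)

lemma fourier_norm_le:
  assumes "integrable lborel f"
  shows "norm (fourier f k) \<le> (LINT x|lborel. norm (f x))"
  unfolding fourier_eq_cis
  by (rule order_trans[OF integral_norm_bound]) (simp add: norm_mult)

lemma fourier_measurable:
  assumes [measurable]: "f \<in> borel_measurable borel"
  shows "fourier f \<in> borel_measurable borel"
proof -
  have "(\<lambda>k. LINT x|lborel. cis (- (k \<bullet> x)) * f x) \<in> borel_measurable borel"
    by measurable
  then show ?thesis by (simp add: fourier_eq_cis[abs_def])
qed

definition gaussian :: "'a::euclidean_space \<Rightarrow> real" where
  "gaussian x = exp (- ((norm x)\<^sup>2) / 2)"

lemma gaussian_measurable[measurable]: "gaussian \<in> borel_measurable borel"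
  unfolding gaussian_def[abs_def] by measurable

text \<open>This is the characteristic function of the standard normal distribution.\<close>

lemma
  shows integrable_fourier_gaussian_real:
      "integrable lborel (\<lambda>s. cis (t * s) * of_real (exp (- s\<^sup>2 / 2)))" (is ?I)
    and fourier_gaussian_real:
      "(LINT s|lborel. cis (t * s) * of_real (exp (- s\<^sup>2 / 2))) = of_real (sqrt (2 * pi) * exp (- t\<^sup>2 / 2))" (is ?E)
proof -
  have "integrable lborel (\<lambda>s. sqrt (2 * pi) * std_normal_density s)"
    using integrable_normal_moment[of 1 0 0] by simp
  then have "integrable lborel (\<lambda>s::real. exp (- s\<^sup>2 / 2))"
    by (simp add: std_normal_density_def)
  then have "integrable lborel (\<lambda>s::real. complex_of_real (exp (- s\<^sup>2 / 2)))" by (rule integrable_of_real)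
  then show ?I by (rule integrable_cis_mult) measurable
  have "of_real (exp (- t\<^sup>2 / 2)) = char std_normal_distribution t"
    by (simp add: char_std_normal_distribution)
  also have "\<dots> = (LINT s|lborel. std_normal_density s *\<^sub>R cis (t * s))"
    unfolding char_def by (subst integral_density) (auto simp: cis_conv_exp)
  also have "\<dots> = (LINT s|lborel. of_real (1 / sqrt (2 * pi)) * (cis (t * s) * of_real (exp (- s\<^sup>2 / 2))))"
    by (intro Bochner_Integration.integral_cong refl)
       (simp add: std_normal_density_def scaleR_conv_of_real)
  also have "\<dots> = of_real (1 / sqrt (2 * pi)) * (LINT s|lborel. cis (t * s) * of_real (exp (- s\<^sup>2 / 2)))"
    by simp
  finally have "of_real (exp (- t\<^sup>2 / 2)) =
    of_real (1 / sqrt (2 * pi)) * (LINT s|lborel. cis (t * s) * of_real (exp (- s\<^sup>2 / 2)))" .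
  then show ?E by (simp add: field_simps)
qed

lemma norm_power2_eq_sum_Basis: "(norm (x::'a::euclidean_space))\<^sup>2 = (\<Sum>b\<in>Basis. (x \<bullet> b)\<^sup>2)"
  unfolding power2_norm_eq_inner by (subst euclidean_inner) (simp add: power2_eq_square)

lemma
  shows integrable_fourier_gaussian:
      "integrable lborel (\<lambda>x::'a::euclidean_space. cis (- (k \<bullet> x)) * of_real (gaussian x))" (is ?I)
    and fourier_gaussian:
      "(LINT x|lborel. cis (- (k \<bullet> x)) * of_real (gaussian x)) = of_real (sqrt (2 * pi) ^ DIM('a) * gaussian k)" (is ?E)
proof -
  have e: "cis (- (k \<bullet> x)) * of_real (gaussian x)
      = (\<Prod>b\<in>Basis. cis ((- (k \<bullet> b)) * (x \<bullet> b)) * of_real (exp (- (x \<bullet> b)\<^sup>2 / 2)))" for x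
  proof -
    have "cis (- (k \<bullet> x)) = (\<Prod>b\<in>Basis. cis ((- (k \<bullet> b)) * (x \<bullet> b)))"
      unfolding cis_conv_exp exp_sum[OF finite_Basis, symmetric]
      by (subst euclidean_inner) (simp add: sum_negf sum_distrib_left)
    moreover have "gaussian x = (\<Prod>b\<in>Basis. exp (- (x \<bullet> b)\<^sup>2 / 2))"
      unfolding gaussian_def exp_sum[OF finite_Basis, symmetric]
      by (simp add: norm_power2_eq_sum_Basis sum_negf sum_divide_distrib)
    ultimately show ?thesis by (simp add: prod.distrib)
  qed
  show ?I unfolding e by (intro integrable_prod_Basis integrable_fourier_gaussian_real)
  have "(LINT x|lborel. cis (- (k \<bullet> x)) * of_real (gaussian x)) =
      (\<Prod>b\<in>Basis. of_real (sqrt (2 * pi) * exp (- (- (k \<bullet> b))\<^sup>2 / 2)))"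
    unfolding e
    by (subst integral_prod_Basis) (intro integrable_fourier_gaussian_real, simp only: fourier_gaussian_real)
  also have "\<dots> = of_real (sqrt (2 * pi) ^ DIM('a) * gaussian k)"
    by (simp add: prod.distrib gaussian_def norm_power2_eq_sum_Basis exp_sum[symmetric] sum_negf
        sum_divide_distrib of_real_prod[symmetric] exp_of_real[symmetric])
  finally show ?E .
qed

lemma integrable_gaussian: "integrable lborel (gaussian :: 'a::euclidean_space \<Rightarrow> real)"
  using integrable_fourier_gaussian[of 0] by (simp add: complex_of_real_integrable_eq)

lemma integral_gaussian: "(LINT x|lborel. gaussian (x::'a::euclidean_space)) = sqrt (2 * pi) ^ DIM('a)"
proof -
  have "complex_of_real (LINT x|lborel. gaussian (x::'a)) = of_real (sqrt (2 * pi) ^ DIM('a))"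
    using fourier_gaussian[of "0::'a"] by (simp add: gaussian_def)
  then show ?thesis by (simp only: of_real_eq_iff)
qed

lemma gaussian_le_1: "gaussian x \<le> 1" and gaussian_nonneg: "0 \<le> gaussian x"
  by (auto simp: gaussian_def)

lemma has_derivative_cis_inner:
  "((\<lambda>x. cis (- (k \<bullet> x))) has_derivative (\<lambda>v. - \<i> * of_real (k \<bullet> v) * cis (- (k \<bullet> x)))) (at x)"
proof -
  have "((\<lambda>x. \<i> * complex_of_real (- (k \<bullet> x))) has_derivative (\<lambda>v. \<i> * complex_of_real (- (k \<bullet> v)))) (at x)"
    by (auto intro!: derivative_eq_intros)
  from diff_chain_at[OF this DERIV_exp[unfolded has_field_derivative_def]]
  show ?thesis by (simp add: o_def cis_conv_exp mult_ac)
qed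

lemma schwartz_bounded: "schwartz f \<Longrightarrow> \<exists>K. \<forall>x. norm (f x) \<le> K"
  using schwartz_bound[of f 0] by simp

text \<open>Integrate the derivative of \<open>cis (- (k \<bullet> x)) * f x\<close>, which contributes nothing by
  \<open>integral_derivative_eq_0\<close>.\<close>

lemma fourier_dir_deriv:
  fixes f :: "'a::euclidean_space \<Rightarrow> complex"
  assumes f: "schwartz f" and b: "b \<in> Basis"
  shows "fourier (dir_deriv b f) k = \<i> * of_real (k \<bullet> b) * fourier f k"
proof -
  let ?D = "\<lambda>x v. cis (- (k \<bullet> x)) * frechet_derivative f (at x) v + - \<i> * of_real (k \<bullet> v) * cis (- (k \<bullet> x)) * f x"
  have cm: "(\<lambda>x::'a. cis (- (k \<bullet> x))) \<in> borel_measurable borel" by measurable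
  have rf: "rapid (\<lambda>x. cis (- (k \<bullet> x)) * g x)" if g: "rapid g" for g :: "'a \<Rightarrow> complex"
    using g cm unfolding rapid_def by (auto simp: norm_mult)
  have rg: "rapid (dir_deriv b f)" "rapid f"
    using f b schwartz_dir_deriv schwartz_rapid by blast+
  have rs: "rapid (\<lambda>x. dir_deriv b f x - \<i> * of_real (k \<bullet> b) * f x)"
    using schwartz_rapid[OF schwartz_diff[OF schwartz_dir_deriv[OF f b]
      schwartz_bounded_linear[OF bounded_linear_mult_right[of "\<i> * of_real (k \<bullet> b)"] f]]] .
  have D: "?D x b = cis (- (k \<bullet> x)) * (dir_deriv b f x - \<i> * of_real (k \<bullet> b) * f x)" for x
    by (simp add: dir_deriv_def algebra_simps)
  have "(LINT x|lborel. ?D x b) = 0"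
  proof (rule integral_derivative_eq_0[where D = ?D and f = "\<lambda>x. cis (- (k \<bullet> x)) * f x"])
    show "((\<lambda>x. cis (- (k \<bullet> x)) * f x) has_derivative ?D x) (at x)" for x
      by (rule has_derivative_mult[OF has_derivative_cis_inner
            frechet_derivativeI[OF schwartz_differentiable[OF f]]])
    show "rapid (\<lambda>x. cis (- (k \<bullet> x)) * f x)" by (rule rf[OF rg(2)])
    show "rapid (\<lambda>x. ?D x b)" unfolding D by (rule rf[OF rs])
  qed
  then have "(LINT x|lborel. cis (- (k \<bullet> x)) * dir_deriv b f x - \<i> * of_real (k \<bullet> b) * (cis (- (k \<bullet> x)) * f x)) = 0"
    unfolding D by (simp add: algebra_simps)
  moreover have "integrable lborel (\<lambda>x. cis (- (k \<bullet> x)) * dir_deriv b f x)"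
     "integrable lborel (\<lambda>x. cis (- (k \<bullet> x)) * f x)"
    using rf rg rapid_integrable by blast+
  ultimately show ?thesis
    unfolding fourier_eq_cis by (subst (asm) Bochner_Integration.integral_diff) auto
qed

lemma fourier_iterated_dir_deriv:
  fixes f :: "'a::euclidean_space \<Rightarrow> complex"
  assumes f: "schwartz f" and b: "b \<in> Basis"
  shows "fourier (foldr dir_deriv (replicate m b) f) k = (\<i> * of_real (k \<bullet> b)) ^ m * fourier f k"
proof (induction m)
  case (Suc m)
  have "schwartz (foldr dir_deriv (replicate m b) f)"
    using f b by (intro schwartz_foldr_dir_deriv) auto
  from fourier_dir_deriv[OF this b] Suc show ?case by (simp add: mult.assoc)
qed simp

text \<open>Reduces polynomial weights to pure powers of single coordinates, which the Fourier transform
  turns into iterated derivatives in one direction.\<close>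

lemma one_plus_norm_power_le:
  fixes k :: "'a::euclidean_space"
  shows "(1 + norm k) ^ m \<le> (1 + real DIM('a)) ^ m * (1 + (\<Sum>b\<in>Basis. \<bar>k \<bullet> b\<bar> ^ m))"
proof -
  define c where "c = Max (insert 1 ((\<lambda>b. \<bar>k \<bullet> b\<bar>) ` Basis))"
  have c: "1 \<le> c" "\<And>b. b \<in> Basis \<Longrightarrow> \<bar>k \<bullet> b\<bar> \<le> c"
    unfolding c_def by (rule Max_ge; simp)+
  have "c \<in> insert 1 ((\<lambda>b. \<bar>k \<bullet> b\<bar>) ` Basis)" unfolding c_def by (intro Max_in) auto
  then have cm: "c ^ m \<le> 1 + (\<Sum>b\<in>Basis. \<bar>k \<bullet> b\<bar> ^ m)"
  proof
    assume "c = 1"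
    then show ?thesis by (simp add: sum_nonneg)
  next
    assume "c \<in> (\<lambda>b. \<bar>k \<bullet> b\<bar>) ` Basis"
    then obtain b where b: "b \<in> Basis" "c = \<bar>k \<bullet> b\<bar>" by blast
    have "\<bar>k \<bullet> b\<bar> ^ m \<le> (\<Sum>b\<in>Basis. \<bar>k \<bullet> b\<bar> ^ m)"
      using b(1) by (intro member_le_sum) auto
    with b show ?thesis by simp
  qed
  have "norm k \<le> (\<Sum>b\<in>Basis. \<bar>k \<bullet> b\<bar>)" by (rule norm_le_l1)
  also have "\<dots> \<le> (\<Sum>b\<in>(Basis::'a set). c)" by (intro sum_mono c)
  finally have "1 + norm k \<le> (1 + real DIM('a)) * c" using c(1) by (simp add: distrib_right)
  then have "(1 + norm k) ^ m \<le> ((1 + real DIM('a)) * c) ^ m" by (intro power_mono) auto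
  also have "\<dots> \<le> (1 + real DIM('a)) ^ m * (1 + (\<Sum>b\<in>Basis. \<bar>k \<bullet> b\<bar> ^ m))"
    unfolding power_mult_distrib by (intro mult_left_mono cm) auto
  finally show ?thesis .
qed

text \<open>The bound is explicit in \<open>f\<close> because it is applied uniformly to a family of slices of a function
  of two variables.\<close>

lemma fourier_decay:
  fixes f :: "'a::euclidean_space \<Rightarrow> complex"
  assumes f: "schwartz f"
  shows "(1 + norm k) ^ m * norm (fourier f k) \<le> (1 + real DIM('a)) ^ m *
    ((LINT x|lborel. norm (f x)) + (\<Sum>b\<in>Basis. LINT x|lborel. norm (foldr dir_deriv (replicate m b) f x)))"
proof -
  have "(1 + norm k) ^ m * norm (fourier f k)
      \<le> (1 + real DIM('a)) ^ m * (1 + (\<Sum>b\<in>Basis. \<bar>k \<bullet> b\<bar> ^ m)) * norm (fourier f k)"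
    by (intro mult_right_mono one_plus_norm_power_le) auto
  also have "\<dots> = (1 + real DIM('a)) ^ m * (norm (fourier f k) + (\<Sum>b\<in>Basis. \<bar>k \<bullet> b\<bar> ^ m * norm (fourier f k)))"
    by (simp add: distrib_right sum_distrib_right mult.assoc)
  also have "\<dots> \<le> (1 + real DIM('a)) ^ m *
    ((LINT x|lborel. norm (f x)) + (\<Sum>b\<in>Basis. LINT x|lborel. norm (foldr dir_deriv (replicate m b) f x)))"
  proof (intro mult_left_mono add_mono sum_mono)
    show "norm (fourier f k) \<le> (LINT x|lborel. norm (f x))"
      by (intro fourier_norm_le schwartz_integrable f)
    fix b :: 'a assume b: "b \<in> Basis"
    have "\<bar>k \<bullet> b\<bar> ^ m * norm (fourier f k) = norm (fourier (foldr dir_deriv (replicate m b) f) k)"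
      unfolding fourier_iterated_dir_deriv[OF f b] by (simp add: norm_mult norm_power)
    also have "\<dots> \<le> (LINT x|lborel. norm (foldr dir_deriv (replicate m b) f x))"
      using b by (intro fourier_norm_le schwartz_integrable schwartz_foldr_dir_deriv f) auto
    finally show "\<bar>k \<bullet> b\<bar> ^ m * norm (fourier f k) \<le> (LINT x|lborel. norm (foldr dir_deriv (replicate m b) f x))" .
  qed auto
  finally show ?thesis .
qed

lemma fourier_rapid:
  fixes f :: "'a::euclidean_space \<Rightarrow> complex"
  assumes f: "schwartz f"
  shows "rapid (fourier f)"
  using fourier_decay[OF f] fourier_measurable[OF rapid_measurable[OF schwartz_rapid[OF f]]]
  unfolding rapid_def by blast

text \<open>Inversion with a Gaussian factor of width \<open>1 / e\<close> in frequency. After exchanging the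
  integrals, the inner one is the Fourier transform of the Gaussian; the factor \<open>e ^ DIM('a)\<close>
  from substituting \<open>x + e *\<^sub>R z\<close> for the outer variable is the one that rescales it to the
  standard Gaussian.\<close>

lemma fourier_inversion_scaled:
  fixes f :: "'a::euclidean_space \<Rightarrow> complex"
  assumes f: "integrable lborel f" and e: "e > 0"
  shows "(LINT k|lborel. (cis (k \<bullet> x) * fourier f k) * of_real (gaussian (e *\<^sub>R k))) =
         of_real (sqrt (2 * pi) ^ DIM('a)) * (LINT z|lborel. of_real (gaussian z) * f (x + e *\<^sub>R z))"
proof -
  let ?g = "\<lambda>k::'a. complex_of_real (gaussian (e *\<^sub>R k))"
  have [measurable]: "f \<in> borel_measurable borel" using borel_measurable_integrable[OF f] by simp
  have g: "integrable lborel ?g"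
    using lborel_integrable_affine[of e "gaussian :: 'a \<Rightarrow> real" 0] e integrable_gaussian
    by (simp add: complex_of_real_integrable_eq)
  have int: "integrable lborel (\<lambda>p. cis (fst p \<bullet> x - fst p \<bullet> snd p) * (?g (fst p) * f (snd p)))"
    by (rule integrable_cis_mult[OF integrable_tensor[OF g f]])
       (simp, intro borel_measurable_continuous_onI continuous_intros)
  have inner: "e ^ DIM('a) *\<^sub>R (LINT k|lborel. cis (k \<bullet> x - k \<bullet> (x + e *\<^sub>R z)) * ?g k) =
      of_real (sqrt (2 * pi) ^ DIM('a) * gaussian z)" for z
  proof -
    have "of_real (sqrt (2 * pi) ^ DIM('a) * gaussian z) = (LINT k|lborel. cis (- (z \<bullet> k)) * of_real (gaussian k))"
      by (rule fourier_gaussian[symmetric])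
    also have "\<dots> = e ^ DIM('a) *\<^sub>R (LINT k|lborel. cis (- (z \<bullet> (0 + e *\<^sub>R k))) * of_real (gaussian (0 + e *\<^sub>R k)))"
      using e by (subst lborel_integral_affine[of e _ 0]) auto
    also have "\<dots> = e ^ DIM('a) *\<^sub>R (LINT k|lborel. cis (k \<bullet> x - k \<bullet> (x + e *\<^sub>R z)) * ?g k)"
      by (simp add: inner_add_right inner_commute)
    finally show ?thesis by simp
  qed
  have "(LINT k|lborel. (cis (k \<bullet> x) * fourier f k) * ?g k) =
      (LINT k|lborel. LINT y|lborel. cis (k \<bullet> x - k \<bullet> y) * (?g k * f y))"
    unfolding fourier_eq_cis
    by (intro Bochner_Integration.integral_cong refl)
       (simp add: mult_ac cis_mult integral_mult_right_zero[symmetric] del: integral_mult_right_zero)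
  also have "\<dots> = (LINT y|lborel. LINT k|lborel. cis (k \<bullet> x - k \<bullet> y) * (?g k * f y))"
    using lborel_integral_swap[OF int] by simp
  also have "\<dots> = (LINT y|lborel. f y * (LINT k|lborel. cis (k \<bullet> x - k \<bullet> y) * ?g k))"
    by (intro Bochner_Integration.integral_cong refl)
       (simp add: mult_ac integral_mult_right_zero[symmetric] del: integral_mult_right_zero)
  also have "\<dots> = e ^ DIM('a) *\<^sub>R (LINT z|lborel. f (x + e *\<^sub>R z) *
      (LINT k|lborel. cis (k \<bullet> x - k \<bullet> (x + e *\<^sub>R z)) * ?g k))"
    using e by (subst lborel_integral_affine[of e _ x]) auto
  also have "\<dots> = (LINT z|lborel. f (x + e *\<^sub>R z) *
      (e ^ DIM('a) *\<^sub>R (LINT k|lborel. cis (k \<bullet> x - k \<bullet> (x + e *\<^sub>R z)) * ?g k)))"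
    by (simp only: integral_scaleR_right mult_scaleR_right)
  also have "\<dots> = (LINT z|lborel. of_real (sqrt (2 * pi) ^ DIM('a)) * (of_real (gaussian z) * f (x + e *\<^sub>R z)))"
    unfolding inner by (simp add: mult_ac)
  finally show ?thesis by simp
qed

text \<open>Let \<open>e\<close> tend to zero: the Gaussian factor tends to one in frequency, while in space the Gaussian
  average concentrates at \<open>x\<close>.\<close>

theorem fourier_inversion:
  fixes f :: "'a::euclidean_space \<Rightarrow> complex"
  assumes f: "integrable lborel f" and f': "integrable lborel (fourier f)"
    and cont: "continuous_on UNIV f" and bdd: "\<And>x. norm (f x) \<le> K"
  shows "(LINT k|lborel. cis (k \<bullet> x) * fourier f k) = of_real ((2 * pi) ^ DIM('a)) * f x"
proof -
  let ?e = "\<lambda>m. inverse (real (Suc m))"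
  have e: "?e m > 0" for m by simp
  have elim: "?e \<longlonglongrightarrow> 0" by (rule LIMSEQ_inverse_real_of_nat)
  have [measurable]: "f \<in> borel_measurable borel" using borel_measurable_integrable[OF f] by simp
  have [measurable]: "fourier f \<in> borel_measurable borel" by (rule fourier_measurable) measurable
  have "(\<lambda>m. LINT k|lborel. (cis (k \<bullet> x) * fourier f k) * of_real (gaussian (?e m *\<^sub>R k)))
      \<longlonglongrightarrow> (LINT k|lborel. (cis (k \<bullet> x) * fourier f k) * of_real 1)"
  proof (rule integral_dominated_convergence[where w = "\<lambda>k. norm (fourier f k)"])
    show "AE k in lborel. (\<lambda>m. (cis (k \<bullet> x) * fourier f k) * of_real (gaussian (?e m *\<^sub>R k)))
        \<longlonglongrightarrow> (cis (k \<bullet> x) * fourier f k) * of_real 1"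
    proof (rule AE_I2)
      fix k :: 'a
      have "(\<lambda>m. gaussian (?e m *\<^sub>R k)) \<longlonglongrightarrow> exp (- ((norm (0 *\<^sub>R k))\<^sup>2) / 2)"
        unfolding gaussian_def by (intro tendsto_intros elim) auto
      then have "(\<lambda>m. gaussian (?e m *\<^sub>R k)) \<longlonglongrightarrow> 1" by simp
      then show "(\<lambda>m. (cis (k \<bullet> x) * fourier f k) * of_real (gaussian (?e m *\<^sub>R k)))
        \<longlonglongrightarrow> (cis (k \<bullet> x) * fourier f k) * of_real 1" by (intro tendsto_intros)
    qed
    show "AE k in lborel. norm ((cis (k \<bullet> x) * fourier f k) * of_real (gaussian (?e m *\<^sub>R k)))
        \<le> norm (fourier f k)" for m
      using mult_left_le[OF gaussian_le_1 norm_ge_zero]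
      by (intro AE_I2) (simp add: norm_mult gaussian_nonneg)
  qed (use f' in auto)
  moreover have "(\<lambda>m. of_real (sqrt (2 * pi) ^ DIM('a)) * (LINT z|lborel. of_real (gaussian z) * f (x + ?e m *\<^sub>R z)))
      \<longlonglongrightarrow> of_real (sqrt (2 * pi) ^ DIM('a)) * (LINT z|lborel. of_real (gaussian (z::'a)) * f x)"
  proof (intro tendsto_mult tendsto_const integral_dominated_convergence[where w = "\<lambda>z. K * gaussian z"])
    show "AE z in lborel. (\<lambda>m. of_real (gaussian z) * f (x + ?e m *\<^sub>R z)) \<longlonglongrightarrow> of_real (gaussian z) * f x"
    proof (rule AE_I2, intro tendsto_mult tendsto_const)
      fix z :: 'a
      have "(\<lambda>m. x + ?e m *\<^sub>R z) \<longlonglongrightarrow> x + 0 *\<^sub>R z" by (intro tendsto_intros elim)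
      then show "(\<lambda>m. f (x + ?e m *\<^sub>R z)) \<longlonglongrightarrow> f x"
        using continuous_on_tendsto_compose[OF cont, of "\<lambda>m. x + ?e m *\<^sub>R z" x] by simp
    qed
    show "AE z in lborel. norm (of_real (gaussian z) * f (x + ?e m *\<^sub>R z)) \<le> K * gaussian z" for m
      using mult_right_mono[OF bdd gaussian_nonneg]
      by (intro AE_I2) (simp add: norm_mult gaussian_nonneg mult.commute)
  qed (use integrable_gaussian in auto)
  ultimately have "(LINT k|lborel. cis (k \<bullet> x) * fourier f k) =
      of_real (sqrt (2 * pi) ^ DIM('a)) * (LINT z|lborel. of_real (gaussian (z::'a)) * f x)"
    unfolding fourier_inversion_scaled[OF f e] by (simp add: LIMSEQ_unique)
  also have "\<dots> = of_real (sqrt (2 * pi) ^ DIM('a)) * (of_real (sqrt (2 * pi) ^ DIM('a)) * f x)"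
    by (simp add: integral_gaussian)
  also have "\<dots> = of_real ((2 * pi) ^ DIM('a)) * f x"
    by (simp only: mult.assoc[symmetric] of_real_mult[symmetric] power_mult_distrib[symmetric]) simp
  finally show ?thesis .
qed

lemma schwartz_fourier_inversion:
  fixes f :: "'a::euclidean_space \<Rightarrow> complex"
  assumes "schwartz f"
  shows "(LINT k|lborel. cis (k \<bullet> x) * fourier f k) = of_real ((2 * pi) ^ DIM('a)) * f x"
proof -
  obtain K where K: "\<And>x. norm (f x) \<le> K" using schwartz_bounded[OF assms] by blast
  show ?thesis
    by (rule fourier_inversion[OF schwartz_integrable[OF assms] rapid_integrable[OF
          fourier_rapid[OF assms]] schwartz_continuous[OF assms] K])
qed

theorem plancherel:
  fixes f :: "'a::euclidean_space \<Rightarrow> complex"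
  assumes f: "schwartz f"
  shows "(LINT k|lborel. (norm (fourier f k))\<^sup>2) = (2 * pi) ^ DIM('a) * (LINT x|lborel. (norm (f x))\<^sup>2)"
proof -
  have fi: "integrable lborel f" by (rule schwartz_integrable[OF f])
  have fci: "integrable lborel (\<lambda>x. cnj (f x))" using fi by simp
  have Fi: "integrable lborel (fourier f)"
    by (rule rapid_integrable[OF fourier_rapid[OF f]])
  have int: "integrable lborel (\<lambda>p. cis (fst p \<bullet> snd p) * (fourier f (fst p) * cnj (f (snd p))))"
    by (rule integrable_cis_mult[OF integrable_tensor[OF Fi fci]])
       (simp, intro borel_measurable_continuous_onI continuous_intros)
  have cnjF: "cnj (fourier f k) = (LINT x|lborel. cis (k \<bullet> x) * cnj (f x))" for k
    unfolding fourier_eq_cis by (subst Bochner_Integration.integral_cnj[symmetric]) (simp add: cis_cnj)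
  have "complex_of_real (LINT k|lborel. (norm (fourier f k))\<^sup>2) = (LINT k|lborel. fourier f k * cnj (fourier f k))"
    by (subst integral_complex_of_real[symmetric]) (simp only: complex_norm_square)
  also have "\<dots> = (LINT k|lborel. LINT x|lborel. cis (k \<bullet> x) * (fourier f k * cnj (f x)))"
    unfolding cnjF
    by (intro Bochner_Integration.integral_cong refl)
       (simp add: mult_ac integral_mult_right_zero[symmetric] del: integral_mult_right_zero)
  also have "\<dots> = (LINT x|lborel. LINT k|lborel. cis (k \<bullet> x) * (fourier f k * cnj (f x)))"
    using lborel_integral_swap[OF int] by simp
  also have "\<dots> = (LINT x|lborel. (LINT k|lborel. cis (k \<bullet> x) * fourier f k) * cnj (f x))"
    by (intro Bochner_Integration.integral_cong refl)
       (simp add: mult.assoc[symmetric])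
  also have "\<dots> = (LINT x|lborel. of_real ((2 * pi) ^ DIM('a)) * of_real ((norm (f x))\<^sup>2))"
    unfolding schwartz_fourier_inversion[OF f] by (simp only: mult.assoc complex_norm_square)
  also have "\<dots> = of_real ((2 * pi) ^ DIM('a) * (LINT x|lborel. (norm (f x))\<^sup>2))"
    unfolding of_real_mult[symmetric] integral_complex_of_real by simp
  finally show ?thesis by (simp only: of_real_eq_iff)
qed

section \<open>The Fourier transform of the Wigner function\<close>

lemma dir_deriv_compose_affine:
  fixes L :: "'a::euclidean_space \<Rightarrow> 'b::euclidean_space"
  assumes "linear L" "f differentiable (at (a + L x))"
  shows "dir_deriv b (\<lambda>x. f (a + L x)) x = dir_deriv (L b) f (a + L x)"
  using dir_deriv_eqI[OF has_derivative_compose_affine[OF assms(1) frechet_derivativeI[OF assms(2)]]]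
  by (simp add: dir_deriv_def)

lemma
  fixes g :: "'a::euclidean_space \<times> 'b::euclidean_space \<Rightarrow> 'c::real_normed_vector"
  assumes "schwartz g"
  shows schwartz_slice: "schwartz (\<lambda>y. g (x, y))"
    and dir_deriv_slice: "dir_deriv b (\<lambda>y. g (x, y)) = (\<lambda>y. dir_deriv (0, b) g (x, y))"
    and schwartz_slice': "schwartz (\<lambda>x. g (x, y))"
    and dir_deriv_slice': "dir_deriv c (\<lambda>x. g (x, y)) = (\<lambda>x. dir_deriv (c, 0) g (x, y))"
proof -
  have L: "linear (\<lambda>y::'b. (0::'a, y))" "inj (\<lambda>y::'b. (0::'a, y))"
     and L': "linear (\<lambda>x::'a. (x, 0::'b))" "inj (\<lambda>x::'a. (x, 0::'b))"
    by (auto simp: inj_def intro!: linearI)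
  show "schwartz (\<lambda>y. g (x, y))" "schwartz (\<lambda>x. g (x, y))"
    using schwartz_compose_affine[OF L assms, of "(x, 0)"]
      schwartz_compose_affine[OF L' assms, of "(0, y)"] by simp_all
  show "dir_deriv b (\<lambda>y. g (x, y)) = (\<lambda>y. dir_deriv (0, b) g (x, y))"
    using dir_deriv_compose_affine[OF L(1) schwartz_differentiable[OF assms], of b "(x, 0)"] by auto
  show "dir_deriv c (\<lambda>x. g (x, y)) = (\<lambda>x. dir_deriv (c, 0) g (x, y))"
    using dir_deriv_compose_affine[OF L'(1) schwartz_differentiable[OF assms], of c "(0, y)"] by auto
qed

lemma Pair_0_in_Basis: "b \<in> Basis \<Longrightarrow> (0, b) \<in> Basis" "b \<in> Basis \<Longrightarrow> (b, 0) \<in> Basis"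
  by (auto simp: Basis_prod_def)

lemma foldr_dir_deriv_slice:
  fixes g :: "'a::euclidean_space \<times> 'b::euclidean_space \<Rightarrow> 'c::real_normed_vector"
  assumes "schwartz g" "b \<in> Basis"
  shows "foldr dir_deriv (replicate m b) (\<lambda>y. g (x, y)) = (\<lambda>y. foldr dir_deriv (replicate m (0, b)) g (x, y))"
proof (induction m)
  case (Suc m)
  have "schwartz (foldr dir_deriv (replicate m (0, b)) g)"
    using assms Pair_0_in_Basis by (intro schwartz_foldr_dir_deriv) auto
  from dir_deriv_slice[OF this] Suc show ?case by simp
qed simp

lemma one_plus_norm_le_Pair:
  "1 + norm x \<le> 1 + norm (x, y)" "1 + norm y \<le> 1 + norm (x, y)"
  by (auto simp: norm_Pair intro: real_le_rsqrt real_sqrt_sum_squares_ge1 real_sqrt_sum_squares_ge2)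

lemma rapid_slice_bound:
  fixes g :: "'a::euclidean_space \<times> 'b::euclidean_space \<Rightarrow> 'c::real_normed_vector"
  assumes "rapid g"
  obtains C where "C > 0" "\<And>x y. norm (g (x, y)) \<le> C / ((1 + norm x) ^ m * (1 + norm y) ^ n)"
proof -
  obtain C where C: "C > 0" "\<And>p. (1 + norm p) ^ (m + n) * norm (g p) \<le> C"
    using rapid_bound[OF assms] by blast
  have "norm (g (x, y)) \<le> C / ((1 + norm x) ^ m * (1 + norm y) ^ n)" for x y
  proof -
    have "(1 + norm x) ^ m * (1 + norm y) ^ n \<le> (1 + norm (x, y)) ^ (m + n)"
      unfolding power_add by (intro mult_mono power_mono one_plus_norm_le_Pair) auto
    from mult_right_mono[OF this, of "norm (g (x, y))"] C(2)[of "(x, y)"]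
    show ?thesis
      using one_plus_norm_power_pos[of x m] one_plus_norm_power_pos[of y n] by (simp add: field_simps)
  qed
  with C(1) show ?thesis by (rule that)
qed

lemma rapid_slice_L1:
  fixes g :: "'a::euclidean_space \<times> 'b::euclidean_space \<Rightarrow> 'c::{banach,second_countable_topology}"
  assumes "rapid g"
  shows "\<exists>C. \<forall>x. (1 + norm x) ^ m * (LINT y|lborel. norm (g (x, y))) \<le> C"
proof -
  let ?n = "2 * DIM('b)"
  obtain C where C: "C > 0" "\<And>x y. norm (g (x, y)) \<le> C / ((1 + norm x) ^ m * (1 + norm y) ^ ?n)"
    using rapid_slice_bound[OF assms] by blast
  have "(1 + norm x) ^ m * (LINT y|lborel. norm (g (x, y))) \<le> C * (LINT y|lborel. 1 / (1 + norm (y::'b)) ^ ?n)" for x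
  proof -
    have "(LINT y|lborel. norm (g (x, y))) \<le> (LINT y|lborel. C / (1 + norm x) ^ m * (1 / (1 + norm (y::'b)) ^ ?n))"
    proof (rule integral_mono_AE')
      show "integrable lborel (\<lambda>y::'b. C / (1 + norm x) ^ m * (1 / (1 + norm y) ^ ?n))"
        by (intro integrable_mult_right integrable_inverse_polynomial)
    qed (use C in auto)
    then have "(1 + norm x) ^ m * (LINT y|lborel. norm (g (x, y)))
        \<le> (1 + norm x) ^ m * (LINT y|lborel. C / (1 + norm x) ^ m * (1 / (1 + norm (y::'b)) ^ ?n))"
      by (rule mult_left_mono) simp
    also have "\<dots> = C * (LINT y|lborel. 1 / (1 + norm (y::'b)) ^ ?n)"
      unfolding integral_mult_right_zero using one_plus_norm_pos[of x, THEN less_imp_neq] by simp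
    finally show ?thesis .
  qed
  then show ?thesis by blast
qed

text \<open>Applied to \<open>u(x + y / 2) cnj (u(x - y / 2))\<close> this shows that the Wigner function is integrable in both
  variables jointly. Without that its double Fourier transform would be the default value zero of a
  divergent integral.\<close>

lemma partial_fourier_rapid:
  fixes g :: "'a::euclidean_space \<times> 'b::euclidean_space \<Rightarrow> complex"
  assumes g: "schwartz g"
  shows "rapid (\<lambda>p. fourier (\<lambda>y. g (fst p, y)) (snd p))"
proof (rule rapidI)
  have "(\<lambda>q. cis (- (snd (fst q) \<bullet> snd q)) * g (fst (fst q), snd q)) \<in> borel_measurable borel"
    unfolding cis_conv_exp
    by (intro borel_measurable_continuous_onI continuous_intros
        continuous_on_compose2[OF schwartz_continuous[OF g, of UNIV]]) auto
  moreover have "sets ((borel :: ('a \<times> 'b) measure) \<Otimes>\<^sub>M (lborel :: 'b measure)) = sets borel"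
    by (subst borel_prod[symmetric], rule sets_pair_measure_cong) simp_all
  ultimately have "(\<lambda>q. cis (- (snd (fst q) \<bullet> snd q)) * g (fst (fst q), snd q)) \<in>
      borel_measurable ((borel :: ('a \<times> 'b) measure) \<Otimes>\<^sub>M lborel)"
    by (simp cong: measurable_cong_sets)
  then show "(\<lambda>p. fourier (\<lambda>y. g (fst p, y)) (snd p)) \<in> borel_measurable borel"
    unfolding fourier_eq_cis by (intro lborel.borel_measurable_lebesgue_integral) (simp add: case_prod_beta')
  fix m
  let ?D = "\<lambda>b. foldr dir_deriv (replicate m (0, b)) g"
  have rD: "rapid (?D b)" if "b \<in> Basis" for b
    using that Pair_0_in_Basis by (intro schwartz_rapid schwartz_foldr_dir_deriv g) auto
  obtain C0 where C0: "\<And>x. (1 + norm x) ^ m * (LINT y|lborel. norm (g (x, y))) \<le> C0"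
    using rapid_slice_L1[OF schwartz_rapid[OF g]] by blast
  have "\<forall>b\<in>Basis. \<exists>C. \<forall>x. (1 + norm x) ^ m * (LINT y|lborel. norm (?D b (x, y))) \<le> C"
    using rapid_slice_L1[OF rD] by blast
  then obtain C where C: "\<And>b x. b \<in> Basis \<Longrightarrow> (1 + norm x) ^ m * (LINT y|lborel. norm (?D b (x, y))) \<le> C b"
    by metis
  let ?K = "(1 + real DIM('b)) ^ m"
  have "(1 + norm p) ^ m * norm (fourier (\<lambda>y. g (fst p, y)) (snd p)) \<le> ?K * (C0 + (\<Sum>b\<in>Basis. C b))" for p
  proof -
    obtain x \<xi> where p: "p = (x, \<xi>)" by fastforce
    have slice: "(\<Sum>b\<in>Basis. LINT y|lborel. norm (foldr dir_deriv (replicate m b) (\<lambda>y. g (x, y)) y))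
        = (\<Sum>b\<in>Basis. LINT y|lborel. norm (?D b (x, y)))"
      by (intro sum.cong refl) (simp only: foldr_dir_deriv_slice[OF g])
    have "(1 + norm p) ^ m * norm (fourier (\<lambda>y. g (fst p, y)) (snd p))
        \<le> ((1 + norm x) * (1 + norm \<xi>)) ^ m * norm (fourier (\<lambda>y. g (x, y)) \<xi>)"
      unfolding p fst_conv snd_conv by (intro mult_right_mono power_mono one_plus_norm_Pair_le) auto
    also have "\<dots> = (1 + norm x) ^ m * ((1 + norm \<xi>) ^ m * norm (fourier (\<lambda>y. g (x, y)) \<xi>))"
      by (simp add: power_mult_distrib mult_ac)
    also have "\<dots> \<le> (1 + norm x) ^ m * (?K * ((LINT y|lborel. norm (g (x, y)))
        + (\<Sum>b\<in>Basis. LINT y|lborel. norm (?D b (x, y)))))"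
      using fourier_decay[OF schwartz_slice[OF g], of \<xi> m x] unfolding slice
      by (intro mult_left_mono) auto
    also have "\<dots> = ?K * ((1 + norm x) ^ m * (LINT y|lborel. norm (g (x, y)))
        + (\<Sum>b\<in>Basis. (1 + norm x) ^ m * (LINT y|lborel. norm (?D b (x, y)))))"
      by (simp add: distrib_left sum_distrib_left mult_ac)
    also have "\<dots> \<le> ?K * (C0 + (\<Sum>b\<in>Basis. C b))"
      by (intro mult_left_mono add_mono sum_mono C0 C) auto
    finally show ?thesis .
  qed
  then show "\<exists>C. \<forall>p. (1 + norm p) ^ m * norm (fourier (\<lambda>y. g (fst p, y)) (snd p)) \<le> C" by blast
qed

lemma schwartz_two_point:
  fixes f g :: "'a::euclidean_space \<Rightarrow> 'c::real_normed_algebra"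
  assumes "schwartz f" "schwartz g" "a \<noteq> b"
  shows "schwartz (\<lambda>p. f (fst p + a *\<^sub>R snd p) * g (fst p + b *\<^sub>R snd p))"
proof -
  let ?L = "\<lambda>p::'a \<times> 'a. (fst p + a *\<^sub>R snd p, fst p + b *\<^sub>R snd p)"
  have "linear ?L" by (rule linearI) (auto simp: algebra_simps)
  moreover have "inj ?L"
  proof (rule injI)
    fix p q :: "'a \<times> 'a" assume "?L p = ?L q"
    then have e: "fst p + a *\<^sub>R snd p = fst q + a *\<^sub>R snd q" "fst p + b *\<^sub>R snd p = fst q + b *\<^sub>R snd q" by auto
    have "(a - b) *\<^sub>R (snd p - snd q) = ((fst p + a *\<^sub>R snd p) - (fst p + b *\<^sub>R snd p))
        - ((fst q + a *\<^sub>R snd q) - (fst q + b *\<^sub>R snd q))" by (simp add: algebra_simps)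
    also have "\<dots> = 0" unfolding e by simp
    finally have "(a - b) *\<^sub>R (snd p - snd q) = 0" .
    then have "snd p = snd q" using assms(3) by simp
    with e show "p = q" by (simp add: prod_eq_iff)
  qed
  ultimately show ?thesis
    using schwartz_compose_affine[OF _ _ schwartz_tensor[OF assms(1,2)], of ?L 0] by simp
qed

text \<open>The Wigner function is a Fourier transform in \<open>y\<close>; transforming it back in \<open>\<xi>\<close> is Fourier
  inversion evaluated at \<open>y = - \<eta>\<close>.\<close>

theorem fourier_wigner_eq:
  fixes u :: "real^'n \<Rightarrow> complex"
  assumes u: "schwartz u"
  shows "fourier_wigner u (k, \<eta>) = fourier (\<lambda>x. u (x - \<eta> /\<^sub>R 2) * cnj (u (x + \<eta> /\<^sub>R 2))) k"
proof -
  define g where "g = (\<lambda>p::(real^'n) \<times> (real^'n). u (fst p + (1/2) *\<^sub>R snd p) * cnj (u (fst p + (-1/2) *\<^sub>R snd p)))"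
  have g: "schwartz g" unfolding g_def by (intro schwartz_two_point u schwartz_cnj) simp
  have w: "wigner u = (\<lambda>p. fourier (\<lambda>y. g (fst p, y)) (snd p))"
    unfolding wigner_def g_def fourier_def by (simp add: case_prod_beta' mult.assoc inverse_eq_divide)
  have int: "integrable lborel (\<lambda>p. cis (- ((k, \<eta>) \<bullet> p)) * wigner u p)"
    unfolding w
    by (intro integrable_cis_mult rapid_integrable partial_fourier_rapid g)
       (unfold measurable_lborel2, intro borel_measurable_continuous_onI continuous_intros)
  have "fourier (wigner u) (k, \<eta>) = (LINT x|lborel. LINT \<xi>|lborel. cis (- ((k, \<eta>) \<bullet> (x, \<xi>))) * wigner u (x, \<xi>))"
    unfolding fourier_eq_cis by (rule lborel_integral_fst[OF int, symmetric])
  also have "\<dots> = (LINT x|lborel. LINT \<xi>|lborel. cis (- (k \<bullet> x)) * (cis (\<xi> \<bullet> - \<eta>) * fourier (\<lambda>y. g (x, y)) \<xi>))"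
    unfolding w by (simp add: mult.assoc[symmetric] cis_mult inner_commute)
  also have "\<dots> = (LINT x|lborel. cis (- (k \<bullet> x)) * (of_real ((2 * pi) ^ CARD('n)) * g (x, - \<eta>)))"
    by (simp only: integral_mult_right_zero schwartz_fourier_inversion[OF schwartz_slice[OF g]]) simp
  also have "\<dots> = of_real ((2 * pi) ^ CARD('n)) * (LINT x|lborel. cis (- (k \<bullet> x)) * g (x, - \<eta>))"
    by (simp only: integral_mult_right_zero[symmetric] mult_ac)
  also have "(LINT x|lborel. cis (- (k \<bullet> x)) * g (x, - \<eta>)) = fourier (\<lambda>x. u (x - \<eta> /\<^sub>R 2) * cnj (u (x + \<eta> /\<^sub>R 2))) k"
    unfolding fourier_eq_cis g_def by (simp add: inverse_eq_divide)
  finally show ?thesis unfolding fourier_wigner_def by simp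
qed

lemma fourier_wigner_hermitian:
  assumes "schwartz u"
  shows "cnj (fourier_wigner u (- p)) = fourier_wigner u p"
proof -
  obtain k \<eta> where p: "p = (k, \<eta>)" by fastforce
  show ?thesis
    unfolding p fourier_wigner_eq[OF assms] uminus_Pair fourier_eq_cis
    by (subst Bochner_Integration.integral_cnj[symmetric]) (simp add: cis_cnj mult_ac)
qed

lemma schwartz_norm_power2:
  fixes u :: "'a::euclidean_space \<Rightarrow> complex"
  assumes "schwartz u"
  shows "schwartz (\<lambda>x. (norm (u x))\<^sup>2)"
proof -
  have "(\<lambda>x. (norm (u x))\<^sup>2) = (\<lambda>x. Re (u x * cnj (u x)))"
    by (simp only: complex_norm_square[symmetric] Re_complex_of_real)
  then show ?thesis
    using schwartz_bounded_linear[OF bounded_linear_Re schwartz_mult[OF assms schwartz_cnj[OF assms]]]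
    by simp
qed

lemma L2norm_power2: "(L2norm f)\<^sup>2 = (LINT x|lborel. (norm (f x))\<^sup>2)"
  unfolding L2norm_def by (simp add: real_sqrt_pow2)

lemma fourier_wigner_0:
  assumes "schwartz u"
  shows "fourier_wigner u (0, 0) = of_real ((L2norm u)\<^sup>2)"
  unfolding fourier_wigner_eq[OF assms] L2norm_power2 integral_complex_of_real[symmetric]
  by (simp add: fourier_eq_cis complex_norm_square[symmetric] del: of_real_power)

text \<open>By Plancherel's theorem in \<open>k\<close> the double integral becomes that of
  \<open>\<bar>u(x)\<bar>\<^sup>2 \<bar>u(x + \<eta>)\<bar>\<^sup>2\<close>, which factorises.\<close>

lemma fourier_wigner_L2:
  fixes u :: "real^'n \<Rightarrow> complex"
  assumes u: "schwartz u"
  shows "(LINT \<eta>|lborel. LINT k|lborel. (norm (fourier_wigner u (k, \<eta>)))\<^sup>2) = (2 * pi) ^ CARD('n) * L2norm u ^ 4"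
proof -
  define q where "q = (\<lambda>x. (norm (u x))\<^sup>2)"
  have q: "schwartz q" unfolding q_def by (rule schwartz_norm_power2[OF u])
  then have [measurable]: "q \<in> borel_measurable borel"
    by (intro rapid_measurable schwartz_rapid)
  have s: "schwartz (\<lambda>x. u (x - \<eta> /\<^sub>R 2) * cnj (u (x + \<eta> /\<^sub>R 2)))" for \<eta>
    using schwartz_shift_scale[OF u, of 1 "- \<eta> /\<^sub>R 2"] schwartz_shift_scale[OF u, of 1 "\<eta> /\<^sub>R 2"]
    by (intro schwartz_mult schwartz_cnj) (simp_all add: add.commute)
  have inner: "(LINT k|lborel. (norm (fourier_wigner u (k, \<eta>)))\<^sup>2) = (2 * pi) ^ CARD('n) * (LINT x|lborel. q x * q (x + \<eta>))" for \<eta>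
  proof -
    have "(LINT k|lborel. (norm (fourier_wigner u (k, \<eta>)))\<^sup>2) =
        (2 * pi) ^ CARD('n) * (LINT x|lborel. q (x - \<eta> /\<^sub>R 2) * q (x + \<eta> /\<^sub>R 2))"
      unfolding fourier_wigner_eq[OF u] plancherel[OF s]
      by (simp add: norm_mult power_mult_distrib q_def)
    also have "(LINT x|lborel. q (x - \<eta> /\<^sub>R 2) * q (x + \<eta> /\<^sub>R 2)) = (LINT x|lborel. q x * q (x + \<eta>))"
      by (rule lborel_integral_midpoint) measurable
    finally show ?thesis .
  qed
  have "integrable lborel (\<lambda>p. q (fst p + 0 *\<^sub>R snd p) * q (fst p + 1 *\<^sub>R snd p))"
    by (intro schwartz_integrable schwartz_two_point q) simp
  then have int: "integrable lborel (\<lambda>p. q (fst p) * q (fst p + snd p))" by simp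
  have "(LINT \<eta>|lborel. LINT x|lborel. q x * q (x + \<eta>)) = (LINT x|lborel. LINT \<eta>|lborel. q x * q (x + \<eta>))"
    using lborel_integral_swap[OF int] by simp
  also have "\<dots> = (LINT x|lborel. q x * (LINT \<eta>|lborel. q \<eta>))"
    using lborel_integral_shift[of q] by simp
  also have "\<dots> = L2norm u ^ 4"
    using L2norm_power2[of u] by (simp add: q_def power4_eq_xxxx power2_eq_square)
  finally have "(LINT \<eta>|lborel. LINT x|lborel. q x * q (x + \<eta>)) = L2norm u ^ 4" .
  then show ?thesis unfolding inner by simp
qed

section \<open>The energy in Wigner variables\<close>

lemma schwartz_integral_dir_deriv:
  fixes f :: "'a::euclidean_space \<Rightarrow> 'b::{banach,second_countable_topology}"
  assumes "schwartz f" "b \<in> Basis"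
  shows "(LINT x|lborel. dir_deriv b f x) = 0"
  unfolding dir_deriv_def
proof (rule integral_derivative_eq_0[where D = "\<lambda>x. frechet_derivative f (at x)" and f = f])
  show "rapid (\<lambda>x. frechet_derivative f (at x) b)"
    using schwartz_rapid[OF schwartz_dir_deriv[OF assms]] by (simp add: dir_deriv_def[abs_def])
qed (use assms in \<open>auto intro: schwartz_rapid frechet_derivativeI schwartz_differentiable\<close>)

lemma dir_deriv_mult:
  fixes f g :: "'a::euclidean_space \<Rightarrow> 'b::real_normed_algebra"
  assumes "f differentiable (at x)" "g differentiable (at x)"
  shows "dir_deriv b (\<lambda>x. f x * g x) x = f x * dir_deriv b g x + dir_deriv b f x * g x"
  using dir_deriv_eqI[OF has_derivative_mult[OF assms[THEN frechet_derivativeI]]]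
  by (simp add: dir_deriv_def)

lemma schwartz_integral_by_parts:
  fixes f g :: "'a::euclidean_space \<Rightarrow> complex"
  assumes f: "schwartz f" and g: "schwartz g" and b: "b \<in> Basis"
  shows "(LINT x|lborel. f x * dir_deriv b g x) = - (LINT x|lborel. dir_deriv b f x * g x)"
proof -
  have "0 = (LINT x|lborel. dir_deriv b (\<lambda>x. f x * g x) x)"
    by (rule schwartz_integral_dir_deriv[OF schwartz_mult[OF f g] b, symmetric])
  also have "\<dots> = (LINT x|lborel. f x * dir_deriv b g x + dir_deriv b f x * g x)"
    by (intro Bochner_Integration.integral_cong refl dir_deriv_mult schwartz_differentiable f g)
  also have "\<dots> = (LINT x|lborel. f x * dir_deriv b g x) + (LINT x|lborel. dir_deriv b f x * g x)"
    by (intro Bochner_Integration.integral_add schwartz_integrable schwartz_mult schwartz_dir_deriv f g b)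
  finally show ?thesis by (simp add: eq_neg_iff_add_eq_0)
qed

text \<open>Rapid decrease of the derivatives in both variables bounds them by an integrable function of
  \<open>x\<close>, uniformly in \<open>\<eta>\<close>.\<close>

lemma partial_integral_has_derivative:
  fixes G :: "'a::euclidean_space \<times> 'b::euclidean_space \<Rightarrow> 'c::{banach,second_countable_topology}"
  assumes G: "schwartz G"
  shows "((\<lambda>\<eta>. LINT x|lborel. G (\<eta>, x)) has_derivative
     (\<lambda>v. LINT x|lborel. (\<Sum>b\<in>Basis. (v \<bullet> b) *\<^sub>R dir_deriv (b, 0) G (\<eta>, x)))) (at \<eta>)"
proof -
  let ?n = "2 * DIM('b)"
  have rD: "rapid (dir_deriv (b, 0) G)" if "b \<in> Basis" for b
    by (intro schwartz_rapid schwartz_dir_deriv G Pair_0_in_Basis that)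
  have "\<forall>b\<in>Basis. \<exists>C. \<forall>\<eta> x. norm (dir_deriv (b, 0) G (\<eta>, x)) \<le> C * (1 / (1 + norm x) ^ ?n)"
  proof
    fix b :: 'a assume "b \<in> Basis"
    then obtain C where "\<And>\<eta> x. norm (dir_deriv (b, 0) G (\<eta>, x)) \<le> C / ((1 + norm \<eta>) ^ 0 * (1 + norm x) ^ ?n)"
      using rapid_slice_bound[OF rD] by blast
    then show "\<exists>C. \<forall>\<eta> x. norm (dir_deriv (b, 0) G (\<eta>, x)) \<le> C * (1 / (1 + norm x) ^ ?n)" by auto
  qed
  then obtain C where C: "\<And>b \<eta> x. b \<in> Basis \<Longrightarrow> norm (dir_deriv (b, 0) G (\<eta>, x)) \<le> C b * (1 / (1 + norm x) ^ ?n)"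
    by metis
  show ?thesis
  proof (rule has_derivative_integral[where e = 1 and
        B = "\<lambda>x. (\<Sum>b\<in>Basis. C b * (1 / (1 + norm x) ^ ?n))"
        and f' = "\<lambda>\<eta> x v. \<Sum>b\<in>Basis. (v \<bullet> b) *\<^sub>R dir_deriv (b, 0) G (\<eta>, x)"])
    show "integrable lborel (\<lambda>x::'b. \<Sum>b\<in>(Basis::'a set). C b * (1 / (1 + norm x) ^ ?n))"
      by (intro Bochner_Integration.integrable_sum integrable_mult_right integrable_inverse_polynomial)
    show "((\<lambda>\<eta>. G (\<eta>, x)) has_derivative (\<lambda>v. \<Sum>b\<in>Basis. (v \<bullet> b) *\<^sub>R dir_deriv (b, 0) G (\<eta>, x))) (at \<eta>)" for \<eta> x
      using schwartz_has_derivative[OF schwartz_slice'[OF G]] by (simp add: dir_deriv_slice'[OF G])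
    show "norm (\<Sum>b\<in>Basis. (v \<bullet> b) *\<^sub>R dir_deriv (b, 0) G (\<eta>, x)) \<le> (\<Sum>b\<in>Basis. C b * (1 / (1 + norm x) ^ ?n)) * norm v" for \<eta> x v
      unfolding sum_distrib_right
    proof (rule sum_norm_le)
      fix b :: 'a assume b: "b \<in> Basis"
      have "norm ((v \<bullet> b) *\<^sub>R dir_deriv (b, 0) G (\<eta>, x)) \<le> norm v * (C b * (1 / (1 + norm x) ^ ?n))"
        unfolding norm_scaleR real_norm_def[symmetric]
        by (intro mult_mono C b norm_ge_zero) (use Basis_le_norm[OF b, of v] in auto)
      then show "norm ((v \<bullet> b) *\<^sub>R dir_deriv (b, 0) G (\<eta>, x)) \<le> C b * (1 / (1 + norm x) ^ ?n) * norm v"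
        by (simp add: mult.commute)
    qed
    show "integrable lborel (\<lambda>x. G (\<eta>, x))" for \<eta> by (intro schwartz_integrable schwartz_slice G)
    show "(\<lambda>x. \<Sum>b\<in>Basis. (v \<bullet> b) *\<^sub>R dir_deriv (b, 0) G (\<eta>, x)) \<in> borel_measurable lborel" for v
      unfolding measurable_lborel2
      by (intro borel_measurable_sum borel_measurable_scaleR borel_measurable_const
          rapid_measurable schwartz_rapid schwartz_slice schwartz_dir_deriv
          G Pair_0_in_Basis)
  qed simp
qed

lemma dir_deriv_partial_integral:
  fixes G :: "'a::euclidean_space \<times> 'b::euclidean_space \<Rightarrow> 'c::{banach,second_countable_topology}"
  assumes G: "schwartz G" and b: "b \<in> Basis"
  shows "dir_deriv b (\<lambda>\<eta>. LINT x|lborel. G (\<eta>, x)) \<eta> = (LINT x|lborel. dir_deriv (b, 0) G (\<eta>, x))"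
proof -
  have "dir_deriv b (\<lambda>\<eta>. LINT x|lborel. G (\<eta>, x)) \<eta> =
     (LINT x|lborel. (\<Sum>c\<in>Basis. (b \<bullet> c) *\<^sub>R dir_deriv (c, 0) G (\<eta>, x)))"
    by (rule dir_deriv_eqI[OF partial_integral_has_derivative[OF G]])
  also have "\<dots> = (LINT x|lborel. dir_deriv (b, 0) G (\<eta>, x))"
  proof (intro Bochner_Integration.integral_cong refl)
    fix x
    have "(\<Sum>c\<in>Basis. (b \<bullet> c) *\<^sub>R dir_deriv (c, 0) G (\<eta>, x)) =
        (\<Sum>c\<in>Basis. if c = b then dir_deriv (c, 0) G (\<eta>, x) else 0)"
      by (intro sum.cong refl) (simp add: inner_Basis b)
    then show "(\<Sum>c\<in>Basis. (b \<bullet> c) *\<^sub>R dir_deriv (c, 0) G (\<eta>, x)) = dir_deriv (b, 0) G (\<eta>, x)"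
      using b by simp
  qed
  finally show ?thesis .
qed

lemma dir_deriv_correlation:
  fixes f g :: "'a::euclidean_space \<Rightarrow> complex"
  assumes f: "schwartz f" and g: "schwartz g" and b: "b \<in> Basis"
  shows "dir_deriv b (\<lambda>\<eta>. LINT x|lborel. f x * g (x + \<eta>)) = (\<lambda>\<eta>. LINT x|lborel. f x * dir_deriv b g (x + \<eta>))"
proof
  fix \<eta>
  let ?L = "\<lambda>p::'a \<times> 'a. (snd p, snd p + fst p)"
  let ?G = "\<lambda>p. f (snd p) * g (snd p + fst p)"
  have L: "linear ?L" "inj ?L" by (auto simp: inj_def algebra_simps intro!: linearI)
  have G: "schwartz ?G"
    using schwartz_compose_affine[OF L schwartz_tensor[OF f g], of 0] by simp
  have "dir_deriv (b, 0) ?G (\<eta>, x) = f x * dir_deriv b g (x + \<eta>)" for x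
  proof -
    have "dir_deriv (b, 0) ?G (\<eta>, x) = dir_deriv b (\<lambda>\<eta>. f x * g (x + \<eta>)) \<eta>"
      using fun_cong[OF dir_deriv_slice'[OF G, of b x], of \<eta>] by simp
    also have "\<dots> = f x * dir_deriv b (\<lambda>\<eta>. g (x + \<eta>)) \<eta>"
      using schwartz_differentiable[OF schwartz_shift_scale[OF g, of 1 x]]
      by (intro dir_deriv_bounded_linear bounded_linear_mult_right) simp
    also have "dir_deriv b (\<lambda>\<eta>. g (x + \<eta>)) \<eta> = dir_deriv b g (x + \<eta>)"
      by (rule dir_deriv_compose_affine[of "\<lambda>x. x"]) (auto intro: linear_id[unfolded id_def] schwartz_differentiable g)
    finally show ?thesis .
  qed
  with dir_deriv_partial_integral[OF G b, of \<eta>]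
  show "dir_deriv b (\<lambda>\<eta>. LINT x|lborel. f x * g (x + \<eta>)) \<eta> = (LINT x|lborel. f x * dir_deriv b g (x + \<eta>))"
    by simp
qed

lemma axis_in_Basis: "axis j (1::real) \<in> Basis"
  by (simp add: axis_in_Basis_iff)

lemma norm_grad_power2: "(norm (grad f x))\<^sup>2 = (\<Sum>j\<in>UNIV. (norm (dir_deriv (axis j 1) f x))\<^sup>2)"
  by (simp add: norm_vec_def L2_set_def grad_def sum_nonneg)

lemma L2norm_grad_power2:
  fixes u :: "real^'n \<Rightarrow> 'b::{banach,second_countable_topology}"
  assumes "\<And>j. integrable lborel (\<lambda>x. (norm (dir_deriv (axis j 1) u x))\<^sup>2)"
  shows "(L2norm (grad u))\<^sup>2 = (\<Sum>j\<in>UNIV. LINT x|lborel. (norm (dir_deriv (axis j 1) u x))\<^sup>2)"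
  unfolding L2norm_power2 norm_grad_power2 by (rule Bochner_Integration.integral_sum) (rule assms)

text \<open>At frequency zero, \<open>w(0, \<eta>)\<close> is the autocorrelation of \<open>u\<close>. Translating the integration variable
  moves all \<open>\<eta>\<close>-derivatives onto one factor, and one integration by parts gives the Dirichlet integral.\<close>

lemma laplacian_fourier_wigner:
  fixes u :: "real^'n \<Rightarrow> complex"
  assumes u: "schwartz u"
  shows "laplacian (\<lambda>\<eta>. fourier_wigner u (0, \<eta>)) 0 = - of_real ((L2norm (grad u))\<^sup>2)"
proof -
  have [measurable]: "u \<in> borel_measurable borel"
    by (rule rapid_measurable[OF schwartz_rapid[OF u]])
  have "fourier_wigner u (0, \<eta>) = (LINT x|lborel. u x * cnj (u (x + \<eta>)))" for \<eta>
  proof -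
    have "fourier_wigner u (0, \<eta>) = (LINT x|lborel. u (x - \<eta> /\<^sub>R 2) * cnj (u (x + \<eta> /\<^sub>R 2)))"
      unfolding fourier_wigner_eq[OF u] by (simp add: fourier_eq_cis)
    also have "\<dots> = (LINT x|lborel. u x * cnj (u (x + \<eta>)))"
      by (rule lborel_integral_midpoint) measurable
    finally show ?thesis .
  qed
  then have w: "(\<lambda>\<eta>. fourier_wigner u (0, \<eta>)) = (\<lambda>\<eta>. LINT x|lborel. u x * (\<lambda>x. cnj (u x)) (x + \<eta>))"
    by simp
  have int: "integrable lborel (\<lambda>x. (norm (dir_deriv (axis j 1) u x))\<^sup>2)" for j
    by (intro schwartz_integrable schwartz_norm_power2 schwartz_dir_deriv u axis_in_Basis)
  have "dir_deriv (axis j 1) (dir_deriv (axis j 1) (\<lambda>\<eta>. fourier_wigner u (0, \<eta>))) 0 =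
      - of_real (LINT x|lborel. (norm (dir_deriv (axis j 1) u x))\<^sup>2)" for j
  proof -
    let ?b = "axis j 1 :: real^'n"
    have b: "?b \<in> Basis" by (rule axis_in_Basis)
    have uc: "schwartz (\<lambda>x. cnj (u x))" by (rule schwartz_cnj[OF u])
    have "dir_deriv ?b (dir_deriv ?b (\<lambda>\<eta>. fourier_wigner u (0, \<eta>))) 0
        = (LINT x|lborel. u x * dir_deriv ?b (dir_deriv ?b (\<lambda>x. cnj (u x))) x)"
      unfolding w by (simp add: dir_deriv_correlation[OF u uc b]
          dir_deriv_correlation[OF u schwartz_dir_deriv[OF uc b] b])
    also have "\<dots> = - (LINT x|lborel. dir_deriv ?b u x * dir_deriv ?b (\<lambda>x. cnj (u x)) x)"
      by (rule schwartz_integral_by_parts[OF u schwartz_dir_deriv[OF uc b] b])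
    also have "(LINT x|lborel. dir_deriv ?b u x * dir_deriv ?b (\<lambda>x. cnj (u x)) x) =
        (LINT x|lborel. of_real ((norm (dir_deriv ?b u x))\<^sup>2))"
      unfolding dir_deriv_bounded_linear[OF bounded_linear_cnj schwartz_differentiable[OF u]]
        complex_norm_square ..
    finally show ?thesis unfolding integral_complex_of_real .
  qed
  then show ?thesis
    unfolding laplacian_def L2norm_grad_power2[OF int] by (simp add: sum_negf)
qed

lemma bracket_pos: "0 < bracket k" and bracket_ge_1: "1 \<le> bracket k"
  by (auto simp: bracket_def add_pos_nonneg)

lemma bracket_power2: "(bracket k)\<^sup>2 = 1 + (norm k)\<^sup>2"
  by (simp add: bracket_def add_nonneg_nonneg)

lemma bracket_le: "bracket k \<le> 1 + norm k"
  unfolding bracket_def by (rule real_le_lsqrt) (auto simp: power2_sum)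

lemma bracket_uminus[simp]: "bracket (- k) = bracket k"
  by (simp add: bracket_def)

lemma abs_bracket[simp]: "\<bar>bracket k\<bar> = bracket k"
  by (simp add: bracket_def)

lemma bracket_measurable[measurable]: "bracket \<in> borel_measurable borel"
  unfolding bracket_def[abs_def] by measurable

lemma test_function_bounded_measurable:
  assumes "test_function X"
  obtains K where "X \<in> borel_measurable borel" "\<And>x. \<bar>X x\<bar> \<le> K"
proof -
  have "X differentiable (at x)" for x
    using assms unfolding test_function_def smooth_def by (auto dest!: spec[where x = "[]"])
  then have cont: "continuous_on A X" for A
    by (simp add: continuous_at_imp_continuous_on differentiable_imp_continuous_within)
  have "compact (X ` closure {x. X x \<noteq> 0})"
    using assms cont compact_continuous_image unfolding test_function_def by blast
  then obtain K where K: "\<And>y. y \<in> X ` closure {x. X x \<noteq> 0} \<Longrightarrow> norm y \<le> K"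
    using compact_imp_bounded[of "X ` closure {x. X x \<noteq> 0}"] unfolding bounded_iff by auto
  have "\<bar>X x\<bar> \<le> max 0 K" for x
  proof (cases "X x = 0")
    case False
    then have "x \<in> closure {x. X x \<noteq> 0}" by (intro subsetD[OF closure_subset]) simp
    then have "norm (X x) \<le> K" by (intro K imageI)
    then show ?thesis by simp
  qed auto
  then show ?thesis by (rule that[OF borel_measurable_continuous_onI[OF cont]])
qed

lemma fourier_real_uminus:
  fixes A :: "'a::euclidean_space \<Rightarrow> real"
  shows "fourier (\<lambda>x. of_real (A x)) (- k) = cnj (fourier (\<lambda>x. of_real (A x)) k)"
  unfolding fourier_eq_cis Bochner_Integration.integral_cnj[symmetric] by (simp add: cis_cnj)

lemma fourier_constant_square:
  "((2 * pi) powr (- real n / 2)) * ((2 * pi) powr (- real n / 2)) = 1 / (2 * pi) ^ n"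
proof -
  have "((2 * pi) powr (- real n / 2)) * ((2 * pi) powr (- real n / 2)) = (2 * pi) powr (- real n)"
    by (simp flip: powr_add)
  also have "\<dots> = 1 / (2 * pi) ^ n" by (simp add: powr_minus_divide powr_realpow)
  finally show ?thesis .
qed

lemma fourier_constant_inverse:
  "1 / (2 * pi) powr (real n / 2) = (2 * pi) powr (- real n / 2)"
  using powr_minus_divide[of "2 * pi" "real n / 2"] by simp

lemma bracket_powr:
  "bracket k powr (1/2) * bracket k powr (1/2) = bracket k"
  "bracket k powr (1/2) * bracket k powr (-1/2) = 1"
  "bracket k * (bracket k powr (-1/2) * bracket k powr (-1/2)) = 1"
proof -
  show "bracket k powr (1/2) * bracket k powr (1/2) = bracket k"
    and 2: "bracket k powr (1/2) * bracket k powr (-1/2) = 1"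
    using bracket_pos[of k] by (simp_all flip: powr_add)
  have "bracket k powr (-1/2) * bracket k powr (-1/2) = bracket k powr (-1)"
    by (simp flip: powr_add)
  then show "bracket k * (bracket k powr (-1/2) * bracket k powr (-1/2)) = 1"
    using bracket_pos[of k] by (simp add: powr_minus_divide)
qed

lemma norm_add_power2: "(norm (z + y))\<^sup>2 = (norm z)\<^sup>2 + (norm y)\<^sup>2 + 2 * Re (z * cnj y)" for z y :: complex
  unfolding cmod_power2 by (simp add: power2_eq_square algebra_simps)

text \<open>Plancherel's theorem for \<open>A\<close> and for its partial derivatives, since
  \<open>(bracket k)\<^sup>2 = 1 + (\<Sum>j\<in>UNIV. (k $ j)\<^sup>2)\<close>.\<close>

lemma integral_bracket_fourier:
  fixes A :: "real^'n \<Rightarrow> real"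
  assumes A: "schwartz A"
  shows "(LINT k|lborel. (bracket k)\<^sup>2 * (norm (fourier (\<lambda>x. of_real (A x)) k))\<^sup>2) =
    (2 * pi) ^ CARD('n) * ((L2norm A)\<^sup>2 + (L2norm (grad A))\<^sup>2)"
proof -
  let ?A = "\<lambda>x. complex_of_real (A x)"
  have Ac: "schwartz ?A" by (rule schwartz_of_real[OF A])
  let ?D = "\<lambda>j. dir_deriv (axis j 1 :: real^'n) ?A"
  have D: "schwartz (?D j)" for j by (intro schwartz_dir_deriv Ac axis_in_Basis)
  have F2: "integrable lborel (\<lambda>k. (norm (fourier f k))\<^sup>2)" if "schwartz f" for f :: "real^'n \<Rightarrow> complex"
    by (intro rapid_integrable rapid_norm_power2 fourier_rapid that)
  have "(bracket k)\<^sup>2 * (norm (fourier ?A k))\<^sup>2 = (norm (fourier ?A k))\<^sup>2 + (\<Sum>j\<in>UNIV. (norm (fourier (?D j) k))\<^sup>2)" for k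
  proof -
    have "(norm (fourier (?D j) k))\<^sup>2 = (k $ j)\<^sup>2 * (norm (fourier ?A k))\<^sup>2" for j
      unfolding fourier_dir_deriv[OF Ac axis_in_Basis] by (simp add: norm_mult power_mult_distrib inner_axis)
    moreover have "(norm k)\<^sup>2 = (\<Sum>j\<in>UNIV. (k $ j)\<^sup>2)"
      by (simp add: norm_vec_def L2_set_def sum_nonneg)
    ultimately show ?thesis by (simp add: bracket_power2 distrib_right sum_distrib_right)
  qed
  then have "(LINT k|lborel. (bracket k)\<^sup>2 * (norm (fourier ?A k))\<^sup>2) =
      (LINT k|lborel. (norm (fourier ?A k))\<^sup>2) + (\<Sum>j\<in>UNIV. (LINT k|lborel. (norm (fourier (?D j) k))\<^sup>2))"
    using F2[OF Ac] F2[OF D] by simp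
  also have "\<dots> = (2 * pi) ^ CARD('n) * ((LINT x|lborel. (norm (?A x))\<^sup>2) + (\<Sum>j\<in>UNIV. (LINT x|lborel. (norm (?D j x))\<^sup>2)))"
    unfolding plancherel[OF Ac] plancherel[OF D] by (simp add: distrib_left sum_distrib_left)
  also have "(LINT x|lborel. (norm (?A x))\<^sup>2) = (L2norm A)\<^sup>2" by (simp add: L2norm_power2)
  also have "(\<Sum>j\<in>UNIV. (LINT x|lborel. (norm (?D j x))\<^sup>2)) = (L2norm (grad A))\<^sup>2"
  proof -
    have n: "norm (?D j x) = norm (dir_deriv (axis j 1) A x)" for j x
      by (simp add: dir_deriv_bounded_linear[OF bounded_linear_of_real schwartz_differentiable[OF A]])
    have "integrable lborel (\<lambda>x. (norm (?D j x))\<^sup>2)" for j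
      by (intro schwartz_integrable schwartz_norm_power2 D)
    then show ?thesis unfolding n by (rule L2norm_grad_power2[symmetric])
  qed
  finally show ?thesis .
qed

text \<open>The three terms of the energy match separately: the kinetic term by
  \<open>laplacian_fourier_wigner\<close>, the interaction by exchanging the integrals over position and frequency,
  the field energy by Plancherel's theorem.\<close>

theorem energy_in_wigner_variables:
  fixes X :: "real^'n \<Rightarrow> real"
  assumes X: "test_function X" and u: "schwartz (u t)" and A: "schwartz (A t)" and B: "schwartz (dt A t)"
    and cf: "comes_from w \<alpha> u A"
  shows "mkg_energy X w \<alpha> t = skg_energy X u A t"
proof -
  define c where "c = (2 * pi) powr (- real CARD('n) / 2)"
  define a where "a = fourier (\<lambda>x. complex_of_real (A t x))"
  define b where "b = fourier (\<lambda>x. complex_of_real (dt A t x))"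
  define r where "r = (\<lambda>k::real^'n. bracket k powr (1/2))"
  define s where "s = (\<lambda>k::real^'n. bracket k powr (-1/2))"
  define q where "q = (\<lambda>x. (norm (u t x))\<^sup>2)"
  have cc: "c * c = 1 / (2 * pi) ^ CARD('n)" unfolding c_def by (rule fourier_constant_square)
  have ccpi: "c * c * (2 * pi) ^ CARD('n) = 1" unfolding cc by simp
  have c': "1 / (2 * pi) powr (real CARD('n) / 2) = c" unfolding c_def by (rule fourier_constant_inverse)
  have rs: "r k * r k = bracket k" "r k * s k = 1" "bracket k * (s k * s k) = 1" for k
    unfolding r_def s_def by (rule bracket_powr)+
  have \<alpha>: "\<alpha> t k = of_real c * (of_real (r k) * a k + \<i> * of_real (s k) * b k)" for k
    using cf unfolding comes_from_def c_def a_def b_def r_def s_def by simp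
  have w: "w t = fourier_wigner (u t)" using cf unfolding comes_from_def by blast
  have a_neg: "a (- k) = cnj (a k)" and b_neg: "b (- k) = cnj (b k)" for k
    unfolding a_def b_def by (rule fourier_real_uminus)+
  have rneg: "r (- k) = r k" "s (- k) = s k" for k by (simp_all add: r_def s_def)
  have ra: "rapid a" and rb: "rapid b"
    unfolding a_def b_def by (intro fourier_rapid schwartz_of_real A B)+
  note [measurable] = rapid_measurable[OF ra] rapid_measurable[OF rb]
  have q: "schwartz q" unfolding q_def by (rule schwartz_norm_power2[OF u])
  obtain K where Xm[measurable]: "X \<in> borel_measurable borel" and XK: "\<And>k. \<bar>X k\<bar> \<le> K"
    using test_function_bounded_measurable[OF X] by blast
  have T1: "- (1 / 2) * laplacian (\<lambda>\<eta>. w t (0, \<eta>)) 0 = of_real (1 / 2 * (L2norm (grad (u t)))\<^sup>2)"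
    unfolding w laplacian_fourier_wigner[OF u] by simp
  \<comment> \<open>The part of \<open>\<alpha>\<close> coming from the time derivative of the field is \<open>\<i>\<close> times a hermitian
    function, so the hermitian part of \<open>\<alpha>\<close> sees the field alone.\<close>
  have herm: "herm (\<alpha> t) k = of_real c * of_real (r k) * a k" for k
    unfolding herm_def \<alpha> a_neg b_neg rneg by (simp add: algebra_simps)
  have wneg: "w t (- k, 0) = (LINT x|lborel. cis (k \<bullet> x) * of_real (q x))" for k
    unfolding w fourier_wigner_eq[OF u] fourier_eq_cis q_def by (simp add: complex_norm_square del: of_real_power)
  have Xa: "integrable lborel (\<lambda>k. of_real (X k) * a k)"
    by (intro rapid_integrable rapid_mult_growth[OF ra, of _ K 0]) (use XK in auto)
  have qi: "integrable lborel (\<lambda>x. complex_of_real (q x))"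
    by (intro schwartz_integrable schwartz_of_real q)
  have int: "integrable lborel (\<lambda>p. cis (fst p \<bullet> snd p) * ((of_real (X (fst p)) * a (fst p)) * of_real (q (snd p))))"
    by (rule integrable_cis_mult[OF integrable_tensor[OF Xa qi]])
       (unfold measurable_lborel2, intro borel_measurable_continuous_onI continuous_intros)
  have "of_real c * (LINT k|lborel. w t (- k, 0) * of_real (s k) * of_real (X k) * herm (\<alpha> t) k) =
      of_real (c * c) * (LINT k|lborel. (of_real (X k) * a k) * (LINT x|lborel. cis (k \<bullet> x) * of_real (q x)))"
  proof -
    have E: "w t (- k, 0) * of_real (s k) * of_real (X k) * herm (\<alpha> t) k =
        of_real c * ((of_real (X k) * a k) * (LINT x|lborel. cis (k \<bullet> x) * of_real (q x)))" for k
    proof -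
      have "w t (- k, 0) * of_real (s k) * of_real (X k) * herm (\<alpha> t) k =
        of_real (r k * s k) * (of_real c * ((of_real (X k) * a k) * w t (- k, 0)))"
        unfolding herm by simp
      then show ?thesis unfolding rs(2) wneg by simp
    qed
    show ?thesis unfolding E integral_mult_right_zero by (simp only: of_real_mult mult.assoc)
  qed
  also have "(LINT k|lborel. (of_real (X k) * a k) * (LINT x|lborel. cis (k \<bullet> x) * of_real (q x))) =
      (LINT k|lborel. LINT x|lborel. cis (k \<bullet> x) * ((of_real (X k) * a k) * of_real (q x)))"
    by (simp only: integral_mult_right_zero[symmetric] mult_ac)
  also have "\<dots> = (LINT x|lborel. LINT k|lborel. cis (k \<bullet> x) * ((of_real (X k) * a k) * of_real (q x)))"
    using lborel_integral_swap[OF int] by simp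
  also have "\<dots> = (LINT x|lborel. (LINT k|lborel. cis (k \<bullet> x) * (of_real (X k) * a k)) * of_real (q x))"
    by (simp only: integral_mult_left_zero mult.assoc[symmetric])
  also have "of_real (c * c) * \<dots> = (LINT x|lborel. fourier_mult X (A t) x * of_real (q x))"
    unfolding fourier_mult_def fourier_inv_eq_cis cc a_def
    by (simp add: integral_mult_right_zero[symmetric] mult.assoc del: integral_mult_right_zero)
  finally have T2: "of_real c * (LINT k|lborel. w t (- k, 0) * of_real (s k) * of_real (X k) * herm (\<alpha> t) k) =
    (LINT x|lborel. fourier_mult X (A t) x * of_real (q x))" .
  \<comment> \<open>Expanding the square leaves the cross term \<open>2 h\<close>. It is odd, because the Fourier transform of a
    real function is hermitian, and so it integrates to zero.\<close>
  define h where "h = (\<lambda>k. bracket k * Re (a k * cnj (\<i> * b k)))"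
  have hneg: "h (- k) = - h k" for k
    unfolding h_def a_neg b_neg by (simp add: algebra_simps)
  have [measurable]: "h \<in> borel_measurable borel" unfolding h_def by measurable
  have "(LINT k|lborel. h k) = (LINT k|lborel. h (- k))"
    by (rule lborel_integral_uminus[symmetric]) measurable
  then have h0: "(LINT k|lborel. h k) = 0" unfolding hneg by simp
  have sq: "bracket k * (norm (\<alpha> t k))\<^sup>2 = c * c * ((bracket k)\<^sup>2 * (norm (a k))\<^sup>2 + (norm (b k))\<^sup>2 + 2 * h k)" for k
  proof -
    have "(norm (\<alpha> t k))\<^sup>2 = c * c * ((r k * r k) * (norm (a k))\<^sup>2 + (s k * s k) * (norm (b k))\<^sup>2
        + 2 * Re ((of_real (r k) * a k) * cnj (\<i> * of_real (s k) * b k)))"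
      unfolding \<alpha> norm_mult power_mult_distrib norm_add_power2
      by (simp add: power2_eq_square)
    also have "Re ((of_real (r k) * a k) * cnj (\<i> * of_real (s k) * b k)) = (r k * s k) * Re (a k * cnj (\<i> * b k))"
      by (simp add: algebra_simps)
    finally have N: "(norm (\<alpha> t k))\<^sup>2 = c * c * (bracket k * (norm (a k))\<^sup>2 + (s k * s k) * (norm (b k))\<^sup>2
        + 2 * Re (a k * cnj (\<i> * b k)))" unfolding rs by simp
    have "bracket k * (norm (\<alpha> t k))\<^sup>2 = c * c * ((bracket k)\<^sup>2 * (norm (a k))\<^sup>2
        + (bracket k * (s k * s k)) * (norm (b k))\<^sup>2 + 2 * h k)"
      unfolding N h_def power2_eq_square[of "bracket k"] by (simp only: distrib_left mult_ac)
    then show ?thesis unfolding rs by simp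
  qed
  have ba: "rapid (\<lambda>k. of_real (bracket k) * a k)"
    by (rule rapid_mult_growth[OF ra, of _ 1 1]) (use bracket_le in auto)
  have i1: "integrable lborel (\<lambda>k. (bracket k)\<^sup>2 * (norm (a k))\<^sup>2)"
    using rapid_integrable[OF rapid_norm_power2[OF ba]]
    by (simp add: norm_mult power_mult_distrib)
  have i2: "integrable lborel (\<lambda>k. (norm (b k))\<^sup>2)"
    by (rule rapid_integrable[OF rapid_norm_power2[OF rb]])
  have "integrable lborel (\<lambda>k. Re ((of_real (bracket k) * a k) * cnj (b k) * (- \<i>)))"
    by (intro integrable_Re integrable_mult_left rapid_integrable rapid_mult
        rapid_cnj ba rb)
  moreover have "(\<lambda>k. Re ((of_real (bracket k) * a k) * cnj (b k) * (- \<i>))) = h"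
    unfolding h_def by (auto simp: algebra_simps)
  ultimately have i3: "integrable lborel h" by simp
  have "(LINT k|lborel. bracket k * (norm (\<alpha> t k))\<^sup>2) =
      c * c * ((LINT k|lborel. (bracket k)\<^sup>2 * (norm (a k))\<^sup>2) + (LINT k|lborel. (norm (b k))\<^sup>2))"
    unfolding sq using i1 i2 i3 h0 by simp
  also have "\<dots> = (c * c * (2 * pi) ^ CARD('n)) * ((L2norm (A t))\<^sup>2 + (L2norm (grad (A t)))\<^sup>2 + (L2norm (dt A t))\<^sup>2)"
    unfolding a_def b_def integral_bracket_fourier[OF A] plancherel[OF schwartz_of_real[OF B]]
    by (simp add: L2norm_power2 algebra_simps)
  finally have T3: "(LINT k|lborel. bracket k * (norm (\<alpha> t k))\<^sup>2) =
      (L2norm (A t))\<^sup>2 + (L2norm (grad (A t)))\<^sup>2 + (L2norm (dt A t))\<^sup>2"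
    unfolding ccpi by simp
  show ?thesis
    unfolding mkg_energy_def skg_energy_def T1 c' T3 T2[unfolded s_def q_def]
    by (simp add: algebra_simps add_divide_distrib)
qed

section \<open>Curves of rapidly decreasing functions\<close>

text \<open>Convergence of the difference quotients in every weighted sup norm. Convergence in the Schwartz
  topology implies this for all partial derivatives; the weaker notion has the advantage that
  multiplication by a measurable weight of polynomial growth preserves it.\<close>

definition rapid_curve ::
    "(real \<Rightarrow> 'a::euclidean_space \<Rightarrow> 'b::real_normed_vector) \<Rightarrow> (real \<Rightarrow> 'a \<Rightarrow> 'b) \<Rightarrow> bool" where
  "rapid_curve F G \<longleftrightarrow>
     (\<forall>t. rapid (F t) \<and> rapid (G t)) \<and>
     (\<forall>t m. \<forall>e>0. \<forall>\<^sub>F h in at 0. \<forall>x.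
        (1 + norm x) ^ m * norm ((F (t + h) x - F t x) /\<^sub>R h - G t x) \<le> e)"

lemma rapid_curveD:
  assumes "rapid_curve F G"
  shows "rapid (F t)" "rapid (G t)"
    "e > 0 \<Longrightarrow> \<forall>\<^sub>F h in at 0. \<forall>x. (1 + norm x) ^ m * norm ((F (t + h) x - F t x) /\<^sub>R h - G t x) \<le> e"
  using assms unfolding rapid_curve_def by blast+

lemma rapid_curveI:
  assumes "\<And>t. rapid (F t)" "\<And>t. rapid (G t)"
    and "\<And>t m e. e > 0 \<Longrightarrow> \<forall>\<^sub>F h in at 0. \<forall>x. (1 + norm x) ^ m * norm ((F (t + h) x - F t x) /\<^sub>R h - G t x) \<le> e"
  shows "rapid_curve F G"
  using assms unfolding rapid_curve_def by blast

lemma smooth_rapidly_decreasing_curve: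
  fixes F :: "real \<Rightarrow> 'a::euclidean_space \<Rightarrow> 'b::real_normed_vector"
  assumes "smooth_rapidly_decreasing F"
  obtains G where "\<And>t. schwartz (F t)" "\<And>t. schwartz (G t)"
    "\<And>bs. set bs \<subseteq> Basis \<Longrightarrow> rapid_curve (\<lambda>t. foldr dir_deriv bs (F t)) (\<lambda>t. foldr dir_deriv bs (G t))"
proof -
  obtain Gs where Gs: "Gs 0 = F" "\<And>n t. schwartz (Gs n t)" "\<And>n t. has_schwartz_derivative (Gs n) (Gs (Suc n) t) t"
    using assms unfolding smooth_rapidly_decreasing_def by blast
  define G where "G = Gs 1"
  have F: "schwartz (F t)" for t using Gs(2)[of 0] Gs(1) by simp
  have G: "schwartz (G t)" for t using Gs(2)[of 1] by (simp add: G_def)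
  have D: "has_schwartz_derivative F (G t) t" for t using Gs(3)[of 0 t] Gs(1) by (simp add: G_def)
  have "rapid_curve (\<lambda>t. foldr dir_deriv bs (F t)) (\<lambda>t. foldr dir_deriv bs (G t))" if bs: "set bs \<subseteq> Basis" for bs
  proof (rule rapid_curveI)
    fix t m and e :: real assume "e > 0"
    define q where "q = (\<lambda>h x. (F (t + h) x - F t x) /\<^sub>R h - G t x)"
    have "((\<lambda>h. schwartz_seminorm m bs (q h)) \<longlongrightarrow> 0) (at 0)"
      using D[of t] bs unfolding has_schwartz_derivative_def q_def by blast
    then have "\<forall>\<^sub>F h in at 0. schwartz_seminorm m bs (q h) < e"
      using \<open>e > 0\<close> by (rule order_tendstoD(2))
    then show "\<forall>\<^sub>F h in at 0. \<forall>x. (1 + norm x) ^ m *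
        norm ((foldr dir_deriv bs (F (t + h)) x - foldr dir_deriv bs (F t) x) /\<^sub>R h - foldr dir_deriv bs (G t) x) \<le> e"
    proof (eventually_elim, intro allI)
      fix h x assume h: "schwartz_seminorm m bs (q h) < e"
      have qd: "q h = (\<lambda>x. 1 *\<^sub>R (inverse h *\<^sub>R F (t + h) x + (- inverse h) *\<^sub>R F t x) + (-1) *\<^sub>R G t x)"
        unfolding q_def by (simp add: scaleR_diff_right)
      have q1: "schwartz (\<lambda>x. inverse h *\<^sub>R F (t + h) x + (- inverse h) *\<^sub>R F t x)"
        by (intro schwartz_add schwartz_scaleR F)
      have qs: "schwartz (q h)" unfolding qd by (intro schwartz_add schwartz_scaleR q1 G)
      have "foldr dir_deriv bs (q h) x =
          (foldr dir_deriv bs (F (t + h)) x - foldr dir_deriv bs (F t) x) /\<^sub>R h - foldr dir_deriv bs (G t) x"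
        unfolding qd foldr_dir_deriv_lincomb[OF q1 G bs] foldr_dir_deriv_lincomb[OF F F bs]
        by (simp add: scaleR_diff_right)
      moreover have "(1 + norm x) ^ m * norm (foldr dir_deriv bs (q h) x) \<le> schwartz_seminorm m bs (q h)"
        unfolding schwartz_seminorm_def using qs bs unfolding schwartz_def
        by (intro cSUP_upper) auto
      ultimately show "(1 + norm x) ^ m *
        norm ((foldr dir_deriv bs (F (t + h)) x - foldr dir_deriv bs (F t) x) /\<^sub>R h - foldr dir_deriv bs (G t) x) \<le> e"
        using h by simp
    qed
  qed (use F G bs in \<open>auto intro!: schwartz_rapid schwartz_foldr_dir_deriv\<close>)
  with F G show ?thesis by (rule that)
qed

text \<open>Here \<open>K\<close> plays the role of a bound for a linear functional, such as evaluation or integration, with respect to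
  one of the weighted sup norms.\<close>

lemma has_vector_derivative_of_quotient_bound:
  fixes f :: "real \<Rightarrow> 'b::real_normed_vector"
  assumes "\<And>e. e > 0 \<Longrightarrow> \<forall>\<^sub>F h in at 0. norm ((f (t + h) - f t) /\<^sub>R h - D) \<le> e * K"
  shows "(f has_vector_derivative D) (at t)"
proof -
  have "((\<lambda>h. norm (f (t + h) - f t - h *\<^sub>R D) / norm h) \<longlongrightarrow> 0) (at 0)"
  proof (rule tendstoI)
    fix e :: real assume "e > 0"
    then have "e / (2 * (\<bar>K\<bar> + 1)) > 0" by (simp add: add_nonneg_pos)
    from assms[OF this] have "\<forall>\<^sub>F h in at 0. norm ((f (t + h) - f t) /\<^sub>R h - D) \<le> e / (2 * (\<bar>K\<bar> + 1)) * K" .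
    moreover have "\<forall>\<^sub>F h::real in at 0. h \<noteq> 0" by (simp add: eventually_at_filter)
    ultimately show "\<forall>\<^sub>F h in at 0. dist (norm (f (t + h) - f t - h *\<^sub>R D) / norm h) 0 < e"
    proof (eventually_elim)
      case (elim h)
      show ?case
      proof -
        have h: "h \<noteq> 0" using elim by blast
        have "norm (f (t + h) - f t - h *\<^sub>R D) / norm h = norm ((f (t + h) - f t) /\<^sub>R h - D)"
        proof -
          have "f (t + h) - f t - h *\<^sub>R D = h *\<^sub>R ((f (t + h) - f t) /\<^sub>R h - D)"
            using h by (simp add: scaleR_diff_right)
          then show ?thesis using h by simp
        qed
        also have "\<dots> \<le> e / (2 * (\<bar>K\<bar> + 1)) * K" using elim by blast
        also have "\<dots> \<le> e / (2 * (\<bar>K\<bar> + 1)) * (\<bar>K\<bar> + 1)"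
          using \<open>e > 0\<close> by (intro mult_left_mono) auto
        also have "\<dots> < e" using \<open>e > 0\<close> by (simp add: field_simps add_pos_nonneg)
        finally show "dist (norm (f (t + h) - f t - h *\<^sub>R D) / norm h) 0 < e" by simp
      qed
    qed
  qed
  then show ?thesis
    unfolding has_vector_derivative_def has_derivative_at by (simp add: bounded_linear_scaleR_left)
qed

lemma rapid_curve_has_vector_derivative:
  assumes "rapid_curve F G"
  shows "((\<lambda>t. F t x) has_vector_derivative G t x) (at t)"
proof (rule has_vector_derivative_of_quotient_bound)
  fix e :: real assume "e > 0"
  show "\<forall>\<^sub>F h in at 0. norm ((F (t + h) x - F t x) /\<^sub>R h - G t x) \<le> e * 1"
    by (rule eventually_mono[OF rapid_curveD(3)[OF assms \<open>e > 0\<close>, of 0 t]]) simp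
qed

lemma rapid_curve_dt: "rapid_curve F G \<Longrightarrow> dt F t x = G t x"
  unfolding dt_def by (intro vector_derivative_at rapid_curve_has_vector_derivative)

lemma rapid_curve_integral:
  fixes F :: "real \<Rightarrow> 'a::euclidean_space \<Rightarrow> 'b::{banach,second_countable_topology}"
  assumes FG: "rapid_curve F G"
  shows "((\<lambda>t. LINT x|lborel. F t x) has_vector_derivative (LINT x|lborel. G t x)) (at t)"
proof (rule has_vector_derivative_of_quotient_bound)
  let ?n = "2 * DIM('a)"
  fix e :: real assume "e > 0"
  from rapid_curveD(3)[OF FG this, of ?n t]
  show "\<forall>\<^sub>F h in at 0. norm (((LINT x|lborel. F (t + h) x) - (LINT x|lborel. F t x)) /\<^sub>R h - (LINT x|lborel. G t x))
      \<le> e * (LINT x|lborel. 1 / (1 + norm (x::'a)) ^ ?n)"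
  proof eventually_elim
    case (elim h)
    have i: "integrable lborel (F s)" "integrable lborel (G s)" for s
      by (intro rapid_integrable rapid_curveD[OF FG])+
    have "((LINT x|lborel. F (t + h) x) - (LINT x|lborel. F t x)) /\<^sub>R h - (LINT x|lborel. G t x) =
        (LINT x|lborel. (F (t + h) x - F t x) /\<^sub>R h - G t x)"
      using i by simp
    also have "norm \<dots> \<le> (LINT x|lborel. e * (1 / (1 + norm (x::'a)) ^ ?n))"
    proof (rule order_trans[OF integral_norm_bound integral_mono_AE'])
      show "integrable lborel (\<lambda>x::'a. e * (1 / (1 + norm x) ^ ?n))"
        by (intro integrable_mult_right integrable_inverse_polynomial)
      have "norm ((F (t + h) x - F t x) /\<^sub>R h - G t x) \<le> e * (1 / (1 + norm x) ^ ?n)" for x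
        using elim[rule_format, of x] one_plus_norm_power_pos[of x ?n] by (simp add: field_simps)
      then show "AE x in lborel. norm ((F (t + h) x - F t x) /\<^sub>R h - G t x) \<le> e * (1 / (1 + norm x) ^ ?n)"
        by (intro AE_I2)
      show "AE x in lborel. 0 \<le> e * (1 / (1 + norm (x::'a)) ^ ?n)"
        using \<open>e > 0\<close> by (intro AE_I2 mult_nonneg_nonneg) auto
    qed
    also have "\<dots> = e * (LINT x|lborel. 1 / (1 + norm (x::'a)) ^ ?n)"
      by (rule integral_mult_right_zero)
    finally show ?case .
  qed
qed

lemma rapid_curve_compose:
  fixes L :: "'a::euclidean_space \<Rightarrow> 'b::euclidean_space"
  assumes L: "linear L" "inj L" and FG: "rapid_curve F G"
  shows "rapid_curve (\<lambda>t x. F t (L x)) (\<lambda>t x. G t (L x))"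
proof (rule rapid_curveI)
  show "rapid (\<lambda>x. F t (L x))" "rapid (\<lambda>x. G t (L x))" for t
    using rapid_compose_affine[OF L rapid_curveD(1)[OF FG, of t], of 0]
      rapid_compose_affine[OF L rapid_curveD(2)[OF FG, of t], of 0] by simp_all
  fix t m and e :: real assume "e > 0"
  obtain K where K: "K > 0" "\<And>x. 1 + norm x \<le> K * (1 + norm (0 + L x))"
    using one_plus_norm_affine_le[OF L, of 0] by blast
  have "e / K ^ m > 0" using K \<open>e > 0\<close> by simp
  from rapid_curveD(3)[OF FG this, of m t]
  show "\<forall>\<^sub>F h in at 0. \<forall>x. (1 + norm x) ^ m * norm ((F (t + h) (L x) - F t (L x)) /\<^sub>R h - G t (L x)) \<le> e"
  proof (eventually_elim, intro allI)
    fix h x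
    let ?r = "norm ((F (t + h) (L x) - F t (L x)) /\<^sub>R h - G t (L x))"
    assume *: "\<forall>y. (1 + norm y) ^ m * norm ((F (t + h) y - F t y) /\<^sub>R h - G t y) \<le> e / K ^ m"
    have "(1 + norm x) ^ m * ?r \<le> (K * (1 + norm (L x))) ^ m * ?r"
      using K(2)[of x] by (intro mult_right_mono power_mono) auto
    also have "\<dots> = K ^ m * ((1 + norm (L x)) ^ m * ?r)" by (simp add: power_mult_distrib mult_ac)
    also have "\<dots> \<le> K ^ m * (e / K ^ m)" using K(1) by (intro mult_left_mono *[rule_format]) auto
    also have "\<dots> = e" using K(1) by simp
    finally show "(1 + norm x) ^ m * ?r \<le> e" .
  qed
qed

lemma rapid_curve_cnj:
  assumes FG: "rapid_curve F G"
  shows "rapid_curve (\<lambda>t x. cnj (F t x)) (\<lambda>t x. cnj (G t x))"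
proof (rule rapid_curveI)
  show "rapid (\<lambda>x. cnj (F t x))" "rapid (\<lambda>x. cnj (G t x))" for t
    by (intro rapid_cnj rapid_curveD[OF FG])+
  fix t m and e :: real assume "e > 0"
  have "norm ((cnj (F (t + h) x) - cnj (F t x)) /\<^sub>R h - cnj (G t x)) = norm ((F (t + h) x - F t x) /\<^sub>R h - G t x)" for h x
    by (metis complex_cnj_diff complex_cnj_scaleR complex_mod_cnj)
  then show "\<forall>\<^sub>F h in at 0. \<forall>x. (1 + norm x) ^ m * norm ((cnj (F (t + h) x) - cnj (F t x)) /\<^sub>R h - cnj (G t x)) \<le> e"
    using rapid_curveD(3)[OF FG \<open>e > 0\<close>] by simp
qed

lemma rapid_curve_diff:
  fixes F F' :: "real \<Rightarrow> 'a::euclidean_space \<Rightarrow> 'b::{real_normed_vector,second_countable_topology}"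
  assumes FG: "rapid_curve F G" and FG': "rapid_curve F' G'"
  shows "rapid_curve (\<lambda>t x. F t x - F' t x) (\<lambda>t x. G t x - G' t x)"
proof (rule rapid_curveI)
  show "rapid (\<lambda>x. F t x - F' t x)" "rapid (\<lambda>x. G t x - G' t x)" for t
    by (intro rapid_diff rapid_curveD[OF FG] rapid_curveD[OF FG'])+
  fix t m and e :: real assume "e > 0"
  then have "e / 2 > 0" by simp
  from rapid_curveD(3)[OF FG this, of m t] rapid_curveD(3)[OF FG' this, of m t]
  show "\<forall>\<^sub>F h in at 0. \<forall>x. (1 + norm x) ^ m *
      norm ((F (t + h) x - F' (t + h) x - (F t x - F' t x)) /\<^sub>R h - (G t x - G' t x)) \<le> e"
  proof (eventually_elim, intro allI)
    fix h x
    let ?r = "(F (t + h) x - F t x) /\<^sub>R h - G t x" and ?r' = "(F' (t + h) x - F' t x) /\<^sub>R h - G' t x"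
    assume *: "\<forall>x. (1 + norm x) ^ m * norm ((F (t + h) x - F t x) /\<^sub>R h - G t x) \<le> e / 2"
      and **: "\<forall>x. (1 + norm x) ^ m * norm ((F' (t + h) x - F' t x) /\<^sub>R h - G' t x) \<le> e / 2"
    have "(F (t + h) x - F' (t + h) x - (F t x - F' t x)) /\<^sub>R h - (G t x - G' t x) = ?r - ?r'"
      by (simp add: scaleR_diff_right)
    then have "(1 + norm x) ^ m * norm ((F (t + h) x - F' (t + h) x - (F t x - F' t x)) /\<^sub>R h - (G t x - G' t x))
        \<le> (1 + norm x) ^ m * (norm ?r + norm ?r')"
      by (intro mult_left_mono) (simp_all only: norm_triangle_ineq4 zero_le_power add_nonneg_nonneg zero_le_one norm_ge_zero)
    also have "\<dots> \<le> e" using *[rule_format, of x] **[rule_format, of x] by (simp add: distrib_left)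
    finally show "(1 + norm x) ^ m * norm ((F (t + h) x - F' (t + h) x - (F t x - F' t x)) /\<^sub>R h - (G t x - G' t x)) \<le> e" .
  qed
qed

lemma rapid_curve_mult_growth:
  fixes F G :: "real \<Rightarrow> 'a::euclidean_space \<Rightarrow> complex"
  assumes FG: "rapid_curve F G" and g: "g \<in> borel_measurable borel"
    and K: "\<And>x. norm (g x) \<le> K * (1 + norm x) ^ N"
  shows "rapid_curve (\<lambda>t x. g x * F t x) (\<lambda>t x. g x * G t x)"
proof (rule rapid_curveI)
  show "rapid (\<lambda>x. g x * F t x)" "rapid (\<lambda>x. g x * G t x)" for t
    by (intro rapid_mult_growth[OF _ g K] rapid_curveD[OF FG])+
  fix t m and e :: real assume "e > 0"
  have K0: "0 \<le> K" using order_trans[OF norm_ge_zero K[of 0]] by simp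
  then have "e / (K + 1) > 0" using \<open>e > 0\<close> by simp
  from rapid_curveD(3)[OF FG this, of "m + N" t]
  show "\<forall>\<^sub>F h in at 0. \<forall>x. (1 + norm x) ^ m * norm ((g x * F (t + h) x - g x * F t x) /\<^sub>R h - g x * G t x) \<le> e"
  proof (eventually_elim, intro allI)
    fix h x
    let ?r = "(F (t + h) x - F t x) /\<^sub>R h - G t x"
    assume *: "\<forall>x. (1 + norm x) ^ (m + N) * norm ((F (t + h) x - F t x) /\<^sub>R h - G t x) \<le> e / (K + 1)"
    have "(g x * F (t + h) x - g x * F t x) /\<^sub>R h - g x * G t x = g x * ?r"
      by (simp add: scaleR_conv_of_real algebra_simps)
    then have "(1 + norm x) ^ m * norm ((g x * F (t + h) x - g x * F t x) /\<^sub>R h - g x * G t x)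
        = (1 + norm x) ^ m * (norm (g x) * norm ?r)" by (simp only: norm_mult)
    also have "\<dots> \<le> (1 + norm x) ^ m * (K * (1 + norm x) ^ N * norm ?r)"
      by (intro mult_left_mono mult_right_mono K) auto
    also have "\<dots> = K * ((1 + norm x) ^ (m + N) * norm ?r)" by (simp add: power_add mult_ac)
    also have "\<dots> \<le> K * (e / (K + 1))" by (intro mult_left_mono *[rule_format] K0)
    also have "\<dots> \<le> e" using K0 \<open>e > 0\<close> by (simp add: field_simps)
    finally show "(1 + norm x) ^ m * norm ((g x * F (t + h) x - g x * F t x) /\<^sub>R h - g x * G t x) \<le> e" .
  qed
qed

text \<open>With \<open>R\<close>, \<open>R'\<close> the errors of the two difference quotients, the error for the product is
  \<open>R F' + F R' + h (R + G) (R' + G')\<close>.\<close>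

lemma rapid_curve_mult:
  fixes F G F' G' :: "real \<Rightarrow> 'a::euclidean_space \<Rightarrow> complex"
  assumes FG: "rapid_curve F G" and FG': "rapid_curve F' G'"
  shows "rapid_curve (\<lambda>t x. F t x * F' t x) (\<lambda>t x. G t x * F' t x + F t x * G' t x)"
proof (rule rapid_curveI)
  show "rapid (\<lambda>x. F t x * F' t x)" "rapid (\<lambda>x. G t x * F' t x + F t x * G' t x)" for t
    by (intro rapid_mult rapid_add rapid_curveD[OF FG] rapid_curveD[OF FG'])+
  fix t m and e :: real assume e: "e > 0"
  obtain C1 where C1: "\<And>x. norm (F t x) \<le> C1" using rapid_bounded[OF rapid_curveD(1)[OF FG]] by blast
  obtain C2 where C2: "\<And>x. norm (F' t x) \<le> C2" using rapid_bounded[OF rapid_curveD(1)[OF FG']] by blast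
  obtain C3 where C3: "\<And>x. (1 + norm x) ^ m * norm (G t x) \<le> C3"
    using rapid_bound[OF rapid_curveD(2)[OF FG]] by blast
  obtain C4 where C4: "\<And>x. norm (G' t x) \<le> C4" using rapid_bounded[OF rapid_curveD(2)[OF FG']] by blast
  define C where "C = \<bar>C1\<bar> + \<bar>C2\<bar> + \<bar>C3\<bar> + \<bar>C4\<bar>"
  have C0: "C \<ge> 0" by (simp add: C_def)
  have C: "norm (F t x) \<le> C" "norm (F' t x) \<le> C" "(1 + norm x) ^ m * norm (G t x) \<le> C" "norm (G' t x) \<le> C" for x
    using C1[of x] C2[of x] C3[of x] C4[of x] unfolding C_def by linarith+
  define d where "d = min 1 (e / (4 * (C + 1)))"
  have d: "d > 0" "d \<le> 1" using e C0 by (auto simp: d_def)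
  have "d * C \<le> e / (4 * (C + 1)) * (C + 1)" using C0 d by (intro mult_mono) (auto simp: d_def)
  also have "\<dots> = e / 4"
  proof -
    have "e / (4 * k) * k = e / 4" if "k \<noteq> 0" for k using that by simp
    moreover have "C + 1 \<noteq> 0" using C0 by linarith
    ultimately show ?thesis by blast
  qed
  finally have dC: "d * C \<le> e / 4" .
  have h0: "\<forall>\<^sub>F h::real in at 0. \<bar>h\<bar> < e / (2 * (C + 1)\<^sup>2)"
  proof -
    have "e / (2 * (C + 1)\<^sup>2) > 0" using e C0 by (simp add: add_nonneg_pos)
    then show ?thesis unfolding eventually_at by (intro exI[of _ "e / (2 * (C + 1)\<^sup>2)"]) (auto simp: dist_real_def)
  qed
  have hne: "\<forall>\<^sub>F h::real in at 0. h \<noteq> 0" by (simp add: eventually_at_filter)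
  from h0 hne rapid_curveD(3)[OF FG d(1), of m t] rapid_curveD(3)[OF FG' d(1), of m t]
  show "\<forall>\<^sub>F h in at 0. \<forall>x. (1 + norm x) ^ m *
      norm ((F (t + h) x * F' (t + h) x - F t x * F' t x) /\<^sub>R h - (G t x * F' t x + F t x * G' t x)) \<le> e"
  proof (eventually_elim, intro allI)
    fix h x
    assume h: "\<bar>h\<bar> < e / (2 * (C + 1)\<^sup>2)" and h0: "h \<noteq> 0"
      and *: "\<forall>x. (1 + norm x) ^ m * norm ((F (t + h) x - F t x) /\<^sub>R h - G t x) \<le> d"
      and **: "\<forall>x. (1 + norm x) ^ m * norm ((F' (t + h) x - F' t x) /\<^sub>R h - G' t x) \<le> d"
    define R where "R = (F (t + h) x - F t x) /\<^sub>R h - G t x"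
    define R' where "R' = (F' (t + h) x - F' t x) /\<^sub>R h - G' t x"
    define W where "W = (1 + norm x) ^ m"
    have W: "1 \<le> W" unfolding W_def by (rule one_le_power) simp
    have R: "W * norm R \<le> d" and WR': "W * norm R' \<le> d"
      using *[rule_format, of x] **[rule_format, of x] unfolding R_def R'_def W_def by auto
    have R': "norm R' \<le> d" using WR' mult_right_mono[OF W, of "norm R'"] by simp
    have F1: "F (t + h) x = F t x + of_real h * (R + G t x)"
      unfolding R_def using h0 by (simp add: scaleR_conv_of_real field_simps)
    have F2: "F' (t + h) x = F' t x + of_real h * (R' + G' t x)"
      unfolding R'_def using h0 by (simp add: scaleR_conv_of_real field_simps)
    have "(F (t + h) x * F' (t + h) x - F t x * F' t x) /\<^sub>R h - (G t x * F' t x + F t x * G' t x) =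
        R * F' t x + F t x * R' + of_real h * ((R + G t x) * (R' + G' t x))"
      unfolding F1 F2 using h0 by (simp add: scaleR_conv_of_real field_simps)
    then have "W * norm ((F (t + h) x * F' (t + h) x - F t x * F' t x) /\<^sub>R h - (G t x * F' t x + F t x * G' t x))
      \<le> W * (norm R * norm (F' t x) + norm (F t x) * norm R' + \<bar>h\<bar> * ((norm R + norm (G t x)) * (norm R' + norm (G' t x))))"
      using W by (intro mult_left_mono)
        (auto intro!: order_trans[OF norm_triangle_ineq] add_mono mult_mono norm_triangle_ineq simp: norm_mult)
    also have "\<dots> = (W * norm R) * norm (F' t x) + norm (F t x) * (W * norm R')
        + \<bar>h\<bar> * ((W * norm R + W * norm (G t x)) * (norm R' + norm (G' t x)))"
      by (simp add: algebra_simps)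
    also have "\<dots> \<le> d * C + C * d + \<bar>h\<bar> * ((d + C) * (d + C))"
      using R WR' R' C[of x] d C0 W unfolding W_def[symmetric]
      by (intro add_mono mult_mono mult_nonneg_nonneg add_nonneg_nonneg) auto
    also have "\<dots> \<le> e / 4 + e / 4 + \<bar>h\<bar> * ((1 + C) * (1 + C))"
      using dC d C0 by (intro add_mono mult_left_mono mult_mono) (auto simp: mult.commute)
    also have "\<bar>h\<bar> * ((1 + C) * (1 + C)) \<le> e / 2"
    proof -
      have "0 < 2 * (C + 1)\<^sup>2" using C0 by (simp add: add_nonneg_pos)
      from h[unfolded pos_less_divide_eq[OF this]] show ?thesis
        by (simp add: power2_eq_square algebra_simps)
    qed
    finally show "(1 + norm x) ^ m * norm ((F (t + h) x * F' (t + h) x - F t x * F' t x) /\<^sub>R h - (G t x * F' t x + F t x * G' t x)) \<le> e"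
      unfolding W_def by simp
  qed
qed

section \<open>Structure of the Moyal--Klein--Gordon equations\<close>

definition transport :: "((real^'n) \<times> (real^'n) \<Rightarrow> complex) \<Rightarrow> (real^'n) \<times> (real^'n) \<Rightarrow> complex" where
  "transport f p = (\<Sum>j\<in>UNIV. of_real (fst p $ j) * dir_deriv (0, axis j 1) f p)"

lemma axis_pair_in_Basis: "(0, axis j (1::real)) \<in> Basis"
  by (intro Pair_0_in_Basis axis_in_Basis)

lemma transport_eq_grad:
  assumes "schwartz f"
  shows "transport f (k, \<eta>) = (\<Sum>j\<in>UNIV. of_real (k $ j) * grad (\<lambda>\<eta>. f (k, \<eta>)) \<eta> $ j)"
  unfolding transport_def grad_def by (simp add: dir_deriv_slice[OF assms])

lemma transport_0: "transport f (0, \<eta>) = 0"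
  by (simp add: transport_def)

lemma coordinate_growth: "norm (complex_of_real (fst (p :: (real^'n) \<times> (real^'n)) $ j)) \<le> 1 * (1 + norm p) ^ 1"
proof -
  have "\<bar>fst p $ j\<bar> \<le> norm (fst p)" by (rule component_le_norm_cart)
  also have "\<dots> \<le> norm p" using norm_fst_le[of "fst p" "snd p"] by simp
  finally show ?thesis by simp
qed

lemma coordinate_measurable: "(\<lambda>p. complex_of_real (fst (p :: (real^'n) \<times> (real^'n)) $ j)) \<in> borel_measurable borel"
  by (intro borel_measurable_continuous_onI continuous_intros)

lemma transport_rapid:
  assumes "schwartz f"
  shows "rapid (transport f)"
proof -
  have "rapid (\<lambda>p. \<Sum>j\<in>J. of_real (fst p $ j) * dir_deriv (0, axis j 1) f p)" if "finite J" for J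
    using that
  proof (induction J)
    case empty
    then show ?case by (auto simp: rapid_def)
  next
    case (insert j J)
    have "rapid (\<lambda>p. of_real (fst p $ j) * dir_deriv (0, axis j 1) f p)"
      by (intro rapid_mult_growth[OF _ coordinate_measurable coordinate_growth]
          schwartz_rapid schwartz_dir_deriv assms axis_pair_in_Basis)
    with insert show ?case by (simp add: rapid_add)
  qed
  from this[of UNIV] show ?thesis unfolding transport_def[abs_def] by simp
qed

text \<open>The integrand is the divergence in \<open>\<eta>\<close> of \<open>k \<bar>f\<bar>\<^sup>2\<close>.\<close>

lemma transport_antisymmetric:
  fixes f :: "(real^'n) \<times> (real^'n) \<Rightarrow> complex"
  assumes f: "schwartz f"
  shows "(LINT p|lborel. transport f p * cnj (f p) + f p * cnj (transport f p)) = 0"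
proof -
  let ?g = "\<lambda>p. f p * cnj (f p)"
  have g: "schwartz ?g" by (intro schwartz_mult schwartz_cnj f)
  have D: "dir_deriv b ?g p = f p * cnj (dir_deriv b f p) + dir_deriv b f p * cnj (f p)" for b p
    using dir_deriv_mult[OF schwartz_differentiable[OF f] schwartz_differentiable[OF schwartz_cnj[OF f]]]
      dir_deriv_bounded_linear[OF bounded_linear_cnj schwartz_differentiable[OF f]] by metis
  have e: "transport f p * cnj (f p) + f p * cnj (transport f p) =
      (\<Sum>j\<in>UNIV. of_real (fst p $ j) * dir_deriv (0, axis j 1) ?g p)" for p
    unfolding transport_def D
    by (simp add: sum_distrib_left sum_distrib_right distrib_left sum.distrib mult_ac)
  have i: "integrable lborel (\<lambda>p. of_real (fst p $ j) * dir_deriv (0, axis j 1) ?g p)" for j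
    by (intro rapid_integrable rapid_mult_growth[OF _ coordinate_measurable coordinate_growth]
        schwartz_rapid schwartz_dir_deriv g axis_pair_in_Basis)
  have "(LINT p|lborel. of_real (fst p $ j) * dir_deriv (0, axis j 1) ?g p) = 0" for j
  proof -
    have "(LINT p|lborel. of_real (fst p $ j) * dir_deriv (0, axis j 1) ?g p) =
        (LINT k|lborel. LINT \<eta>|lborel. of_real (k $ j) * dir_deriv (0, axis j 1) ?g (k, \<eta>))"
      using lborel_integral_fst[OF i] by simp
    also have "\<dots> = (LINT k|lborel. of_real (k $ j) * (LINT \<eta>|lborel. dir_deriv (axis j 1) (\<lambda>\<eta>. ?g (k, \<eta>)) \<eta>))"
      by (simp add: dir_deriv_slice[OF g])
    also have "\<dots> = 0"
      using schwartz_integral_dir_deriv[OF schwartz_slice[OF g] axis_in_Basis] by simp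
    finally show ?thesis .
  qed
  then show ?thesis unfolding e using i by simp
qed

lemma transport_diff:
  assumes "schwartz f" "schwartz g"
  shows "transport (\<lambda>p. f p - g p) p = transport f p - transport g p"
proof -
  have "dir_deriv b (\<lambda>p. f p - g p) p = dir_deriv b f p - dir_deriv b g p" for b
    using dir_deriv_lincomb[of f p g b 1 "-1"] assms by (simp add: schwartz_differentiable)
  then show ?thesis by (simp add: transport_def right_diff_distrib sum_subtractf)
qed

lemma schwartz_uminus_arg:
  fixes f :: "'a::euclidean_space \<Rightarrow> 'b::real_normed_vector"
  shows "schwartz f \<Longrightarrow> schwartz (\<lambda>x. f (- x))"
  using schwartz_compose_affine[of uminus f 0] by (simp add: linear_uminus)

lemma transport_hermitian:
  assumes f: "schwartz f"
  shows "transport (\<lambda>p. cnj (f (- p))) p = cnj (transport f (- p))"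
proof -
  have "dir_deriv b (\<lambda>p. cnj (f (- p))) p = - cnj (dir_deriv b f (- p))" for b
  proof -
    have "dir_deriv b (\<lambda>p. cnj (f (- p))) p = cnj (dir_deriv b (\<lambda>p. f (- p)) p)"
      by (rule dir_deriv_bounded_linear[OF bounded_linear_cnj schwartz_differentiable[OF schwartz_uminus_arg[OF f]]])
    also have "dir_deriv b (\<lambda>p. f (- p)) p = dir_deriv (- b) f (- p)"
      using dir_deriv_compose_affine[of uminus f 0 p b] schwartz_differentiable[OF f] by (simp add: linear_uminus)
    also have "\<dots> = - dir_deriv b f (- p)"
      unfolding dir_deriv_def
      using linear_neg[OF linear_frechet_derivative[OF schwartz_differentiable[OF f]]] by blast
    finally show ?thesis by simp
  qed
  then show ?thesis by (simp add: transport_def)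
qed

text \<open>Convolution with \<open>b\<close> has as its adjoint the convolution with \<open>q \<mapsto> cnj (b (- q))\<close>.\<close>

lemma convolution_antisymmetric:
  fixes b g :: "'a::euclidean_space \<Rightarrow> complex"
  assumes b: "integrable lborel b" and bneg: "\<And>q. cnj (b (- q)) = - b q"
    and g: "integrable lborel g" and gm: "\<And>x. norm (g x) \<le> M"
  shows "(LINT k|lborel. (LINT q|lborel. b q * g (k - q)) * cnj (g k) + g k * cnj (LINT q|lborel. b q * g (k - q))) = 0"
proof -
  have [measurable]: "b \<in> borel_measurable borel" "g \<in> borel_measurable borel"
    using b g borel_measurable_integrable by force+
  have meas: "(\<lambda>p. b (snd p) * g (fst p - snd p) * cnj (g (fst p))) \<in> borel_measurable (borel :: ('a \<times> 'a) measure)"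
    unfolding borel_prod[symmetric] by measurable
  have int: "integrable lborel (\<lambda>p. b (snd p) * g (fst p - snd p) * cnj (g (fst p)))"
  proof (rule Bochner_Integration.integrable_bound)
    show "integrable lborel (\<lambda>p. of_real M * (g (fst p) * b (snd p)))"
      by (intro integrable_mult_right integrable_tensor g b)
    show "AE p in lborel. norm (b (snd p) * g (fst p - snd p) * cnj (g (fst p))) \<le> norm (of_real M * (g (fst p) * b (snd p)))"
    proof (rule AE_I2)
      fix p :: "'a \<times> 'a"
      have "norm (b (snd p)) * norm (g (fst p - snd p)) * norm (g (fst p)) \<le> norm (b (snd p)) * \<bar>M\<bar> * norm (g (fst p))"
        by (intro mult_right_mono mult_left_mono order_trans[OF gm abs_ge_self]) auto
      then show "norm (b (snd p) * g (fst p - snd p) * cnj (g (fst p))) \<le> norm (of_real M * (g (fst p) * b (snd p)))"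
        by (simp add: norm_mult mult_ac)
    qed
  qed (use meas in simp)
  define J where "J = (LINT k|lborel. (LINT q|lborel. b q * g (k - q)) * cnj (g k))"
  have J: "J = (LINT k|lborel. LINT q|lborel. b q * g (k - q) * cnj (g k))"
    unfolding J_def by simp
  have intk: "integrable lborel (\<lambda>k. (LINT q|lborel. b q * g (k - q)) * cnj (g k))"
    using lborel_integrable_fst[OF int] by simp
  have J': "J = (LINT q|lborel. b q * (LINT k|lborel. g (k - q) * cnj (g k)))"
    unfolding J using lborel_integral_swap[OF int] by (simp add: mult.assoc)
  have "cnj J = (LINT q|lborel. cnj (b q) * (LINT k|lborel. cnj (g (k - q)) * g k))"
    unfolding J' by (simp add: Bochner_Integration.integral_cnj[symmetric] del: Bochner_Integration.integral_cnj)
  also have "\<dots> = (LINT q|lborel. cnj (b q) * (LINT k|lborel. cnj (g (q + k - q)) * g (q + k)))"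
  proof -
    have "(LINT k|lborel. cnj (g (k - q)) * g k) = (LINT k|lborel. cnj (g (q + k - q)) * g (q + k))" for q
      by (rule lborel_integral_shift[symmetric]) measurable
    then show ?thesis by (simp only:)
  qed
  also have "\<dots> = (LINT q|lborel. cnj (b q) * (LINT k|lborel. cnj (g k) * g (k + q)))"
    by (simp add: add.commute)
  also have "\<dots> = (LINT q|lborel. cnj (b (- q)) * (LINT k|lborel. cnj (g k) * g (k + - q)))"
    by (rule lborel_integral_uminus[symmetric]) measurable
  also have "\<dots> = - J"
    unfolding bneg J' by (simp add: mult.commute)
  finally have cJ: "cnj J = - J" .
  have "(LINT k|lborel. (LINT q|lborel. b q * g (k - q)) * cnj (g k) + g k * cnj (LINT q|lborel. b q * g (k - q)))
      = J + (LINT k|lborel. g k * cnj (LINT q|lborel. b q * g (k - q)))"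
    unfolding J_def
  proof (intro Bochner_Integration.integral_add intk)
    show "integrable lborel (\<lambda>k. g k * cnj (LINT q|lborel. b q * g (k - q)))"
      using integrable_cnj[OF intk] by (simp add: mult.commute)
  qed
  also have "(LINT k|lborel. g k * cnj (LINT q|lborel. b q * g (k - q))) = cnj J"
  proof -
    have "cnj J = (LINT k|lborel. cnj ((LINT q|lborel. b q * g (k - q)) * cnj (g k)))"
      unfolding J_def by (rule Bochner_Integration.integral_cnj[symmetric])
    also have "\<dots> = (LINT k|lborel. g k * cnj (LINT q|lborel. b q * g (k - q)))"
      by (simp only: complex_cnj_mult complex_cnj_cnj mult.commute)
    finally show ?thesis by simp
  qed
  finally show ?thesis unfolding cJ by simp
qed

text \<open>At \<open>k = 0\<close> the force term has this form with \<open>\<phi> = sin\<close>. Allowing a general \<open>\<phi>\<close> and \<open>a\<close> makes the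
  class closed under differentiation in \<open>\<eta>\<close>.\<close>

definition oscillatory ::
    "(real \<Rightarrow> real) \<Rightarrow> ('a::euclidean_space \<Rightarrow> complex) \<Rightarrow> ('a \<times> 'a \<Rightarrow> complex) \<Rightarrow> 'a \<Rightarrow> complex" where
  "oscillatory \<phi> a W \<eta> = (LINT q|lborel. of_real (\<phi> ((q \<bullet> \<eta>) / 2)) * a q * W (- q, \<eta>))"

lemma inner_growth_measurable:
  fixes b :: "'a::euclidean_space"
  shows "(\<lambda>q. complex_of_real ((q \<bullet> b) / 2)) \<in> borel_measurable borel"
    and "b \<in> Basis \<Longrightarrow> norm (complex_of_real ((q \<bullet> b) / 2)) \<le> 1 * (1 + norm q) ^ 1"
  using Basis_le_norm[of b q] by auto

lemma
  fixes a :: "'a::euclidean_space \<Rightarrow> complex"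
  assumes \<phi>: "\<And>x. (\<phi> has_real_derivative \<phi>' x) (at x)" "\<And>x. \<bar>\<phi> x\<bar> \<le> 1" "\<And>x. \<bar>\<phi>' x\<bar> \<le> 1"
    and \<phi>'_cont: "continuous_on UNIV \<phi>'"
    and a: "rapid a" and W: "schwartz W"
  shows oscillatory_differentiable: "oscillatory \<phi> a W differentiable (at \<eta>)"
    and dir_deriv_oscillatory: "b \<in> Basis \<Longrightarrow> dir_deriv b (oscillatory \<phi> a W) \<eta> =
      oscillatory \<phi>' (\<lambda>q. of_real ((q \<bullet> b) / 2) * a q) W \<eta> + oscillatory \<phi> a (dir_deriv (0, b) W) \<eta>"
proof -
  let ?D = "\<lambda>\<eta> q v. of_real (\<phi>' ((q \<bullet> \<eta>) / 2)) * of_real ((q \<bullet> v) / 2) * a q * W (- q, \<eta>)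
      + of_real (\<phi> ((q \<bullet> \<eta>) / 2)) * a q * frechet_derivative (\<lambda>\<eta>. W (- q, \<eta>)) (at \<eta>) v"
  have [measurable]: "a \<in> borel_measurable borel" by (rule rapid_measurable[OF a])
  have \<phi>_cont: "continuous_on UNIV \<phi>"
    using \<phi>(1) DERIV_isCont continuous_at_imp_continuous_on by blast
  have [measurable]: "\<phi> \<in> borel_measurable borel" "\<phi>' \<in> borel_measurable borel"
    using \<phi>_cont \<phi>'_cont borel_measurable_continuous_onI by blast+
  have WD: "schwartz (dir_deriv (0, c) W)" if "c \<in> Basis" for c
    by (intro schwartz_dir_deriv W Pair_0_in_Basis that)
  have Wm: "(\<lambda>q. V (- q, \<eta>)) \<in> borel_measurable borel" if "schwartz V" for V :: "'a \<times> 'a \<Rightarrow> complex" and \<eta>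
    by (intro borel_measurable_continuous_onI continuous_on_compose2[OF schwartz_continuous[OF that, of UNIV]] continuous_intros) auto
  obtain K0 where K0: "\<And>p. norm (W p) \<le> K0" using schwartz_bounded[OF W] by blast
  have "\<forall>c\<in>Basis. \<exists>K. \<forall>p. norm (dir_deriv (0, c) W p) \<le> K" using schwartz_bounded[OF WD] by blast
  then obtain K where K: "\<And>c p. c \<in> Basis \<Longrightarrow> norm (dir_deriv (0, c) W p) \<le> K c" by metis
  define M where "M = \<bar>K0\<bar> + (\<Sum>c\<in>Basis. \<bar>K c\<bar>)"
  have M: "\<bar>K0\<bar> \<le> M" "(\<Sum>c\<in>Basis. \<bar>K c\<bar>) \<le> M" by (auto simp: M_def sum_nonneg)
  have F: "frechet_derivative (\<lambda>\<eta>. W (- q, \<eta>)) (at \<eta>) v = (\<Sum>c\<in>Basis. (v \<bullet> c) *\<^sub>R dir_deriv (0, c) W (- q, \<eta>))" for q \<eta> v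
    using fun_cong[OF frechet_derivative_at[OF schwartz_has_derivative[OF schwartz_slice[OF W, of "- q"], of \<eta>]], of v]
    by (simp add: dir_deriv_slice[OF W])
  have Fb: "norm (frechet_derivative (\<lambda>\<eta>. W (- q, \<eta>)) (at \<eta>) v) \<le> M * norm v" for q \<eta> v
  proof -
    have "norm (frechet_derivative (\<lambda>\<eta>. W (- q, \<eta>)) (at \<eta>) v) \<le> (\<Sum>c\<in>Basis. norm v * \<bar>K c\<bar>)"
      unfolding F
    proof (rule sum_norm_le)
      fix c :: 'a assume c: "c \<in> Basis"
      show "norm ((v \<bullet> c) *\<^sub>R dir_deriv (0, c) W (- q, \<eta>)) \<le> norm v * \<bar>K c\<bar>"
        unfolding norm_scaleR by (intro mult_mono Basis_le_norm c order_trans[OF K abs_ge_self]) auto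
    qed
    also have "\<dots> = norm v * (\<Sum>c\<in>Basis. \<bar>K c\<bar>)" by (simp add: sum_distrib_left)
    also have "\<dots> \<le> M * norm v"
      using mult_right_mono[OF M(2) norm_ge_zero[of v]] by (simp add: mult.commute)
    finally show ?thesis .
  qed
  have ra: "rapid (\<lambda>q. of_real (1 + norm q) * a q)"
    by (rule rapid_mult_growth[OF a, of _ 1 1]) (auto simp: abs_of_nonneg add_nonneg_nonneg simp del: of_real_add)
  have i: "integrable lborel (\<lambda>q. of_real (\<psi> ((q \<bullet> \<eta>) / 2)) * c q * V (- q, \<eta>))"
    if H: "\<psi> \<in> borel_measurable borel" "\<And>x. \<bar>\<psi> x\<bar> \<le> 1" "rapid c" "schwartz V" for \<psi> :: "real \<Rightarrow> real" and c and V :: "'a \<times> 'a \<Rightarrow> complex" and \<eta>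
  proof -
    note [measurable] = H(1) rapid_measurable[OF H(3)] Wm[OF H(4)]
    obtain N where N: "\<And>p. norm (V p) \<le> N" using schwartz_bounded[OF H(4)] by blast
    show ?thesis
    proof (rule Bochner_Integration.integrable_bound)
      show "integrable lborel (\<lambda>q. of_real N * c q)"
        by (intro integrable_mult_right rapid_integrable H)
      show "AE q in lborel. norm (of_real (\<psi> ((q \<bullet> \<eta>) / 2)) * c q * V (- q, \<eta>)) \<le> norm (of_real N * c q)"
      proof (rule AE_I2)
        fix q
        have "norm (of_real (\<psi> ((q \<bullet> \<eta>) / 2)) * c q * V (- q, \<eta>)) \<le> 1 * norm (c q) * \<bar>N\<bar>"
          unfolding norm_mult norm_of_real
          by (intro mult_mono H order_trans[OF N abs_ge_self]) auto
        then show "norm (of_real (\<psi> ((q \<bullet> \<eta>) / 2)) * c q * V (- q, \<eta>)) \<le> norm (of_real N * c q)"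
          by (simp add: norm_mult mult.commute)
      qed
    qed measurable
  qed
  have der: "((\<lambda>\<eta>. oscillatory \<phi> a W \<eta>) has_derivative (\<lambda>v. LINT q|lborel. ?D \<eta> q v)) (at \<eta>)" for \<eta>
    unfolding oscillatory_def
  proof (rule has_derivative_integral[where e = 1 and B = "\<lambda>q. 2 * M * norm (of_real (1 + norm q) * a q)" and f' = ?D])
    show "integrable lborel (\<lambda>q. 2 * M * norm (of_real (1 + norm q) * a q))"
      by (intro integrable_mult_right integrable_norm rapid_integrable ra)
    show "((\<lambda>\<eta>. of_real (\<phi> ((q \<bullet> \<eta>) / 2)) * a q * W (- q, \<eta>)) has_derivative ?D \<eta> q) (at \<eta>)" for \<eta> q
    proof -
      have "((\<lambda>\<eta>. (q \<bullet> \<eta>) / 2) has_derivative (\<lambda>v. (q \<bullet> v) / 2)) (at \<eta>)"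
        by (auto intro!: derivative_eq_intros)
      from diff_chain_at[OF this \<phi>(1)[unfolded has_field_derivative_def]]
      have "((\<lambda>\<eta>. \<phi> ((q \<bullet> \<eta>) / 2)) has_derivative (\<lambda>v. \<phi>' ((q \<bullet> \<eta>) / 2) * ((q \<bullet> v) / 2))) (at \<eta>)"
        by (simp add: o_def)
      from has_derivative_mult[OF has_derivative_mult[OF bounded_linear.has_derivative[OF bounded_linear_of_real this]
          has_derivative_const[of "a q"]] frechet_derivativeI[OF schwartz_differentiable[OF schwartz_slice[OF W, of "- q"]]]]
      show ?thesis by (rule has_derivative_eq_rhs) (auto simp: algebra_simps)
    qed
    show "norm (?D \<eta> q v) \<le> 2 * M * norm (of_real (1 + norm q) * a q) * norm v" for \<eta> q v
    proof -
      have "norm (of_real (\<phi>' ((q \<bullet> \<eta>) / 2)) * of_real ((q \<bullet> v) / 2) * a q * W (- q, \<eta>)) \<le>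
          1 * ((1 + norm q) * norm v) * norm (a q) * M"
      proof -
        have "\<bar>q \<bullet> v\<bar> \<le> norm q * norm v" by (rule Cauchy_Schwarz_ineq2)
        then have "\<bar>(q \<bullet> v) / 2\<bar> \<le> (1 + norm q) * norm v"
          using mult_nonneg_nonneg[OF norm_ge_zero[of q] norm_ge_zero[of v]] norm_ge_zero[of v]
          unfolding distrib_right abs_divide by linarith
        then show ?thesis
          unfolding norm_mult norm_of_real
          by (intro mult_mono \<phi> order_trans[OF K0 order_trans[OF abs_ge_self M(1)]]) auto
      qed
      moreover have "norm (of_real (\<phi> ((q \<bullet> \<eta>) / 2)) * a q * frechet_derivative (\<lambda>\<eta>. W (- q, \<eta>)) (at \<eta>) v) \<le>
          1 * norm (a q) * (M * norm v)"
        unfolding norm_mult norm_of_real by (intro mult_mono \<phi> Fb) auto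
      moreover have "1 * norm (a q) * (M * norm v) \<le> 1 * ((1 + norm q) * norm v) * norm (a q) * M"
        using M(1) mult_right_mono[of 1 "1 + norm q" "norm v * norm (a q) * M"] by (simp add: mult_ac)
      ultimately have "norm (?D \<eta> q v) \<le> 2 * (1 * ((1 + norm q) * norm v) * norm (a q) * M)"
        using norm_triangle_ineq[of "of_real (\<phi>' ((q \<bullet> \<eta>) / 2)) * of_real ((q \<bullet> v) / 2) * a q * W (- q, \<eta>)"
            "of_real (\<phi> ((q \<bullet> \<eta>) / 2)) * a q * frechet_derivative (\<lambda>\<eta>. W (- q, \<eta>)) (at \<eta>) v"] by linarith
      also have "\<dots> = 2 * M * norm (of_real (1 + norm q) * a q) * norm v"
        by (simp add: norm_mult mult_ac abs_of_nonneg add_nonneg_nonneg del: of_real_add)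
      finally show ?thesis .
    qed
    show "integrable lborel (\<lambda>q. of_real (\<phi> ((q \<bullet> \<eta>) / 2)) * a q * W (- q, \<eta>))" for \<eta>
      by (intro i a W \<phi>) measurable
    show "(\<lambda>q. ?D \<eta> q v) \<in> borel_measurable lborel" for v
    proof -
      have [measurable]: "(\<lambda>q. frechet_derivative (\<lambda>\<eta>. W (- q, \<eta>)) (at \<eta>) v) \<in> borel_measurable borel"
        unfolding F by (intro borel_measurable_sum borel_measurable_scaleR borel_measurable_const Wm WD)
      note [measurable] = Wm[OF W]
      show ?thesis by measurable
    qed
  qed simp
  show "oscillatory \<phi> a W differentiable (at \<eta>)"
    using der unfolding differentiable_def by blast
  assume b: "b \<in> Basis"
  have ab: "rapid (\<lambda>q. of_real ((q \<bullet> b) / 2) * a q)"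
    by (rule rapid_mult_growth[OF a inner_growth_measurable(1) inner_growth_measurable(2)[OF b]])
  have Fbq: "frechet_derivative (\<lambda>\<eta>. W (- q, \<eta>)) (at \<eta>) b = dir_deriv (0, b) W (- q, \<eta>)" for q
    using fun_cong[OF dir_deriv_slice[OF W, of b "- q"], of \<eta>] by (simp add: dir_deriv_def)
  have "dir_deriv b (oscillatory \<phi> a W) \<eta> = (LINT q|lborel. ?D \<eta> q b)"
    by (rule dir_deriv_eqI[OF der])
  also have "\<dots> = (LINT q|lborel. of_real (\<phi>' ((q \<bullet> \<eta>) / 2)) * (of_real ((q \<bullet> b) / 2) * a q) * W (- q, \<eta>)
      + of_real (\<phi> ((q \<bullet> \<eta>) / 2)) * a q * dir_deriv (0, b) W (- q, \<eta>))"
    unfolding Fbq by (simp only: mult.assoc)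
  also have "\<dots> = oscillatory \<phi>' (\<lambda>q. of_real ((q \<bullet> b) / 2) * a q) W \<eta> + oscillatory \<phi> a (dir_deriv (0, b) W) \<eta>"
    unfolding oscillatory_def
    by (intro Bochner_Integration.integral_add i ab a W WD b \<phi>) measurable
  finally show "dir_deriv b (oscillatory \<phi> a W) \<eta> =
      oscillatory \<phi>' (\<lambda>q. of_real ((q \<bullet> b) / 2) * a q) W \<eta> + oscillatory \<phi> a (dir_deriv (0, b) W) \<eta>" .
qed

text \<open>Of the four second-order terms, those carrying a factor \<open>sin\<close> vanish at the origin; the two mixed
  ones are equal.\<close>

lemma second_dir_deriv_oscillatory_sin:
  fixes a :: "'a::euclidean_space \<Rightarrow> complex"
  assumes a: "rapid a" and W: "schwartz W" and b: "b \<in> Basis"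
  shows "dir_deriv b (dir_deriv b (oscillatory sin a W)) 0 = (LINT q|lborel. of_real (q \<bullet> b) * a q * dir_deriv (0, b) W (- q, 0))"
proof -
  let ?ab = "\<lambda>q. of_real ((q \<bullet> b) / 2) * a q" and ?W = "dir_deriv (0, b) W"
  have ab: "rapid ?ab"
    by (rule rapid_mult_growth[OF a inner_growth_measurable(1) inner_growth_measurable(2)[OF b]])
  have W': "schwartz ?W" by (intro schwartz_dir_deriv W Pair_0_in_Basis b)
  have s: "(sin has_real_derivative cos x) (at x)" "(cos has_real_derivative - sin x) (at x)" for x :: real
    by (auto intro!: derivative_eq_intros)
  have cont: "continuous_on UNIV (cos :: real \<Rightarrow> real)" "continuous_on UNIV (\<lambda>x::real. - sin x)"
    by (intro continuous_intros)+
  have le: "\<bar>sin x\<bar> \<le> 1" "\<bar>cos x\<bar> \<le> 1" "\<bar>- sin x\<bar> \<le> 1" for x :: real by auto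
  have 1: "dir_deriv b (oscillatory sin a W) = (\<lambda>\<eta>. 1 *\<^sub>R oscillatory cos ?ab W \<eta> + 1 *\<^sub>R oscillatory sin a ?W \<eta>)"
    by (rule ext, subst dir_deriv_oscillatory[OF s(1) le(1,2) cont(1) a W b]) simp
  have "dir_deriv b (dir_deriv b (oscillatory sin a W)) 0 =
      1 *\<^sub>R dir_deriv b (oscillatory cos ?ab W) 0 + 1 *\<^sub>R dir_deriv b (oscillatory sin a ?W) 0"
    unfolding 1
    by (rule dir_deriv_lincomb[OF oscillatory_differentiable[OF s(2) le(2,3) cont(2) ab W]
          oscillatory_differentiable[OF s(1) le(1,2) cont(1) a W']])
  also have "\<dots> = oscillatory cos ?ab ?W 0 + oscillatory cos ?ab ?W 0"
    unfolding dir_deriv_oscillatory[OF s(2) le(2,3) cont(2) ab W b]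
      dir_deriv_oscillatory[OF s(1) le(1,2) cont(1) a W' b]
    by (simp add: oscillatory_def)
  also have "\<dots> = 2 * oscillatory cos ?ab ?W 0" by simp
  also have "\<dots> = (LINT q|lborel. of_real (q \<bullet> b) * a q * ?W (- q, 0))"
    unfolding oscillatory_def integral_mult_right_zero[symmetric] by (simp add: mult.assoc)
  finally show ?thesis .
qed

section \<open>Conservation laws\<close>

lemma
  fixes F :: "real \<Rightarrow> 'a::euclidean_space \<Rightarrow> 'b::real_normed_vector"
  assumes "smooth_rapidly_decreasing F"
  shows smooth_rapidly_decreasing_schwartz: "schwartz (F t)"
    and smooth_rapidly_decreasing_schwartz_dt: "schwartz (dt F t)"
    and smooth_rapidly_decreasing_foldr_curve: "set bs \<subseteq> Basis \<Longrightarrow>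
      rapid_curve (\<lambda>t. foldr dir_deriv bs (F t)) (\<lambda>t. foldr dir_deriv bs (dt F t))"
    and smooth_rapidly_decreasing_rapid_curve: "rapid_curve F (dt F)"
proof -
  obtain G where G: "\<And>t. schwartz (F t)" "\<And>t. schwartz (G t)"
    "\<And>bs. set bs \<subseteq> Basis \<Longrightarrow> rapid_curve (\<lambda>t. foldr dir_deriv bs (F t)) (\<lambda>t. foldr dir_deriv bs (G t))"
    using smooth_rapidly_decreasing_curve[OF assms] by blast
  have FG: "rapid_curve F G" using G(3)[of "[]"] by simp
  have dt: "dt F = G" by (intro ext rapid_curve_dt[OF FG])
  show "schwartz (F t)" "schwartz (dt F t)" "rapid_curve F (dt F)"
    using G FG by (auto simp: dt)
  show "set bs \<subseteq> Basis \<Longrightarrow> rapid_curve (\<lambda>t. foldr dir_deriv bs (F t)) (\<lambda>t. foldr dir_deriv bs (dt F t))"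
    unfolding dt by (rule G(3))
qed

lemma constant_of_zero_derivative:
  fixes f :: "real \<Rightarrow> 'b::real_normed_vector"
  assumes "\<And>t. (f has_vector_derivative 0) (at t)"
  shows "f t = f 0"
proof -
  have "\<exists>c. \<forall>t\<in>UNIV. f t = c"
    using assms by (intro has_derivative_zero_constant) (auto simp: has_vector_derivative_def)
  then show ?thesis by auto
qed

lemma continuous_eq_0_of_integral_eq_0:
  fixes f :: "'a::euclidean_space \<Rightarrow> real"
  assumes cont: "continuous_on UNIV f" and pos: "\<And>x. 0 \<le> f x" and int: "integrable lborel f"
    and zero: "(LINT x|lborel. f x) = 0"
  shows "f x = 0"
proof (rule ccontr)
  assume "f x \<noteq> 0"
  have "AE x in lborel. f x = 0"
    using integral_nonneg_eq_0_iff_AE[OF int] pos zero by auto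
  moreover have op: "open {x. f x \<noteq> 0}"
    using open_Collect_neq[OF cont continuous_on_const] .
  ultimately have "{x. f x \<noteq> 0} \<in> null_sets lborel"
    by (subst (asm) AE_iff_null) (auto intro!: borel_open)
  then have "negligible {x. f x \<noteq> 0}"
    by (simp add: negligible_iff_null_sets null_sets_completionI)
  moreover have "{x. f x \<noteq> 0} \<noteq> {}" using \<open>f x \<noteq> 0\<close> by blast
  ultimately show False using open_not_negligible[OF op] by blast
qed

text \<open>That the initial datum comes from a wave function enters the evolution only through its hermitian
  symmetry.\<close>

locale mkg_solution =
  fixes X :: "real^'n \<Rightarrow> real" and w :: "real \<Rightarrow> (real^'n) \<times> (real^'n) \<Rightarrow> complex"
    and \<alpha> :: "real \<Rightarrow> real^'n \<Rightarrow> complex"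
  assumes X: "test_function X" and X_even: "\<And>k. X (- k) = X k"
    and w: "smooth_rapidly_decreasing w" and \<alpha>: "smooth_rapidly_decreasing \<alpha>"
    and system: "mkg_system X w \<alpha>"
    and hermitian_0: "\<And>p. cnj (w 0 (- p)) = w 0 p"
begin

definition norming :: real where "norming = (2 * pi) powr (- real CARD('n) / 2)"

definition coupling :: "real^'n \<Rightarrow> real" where "coupling k = bracket k powr (-1/2) * X k"

definition potential :: "real \<Rightarrow> real^'n \<Rightarrow> complex" where "potential t k = of_real (coupling k) * herm (\<alpha> t) k"

definition force :: "real \<Rightarrow> (real^'n) \<times> (real^'n) \<Rightarrow> complex" where
  "force t p = (LINT q|lborel. of_real (sin ((q \<bullet> snd p) / 2)) * potential t q * herm (w t) (fst p - q, snd p))"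

lemma schwartz_w: "schwartz (w t)" and schwartz_dt_w: "schwartz (dt w t)"
  and curve_w: "rapid_curve w (dt w)" and curve_\<alpha>: "rapid_curve \<alpha> (dt \<alpha>)"
  and schwartz_\<alpha>: "schwartz (\<alpha> t)"
  using smooth_rapidly_decreasing_schwartz smooth_rapidly_decreasing_schwartz_dt
    smooth_rapidly_decreasing_rapid_curve w \<alpha> by blast+

lemma X_measurable[measurable]: "X \<in> borel_measurable borel"
  using test_function_bounded_measurable[OF X] by blast

lemma coupling_measurable: "coupling \<in> borel_measurable borel"
  unfolding coupling_def[abs_def] by measurable

lemma coupling_bounded: "\<exists>K. \<forall>k. \<bar>coupling k\<bar> \<le> K"
proof -
  obtain K where K: "\<And>k. \<bar>X k\<bar> \<le> K" using test_function_bounded_measurable[OF X] by blast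
  have "\<bar>coupling k\<bar> \<le> 1 * K" for k
  proof -
    have "bracket k powr (-1/2) \<le> 1" using powr_mono[of "-1/2" 0, OF _ bracket_ge_1[of k]] bracket_pos[of k] by simp
    then show ?thesis
      unfolding coupling_def abs_mult by (intro mult_mono K) auto
  qed
  then show ?thesis by blast
qed

lemma coupling_uminus[simp]: "coupling (- k) = coupling k"
  by (simp add: coupling_def X_even)

lemma rapid_coupling:
  "rapid f \<Longrightarrow> rapid (\<lambda>k. of_real (coupling k) * f k)" for f :: "real^'n \<Rightarrow> complex"
  using coupling_bounded coupling_measurable
  by (auto intro!: rapid_mult_growth[where N = 0])

lemma rapid_curve_coupling:
  "rapid_curve F G \<Longrightarrow> rapid_curve (\<lambda>t k. of_real (coupling k) * F t k) (\<lambda>t k. of_real (coupling k) * G t k)"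
  for F G :: "real \<Rightarrow> real^'n \<Rightarrow> complex"
  using coupling_bounded coupling_measurable
  by (auto intro!: rapid_curve_mult_growth[where N = 0])

lemma rapid_herm:
  fixes f :: "'a::euclidean_space \<Rightarrow> complex"
  assumes "rapid f"
  shows "rapid (herm f)"
proof -
  have "rapid (\<lambda>p. (1/2) * (f p + cnj (f (- p))))"
    by (rule rapid_mult_growth[where K = "1/2" and N = 0])
       (auto intro!: rapid_add rapid_cnj rapid_uminus assms)
  then show ?thesis by (simp add: herm_def[abs_def])
qed

lemma rapid_potential: "rapid (potential t)"
  unfolding potential_def[abs_def]
  by (intro rapid_coupling rapid_herm schwartz_rapid schwartz_\<alpha>)

lemma herm_uminus: "herm f (- p) = cnj (herm f p)"
  by (simp add: herm_def add.commute)

lemma potential_uminus: "potential t (- k) = cnj (potential t k)"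
  by (simp add: potential_def herm_uminus)

lemma norming_pos: "norming > 0"
  by (simp add: norming_def)

text \<open>The constant of the system, \<open>(2 \<pi>) powr (d / 2)\<close>, and that of the bilinear map, \<open>2 / (2 \<pi>) ^ d\<close>,
  combine to \<open>2 * norming\<close>.\<close>

lemma dt_w_eq: "dt w t p = transport (w t) p - of_real (2 * norming) * force t p"
proof -
  obtain k \<eta> where p: "p = (k, \<eta>)" by fastforce
  have c: "(2 * pi) powr (real CARD('n) / 2) * (2 / (2 * pi) ^ CARD('n)) = 2 * norming"
  proof -
    have "(2 * pi) powr (real CARD('n) / 2) * ((2 * pi) powr (- real CARD('n))) = norming"
      unfolding norming_def by (simp flip: powr_add)
    then have "(2 * pi) powr (real CARD('n) / 2) * (1 / (2 * pi) ^ CARD('n)) = norming"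
      by (simp add: powr_minus_divide powr_realpow)
    moreover have "a * (2 / b) = 2 * (a * (1 / b))" for a b :: real by simp
    ultimately show ?thesis by (simp only:)
  qed
  have y: "yukawa X (\<lambda>(k, _). of_real (bracket k powr (- 1 / 2)) * \<alpha> t k) (w t) (k, \<eta>) =
      of_real (2 / (2 * pi) ^ CARD('n)) * force t p"
    unfolding yukawa_def force_def potential_def coupling_def p
    by (simp add: herm_def algebra_simps)
  have "dt w t (k, \<eta>) - transport (w t) (k, \<eta>) + of_real ((2 * pi) powr (real CARD('n) / 2)) *
          yukawa X (\<lambda>(k, _). of_real (bracket k powr (- 1 / 2)) * \<alpha> t k) (w t) (k, \<eta>) = 0"
    using system unfolding mkg_system_def transport_eq_grad[OF schwartz_w] by blast
  then have "dt w t p = transport (w t) p - of_real ((2 * pi) powr (real CARD('n) / 2) * (2 / (2 * pi) ^ CARD('n))) * force t p"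
    unfolding y p of_real_mult by (simp add: algebra_simps)
  then show ?thesis unfolding c .
qed

lemma dt_\<alpha>_eq: "dt \<alpha> t k = - \<i> * of_real (bracket k) * \<alpha> t k - \<i> * of_real (norming * coupling k) * w t (k, 0)"
proof -
  have "dt \<alpha> t k + \<i> * of_real (bracket k) * \<alpha> t k
        + \<i> * of_real ((2 * pi) powr (- real CARD('n) / 2)) * of_real (bracket k powr (- 1 / 2)) *
          of_real (X k) * w t (k, 0) = 0"
    using system unfolding mkg_system_def by blast
  then show ?thesis
    unfolding norming_def coupling_def of_real_mult by (simp add: algebra_simps eq_neg_iff_add_eq_0)
qed

lemma force_uminus: "cnj (force t (- p)) = force t p"
proof -
  have [measurable]: "potential t \<in> borel_measurable borel" by (rule rapid_measurable[OF rapid_potential])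
  have hm: "herm (w t) \<in> borel_measurable borel"
    by (intro rapid_measurable rapid_herm schwartz_rapid schwartz_w)
  have [measurable]: "(\<lambda>q. herm (w t) (fst p - q, snd p)) \<in> borel_measurable borel"
    by (rule measurable_compose[OF _ hm]) (intro borel_measurable_continuous_onI continuous_intros)
  have "cnj (force t (- p)) = (LINT q|lborel. of_real (sin ((- q \<bullet> snd p) / 2)) * potential t (- q) * herm (w t) (fst p - - q, snd p))"
  proof -
    have "herm (w t) (- fst p - q, - snd p) = cnj (herm (w t) (fst p - - q, snd p))" for q
      using herm_uminus[of "w t" "(fst p + q, snd p)"] by simp
    then show ?thesis
      unfolding force_def Bochner_Integration.integral_cnj[symmetric]
      by (simp add: potential_uminus)
  qed
  also have "\<dots> = force t p"
    unfolding force_def by (rule lborel_integral_uminus) measurable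
  finally show ?thesis .
qed

lemma force_0: "force t (k, 0) = 0"
  by (simp add: force_def)

lemma curve_square_integral:
  assumes "rapid_curve F G"
  shows "((\<lambda>t. LINT p|lborel. F t p * cnj (F t p)) has_vector_derivative
     (LINT p|lborel. G t p * cnj (F t p) + F t p * cnj (G t p))) (at t)"
  by (intro rapid_curve_integral rapid_curve_mult rapid_curve_cnj assms)

text \<open>The force is hermitian by construction, so it cancels in the equation for the anti-hermitian part
  \<open>v\<close>, which is therefore freely transported with constant \<open>L\<^sup>2\<close> norm.\<close>

lemma w_hermitian: "cnj (w t (- p)) = w t p"
proof -
  define v where "v = (\<lambda>t p. w t p - cnj (w t (- p)))"
  have inj: "linear (uminus :: (real^'n) \<times> (real^'n) \<Rightarrow> _)" "inj (uminus :: (real^'n) \<times> (real^'n) \<Rightarrow> _)"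
    by (auto simp: linear_uminus)
  have v: "schwartz (v t)" for t
    unfolding v_def by (intro schwartz_diff schwartz_cnj schwartz_uminus_arg schwartz_w)
  have dv: "dt w t p - cnj (dt w t (- p)) = transport (v t) p" for t p
    unfolding v_def transport_diff[OF schwartz_w schwartz_cnj[OF schwartz_uminus_arg[OF schwartz_w]]]
      transport_hermitian[OF schwartz_w] dt_w_eq
    by (simp add: force_uminus algebra_simps)
  have curve: "rapid_curve v (\<lambda>t. transport (v t))"
    using rapid_curve_diff[OF curve_w rapid_curve_cnj[OF rapid_curve_compose[OF inj curve_w]]]
    unfolding dv v_def .
  have "((\<lambda>t. LINT p|lborel. v t p * cnj (v t p)) has_vector_derivative 0) (at t)" for t
    using curve_square_integral[OF curve, of t] unfolding transport_antisymmetric[OF v] .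
  then have "(LINT p|lborel. v t p * cnj (v t p)) = (LINT p|lborel. v 0 p * cnj (v 0 p))"
    by (rule constant_of_zero_derivative)
  also have "\<dots> = 0" by (simp add: v_def hermitian_0)
  finally have "(LINT p|lborel. (norm (v t p))\<^sup>2) = 0"
    unfolding complex_norm_square[symmetric] integral_complex_of_real by (simp only: of_real_eq_0_iff)
  then have "(norm (v t p))\<^sup>2 = 0"
    by (intro continuous_eq_0_of_integral_eq_0[where f = "\<lambda>p. (norm (v t p))\<^sup>2"] schwartz_continuous
        schwartz_integrable schwartz_norm_power2 v) auto
  then show ?thesis by (simp add: v_def)
qed

lemma herm_w: "herm (w t) = w t"
  by (rule ext) (simp add: herm_def w_hermitian)

lemma mass_conserved: "w t (0, 0) = w 0 (0, 0)"
proof (rule constant_of_zero_derivative)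
  fix t show "((\<lambda>t. w t (0, 0)) has_vector_derivative 0) (at t)"
    using rapid_curve_has_vector_derivative[OF curve_w, of "(0, 0)" t]
    by (simp add: dt_w_eq transport_0 force_0)
qed

text \<open>The equation itself expresses the force through \<open>transport (w t)\<close> and \<open>dt w t\<close>; this is how its
  rapid decrease is obtained.\<close>

lemma force_antisymmetric:
  shows "(LINT p|lborel. force t p * cnj (w t p) + w t p * cnj (force t p)) = 0"
proof -
  have f: "force t p = of_real (1 / (2 * norming)) * (transport (w t) p - dt w t p)" for p
    unfolding dt_w_eq using norming_pos by (simp add: field_simps)
  have rf: "rapid (force t)"
    unfolding f[abs_def]
    by (rule rapid_mult_growth[OF rapid_diff[OF transport_rapid[OF schwartz_w]
          schwartz_rapid[OF schwartz_dt_w]], where K = "norm (complex_of_real (1 / (2 * norming)))" and N = 0]) auto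
  have int: "integrable lborel (\<lambda>p. force t p * cnj (w t p) + w t p * cnj (force t p))"
    by (intro rapid_integrable rapid_add rapid_mult rapid_cnj
        rf schwartz_rapid schwartz_w)
  have "(LINT p|lborel. force t p * cnj (w t p) + w t p * cnj (force t p)) =
      (LINT \<eta>|lborel. LINT k|lborel. force t (k, \<eta>) * cnj (w t (k, \<eta>)) + w t (k, \<eta>) * cnj (force t (k, \<eta>)))"
    by (rule lborel_integral_snd[OF int, symmetric])
  also have "\<dots> = 0"
  proof -
    have "(LINT k|lborel. force t (k, \<eta>) * cnj (w t (k, \<eta>)) + w t (k, \<eta>) * cnj (force t (k, \<eta>))) = 0" for \<eta>
    proof -
      obtain M where M: "\<And>p. norm (w t p) \<le> M" using schwartz_bounded[OF schwartz_w] by blast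
      have b: "rapid (\<lambda>q. of_real (sin ((q \<bullet> \<eta>) / 2)) * potential t q)"
        by (rule rapid_mult_growth[OF rapid_potential, where K = 1 and N = 0]) auto
      show ?thesis
        unfolding force_def herm_w fst_conv snd_conv
        by (rule convolution_antisymmetric[OF rapid_integrable[OF b] _ schwartz_integrable[OF schwartz_slice'[OF schwartz_w]] M])
           (simp add: potential_uminus)
    qed
    then show ?thesis by simp
  qed
  finally show ?thesis .
qed

lemma L2_conserved:
  "(LINT \<eta>|lborel. LINT k|lborel. (norm (w t (k, \<eta>)))\<^sup>2) = (LINT \<eta>|lborel. LINT k|lborel. (norm (w 0 (k, \<eta>)))\<^sup>2)"
proof -
  have rT: "rapid (transport (w t))" and rw: "rapid (w t)"
    and rd: "rapid (dt w t)" for t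
    by (intro transport_rapid schwartz_rapid schwartz_w schwartz_dt_w)+
  have zero: "(LINT p|lborel. dt w t p * cnj (w t p) + w t p * cnj (dt w t p)) = 0" for t
  proof -
    have i1: "integrable lborel (\<lambda>p. transport (w t) p * cnj (w t p) + w t p * cnj (transport (w t) p))"
      and i2: "integrable lborel (\<lambda>p. dt w t p * cnj (w t p) + w t p * cnj (dt w t p))"
      by (intro rapid_integrable rapid_add rapid_mult rapid_cnj rT rw rd)+
    have f: "of_real (2 * norming) * (force t p * cnj (w t p) + w t p * cnj (force t p)) =
        (transport (w t) p * cnj (w t p) + w t p * cnj (transport (w t) p)) -
        (dt w t p * cnj (w t p) + w t p * cnj (dt w t p))" for p
      unfolding dt_w_eq by (simp add: algebra_simps)
    have "0 = (LINT p|lborel. of_real (2 * norming) * (force t p * cnj (w t p) + w t p * cnj (force t p)))"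
      unfolding integral_mult_right_zero force_antisymmetric by simp
    also have "\<dots> = 0 - (LINT p|lborel. dt w t p * cnj (w t p) + w t p * cnj (dt w t p))"
      unfolding f Bochner_Integration.integral_diff[OF i1 i2] transport_antisymmetric[OF schwartz_w] ..
    finally show ?thesis by simp
  qed
  have "(LINT p|lborel. w t p * cnj (w t p)) = (LINT p|lborel. w 0 p * cnj (w 0 p))"
    by (rule constant_of_zero_derivative, rule curve_square_integral[OF curve_w, unfolded zero])
  then have "(LINT p|lborel. (norm (w t p))\<^sup>2) = (LINT p|lborel. (norm (w 0 p))\<^sup>2)"
    unfolding complex_norm_square[symmetric] integral_complex_of_real by (simp only: of_real_eq_iff)
  then show ?thesis
    by (simp only: lborel_integral_snd[OF schwartz_integrable[OF schwartz_norm_power2[OF schwartz_w]]])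
qed

lemma slice_curve: "rapid_curve (\<lambda>t k. w t (- k, 0)) (\<lambda>t k. dt w t (- k, 0))"
  by (rule rapid_curve_compose[OF _ _ curve_w]) (auto simp: inj_def intro!: linearI)

lemma rapid_curve_herm:
  fixes F :: "real \<Rightarrow> 'a::euclidean_space \<Rightarrow> complex"
  assumes "rapid_curve F G"
  shows "rapid_curve (\<lambda>t. herm (F t)) (\<lambda>t. herm (G t))"
proof -
  have m: "rapid_curve (\<lambda>t p. - 1 * cnj (F t (- p))) (\<lambda>t p. - 1 * cnj (G t (- p)))"
    by (rule rapid_curve_mult_growth[OF rapid_curve_cnj[OF rapid_curve_compose[OF _ _ assms]], where K = 1 and N = 0])
       (auto simp: linear_uminus)
  have "rapid_curve (\<lambda>t p. (1/2) * (F t p - - 1 * cnj (F t (- p)))) (\<lambda>t p. (1/2) * (G t p - - 1 * cnj (G t (- p))))"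
    by (rule rapid_curve_mult_growth[OF rapid_curve_diff[OF assms m], where K = "1/2" and N = 0]) auto
  then show ?thesis by (simp add: herm_def[abs_def])
qed

lemma potential_curve: "rapid_curve potential (\<lambda>t k. of_real (coupling k) * herm (dt \<alpha> t) k)"
  unfolding potential_def[abs_def] by (intro rapid_curve_coupling rapid_curve_herm curve_\<alpha>)

lemma dt_w_slice: "dt w t (k, 0) = transport (w t) (k, 0)"
  by (simp add: dt_w_eq force_0)

text \<open>At \<open>k = 0\<close> there is no transport, so only the oscillatory force contributes; at \<open>\<eta> = 0\<close> there is no
  force, so the transport terms that appear can be rewritten as time derivatives.\<close>

lemma laplacian_dt_w:
  "laplacian (\<lambda>\<eta>. dt w t (0, \<eta>)) 0 = of_real (2 * norming) * (LINT k|lborel. potential t k * dt w t (- k, 0))"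
proof -
  let ?osc = "oscillatory sin (potential t) (w t)"
  have f: "dt w t (0, \<eta>) = of_real (- 2 * norming) * ?osc \<eta>" for \<eta>
    unfolding dt_w_eq transport_0 force_def herm_w oscillatory_def by simp
  have osc: "?osc = (\<lambda>\<eta>. of_real (- 1 / (2 * norming)) * dt w t (0, \<eta>))"
    unfolding f using norming_pos by auto
  have sl: "schwartz (\<lambda>\<eta>. dt w t (0, \<eta>))" by (rule schwartz_slice[OF schwartz_dt_w])
  have sosc: "schwartz ?osc"
    unfolding osc by (rule schwartz_bounded_linear[OF bounded_linear_mult_right sl])
  have dd: "dir_deriv b (dir_deriv b (\<lambda>\<eta>. dt w t (0, \<eta>))) 0 = of_real (- 2 * norming) * dir_deriv b (dir_deriv b ?osc) 0"
    if "b \<in> Basis" for b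
  proof -
    have 1: "dir_deriv b (\<lambda>\<eta>. dt w t (0, \<eta>)) = (\<lambda>\<eta>. of_real (- 2 * norming) * dir_deriv b ?osc \<eta>)"
      unfolding f by (intro ext dir_deriv_bounded_linear bounded_linear_mult_right schwartz_differentiable sosc)
    show ?thesis
      unfolding 1 by (intro dir_deriv_bounded_linear bounded_linear_mult_right schwartz_differentiable schwartz_dir_deriv sosc that)
  qed
  have i: "integrable lborel (\<lambda>q. of_real (q \<bullet> axis j 1) * potential t q * dir_deriv (0, axis j 1) (w t) (- q, 0))" for j
  proof -
    have s: "rapid (\<lambda>q. dir_deriv (0, axis j 1) (w t) (- q, 0))"
    proof -
      have "linear (\<lambda>q::real^'n. (- q, 0::real^'n))" "inj (\<lambda>q::real^'n. (- q, 0::real^'n))"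
        by (auto simp: inj_def intro!: linearI)
      from rapid_compose_affine[OF this schwartz_rapid[OF
            schwartz_dir_deriv[OF schwartz_w axis_pair_in_Basis]], where a = 0]
      show ?thesis by (simp add: zero_prod_def)
    qed
    have "rapid (\<lambda>q. of_real (q \<bullet> axis j 1) * (potential t q * dir_deriv (0, axis j 1) (w t) (- q, 0)))"
    proof (rule rapid_mult_growth[where K = 1 and N = 1])
      show "norm (complex_of_real (q \<bullet> axis j 1)) \<le> 1 * (1 + norm q) ^ 1" for q :: "real^'n"
        using Basis_le_norm[OF axis_in_Basis, of q j] by simp
    qed (auto intro!: rapid_mult rapid_potential s)
    then show ?thesis using rapid_integrable by (simp add: mult.assoc)
  qed
  have "laplacian (\<lambda>\<eta>. dt w t (0, \<eta>)) 0 = of_real (- 2 * norming) *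
      (\<Sum>j\<in>UNIV. LINT q|lborel. of_real (q \<bullet> axis j 1) * potential t q * dir_deriv (0, axis j 1) (w t) (- q, 0))"
    unfolding laplacian_def dd[OF axis_in_Basis]
      second_dir_deriv_oscillatory_sin[OF rapid_potential schwartz_w axis_in_Basis]
    by (simp add: sum_distrib_left)
  also have "(\<Sum>j\<in>UNIV. LINT q|lborel. of_real (q \<bullet> axis j 1) * potential t q * dir_deriv (0, axis j 1) (w t) (- q, 0)) =
      (LINT q|lborel. (\<Sum>j\<in>UNIV. of_real (q \<bullet> axis j 1) * potential t q * dir_deriv (0, axis j 1) (w t) (- q, 0)))"
    by (rule Bochner_Integration.integral_sum[symmetric]) (rule i)
  also have "\<dots> = (LINT q|lborel. - (potential t q * dt w t (- q, 0)))"
    unfolding dt_w_slice transport_def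
    by (intro Bochner_Integration.integral_cong refl)
       (simp add: inner_axis sum_distrib_left sum_negf[symmetric] mult_ac)
  finally show ?thesis by simp
qed

text \<open>The rate of change of the kinetic energy cancels the part of the derivative of the interaction
  energy in which \<open>w\<close> is differentiated. What remains is the derivative of \<open>\<alpha>\<close> in the interaction
  and in the field energy, whose integrands are compared pointwise in \<open>k\<close>.\<close>

theorem energy_conserved: "mkg_energy X w \<alpha> t = mkg_energy X w \<alpha> 0"
proof (rule constant_of_zero_derivative)
  fix t
  let ?bs = "\<lambda>j. [(0, axis j 1), (0, axis j 1)] :: ((real^'n) \<times> (real^'n)) list"
  have lap: "laplacian (\<lambda>\<eta>. f (0, \<eta>)) 0 = (\<Sum>j\<in>UNIV. foldr dir_deriv (?bs j) f (0, 0))"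
    if "schwartz f" for f :: "(real^'n) \<times> (real^'n) \<Rightarrow> complex"
    unfolding laplacian_def dir_deriv_slice[OF that]
    by (simp add: dir_deriv_slice[OF schwartz_dir_deriv[OF that axis_pair_in_Basis]])
  have E1: "((\<lambda>t. laplacian (\<lambda>\<eta>. w t (0, \<eta>)) 0) has_vector_derivative laplacian (\<lambda>\<eta>. dt w t (0, \<eta>)) 0) (at t)"
    unfolding lap[OF schwartz_w] lap[OF schwartz_dt_w]
    by (intro has_vector_derivative_sum rapid_curve_has_vector_derivative
        smooth_rapidly_decreasing_foldr_curve w) (auto simp: axis_pair_in_Basis)
  define g where "g = (\<lambda>k. of_real (coupling k) * herm (dt \<alpha> t) k)"
  have E2: "((\<lambda>t. LINT k|lborel. w t (- k, 0) * potential t k) has_vector_derivative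
      (LINT k|lborel. dt w t (- k, 0) * potential t k + w t (- k, 0) * g k)) (at t)"
    unfolding g_def by (intro rapid_curve_integral rapid_curve_mult slice_curve potential_curve)
  define e3 where "e3 = (\<lambda>k. of_real (bracket k) * (dt \<alpha> t k * cnj (\<alpha> t k) + \<alpha> t k * cnj (dt \<alpha> t k)))"
  have E3: "((\<lambda>t. LINT k|lborel. of_real (bracket k) * (\<alpha> t k * cnj (\<alpha> t k))) has_vector_derivative
      (LINT k|lborel. e3 k)) (at t)"
    unfolding e3_def
    by (intro rapid_curve_integral rapid_curve_mult_growth[where K = 1 and N = 1] rapid_curve_mult rapid_curve_cnj curve_\<alpha>)
       (auto simp: bracket_le)
  have energy: "mkg_energy X w \<alpha> t = - (1 / 2) * laplacian (\<lambda>\<eta>. w t (0, \<eta>)) 0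
      + of_real norming * (LINT k|lborel. w t (- k, 0) * potential t k)
      + (1 / 2) * (LINT k|lborel. of_real (bracket k) * (\<alpha> t k * cnj (\<alpha> t k)))" for t
  proof -
    have "of_real (1 / 2 * (LINT k|lborel. bracket k * (norm (\<alpha> t k))\<^sup>2)) =
        (1 / 2) * (LINT k|lborel. of_real (bracket k) * (\<alpha> t k * cnj (\<alpha> t k)))"
      unfolding complex_norm_square[symmetric] of_real_mult[symmetric] integral_complex_of_real by simp
    then show ?thesis
      unfolding mkg_energy_def fourier_constant_inverse norming_def[symmetric] potential_def coupling_def
      by (simp only: of_real_mult mult.assoc)
  qed
  have rw: "rapid (\<lambda>k. w t (- k, 0))" and rdw: "rapid (\<lambda>k. dt w t (- k, 0))"
    by (rule rapid_curveD[OF slice_curve])+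
  have ra: "rapid (\<alpha> t)" and rda: "rapid (dt \<alpha> t)"
    by (rule rapid_curveD[OF curve_\<alpha>])+
  have rg: "rapid g" using rapid_curveD(2)[OF potential_curve] unfolding g_def .
  have i1: "integrable lborel (\<lambda>k. dt w t (- k, 0) * potential t k)" and i2: "integrable lborel (\<lambda>k. w t (- k, 0) * g k)"
    by (intro rapid_integrable rapid_mult rw rdw rg rapid_potential)+
  have i3: "integrable lborel e3"
    unfolding e3_def
    by (rule rapid_integrable, rule rapid_mult_growth[where K = 1 and N = 1])
       (auto intro!: rapid_mult rapid_add rapid_cnj ra rda simp: bracket_le)
  define M where "M = (\<lambda>k. (\<i> / 2) * of_real (norming * bracket k) * (of_real (coupling k) * (w t (k, 0) * cnj (\<alpha> t k))))"
  \<comment> \<open>The source term of the equation for \<open>\<alpha>\<close> is \<open>\<i>\<close> times a hermitian function and drops out of \<open>g\<close>.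
    The rotation term contributes a purely imaginary number to \<open>dt \<alpha> t k * cnj (\<alpha> t k)\<close> and drops
    out of \<open>e3\<close>.\<close>
  have M: "of_real norming * (w t (- k, 0) * g k) + (1 / 2) * e3 k = M (- k) - M k" for k
  proof -
    have c: "cnj (w t (k, 0)) = w t (- k, 0)" "cnj (w t (- k, 0)) = w t (k, 0)"
      using w_hermitian[of t "(- k, 0)"] w_hermitian[of t "(k, 0)"] by simp_all
    show ?thesis
      unfolding g_def e3_def M_def herm_def dt_\<alpha>_eq
      by (simp add: c field_simps)
  qed
  have rs: "rapid (\<lambda>k. w t (k, 0))" using rapid_uminus[OF rw] by simp
  have rM: "rapid M"
    unfolding M_def
  proof (rule rapid_mult_growth[where K = "\<bar>norming\<bar>" and N = 1])
    show "norm ((\<i> / 2) * of_real (norming * bracket k)) \<le> \<bar>norming\<bar> * (1 + norm k) ^ 1" for k :: "real^'n"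
    proof -
      have "norm ((\<i> / 2) * of_real (norming * bracket k)) = \<bar>norming\<bar> * (bracket k / 2)"
        by (simp add: norm_mult abs_mult norm_divide)
      also have "\<dots> \<le> \<bar>norming\<bar> * (1 + norm k)"
        using bracket_le[of k] bracket_pos[of k] by (intro mult_left_mono) auto
      finally show ?thesis by simp
    qed
  qed (auto intro!: rapid_coupling rapid_mult rapid_cnj rs ra)
  have "of_real norming * (LINT k|lborel. w t (- k, 0) * g k) + (1 / 2) * (LINT k|lborel. e3 k)
      = (LINT k|lborel. of_real norming * (w t (- k, 0) * g k) + (1 / 2) * e3 k)"
    using i2 i3 by simp
  also have "\<dots> = (LINT k|lborel. M (- k)) - (LINT k|lborel. M k)"
    unfolding M by (intro Bochner_Integration.integral_diff rapid_integrable rapid_uminus rM)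
  also have "\<dots> = 0"
    by (simp add: lborel_integral_uminus[OF rapid_measurable[OF rM]])
  finally have final: "of_real norming * (LINT k|lborel. w t (- k, 0) * g k) + (1 / 2) * (LINT k|lborel. e3 k) = 0" .
  have "((\<lambda>t. mkg_energy X w \<alpha> t) has_vector_derivative
      - (1 / 2) * laplacian (\<lambda>\<eta>. dt w t (0, \<eta>)) 0
      + of_real norming * (LINT k|lborel. dt w t (- k, 0) * potential t k + w t (- k, 0) * g k)
      + (1 / 2) * (LINT k|lborel. e3 k)) (at t)"
    unfolding energy
    by (intro has_vector_derivative_add has_vector_derivative_mult_right E1 E2 E3)
  moreover have "- (1 / 2) * laplacian (\<lambda>\<eta>. dt w t (0, \<eta>)) 0
      + of_real norming * (LINT k|lborel. dt w t (- k, 0) * potential t k + w t (- k, 0) * g k)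
      + (1 / 2) * (LINT k|lborel. e3 k) = 0"
    unfolding laplacian_dt_w Bochner_Integration.integral_add[OF i1 i2]
    using final by (simp add: algebra_simps)
  ultimately show "((\<lambda>t. mkg_energy X w \<alpha> t) has_vector_derivative 0) (at t)" by simp
qed

end

theorem corollary7:
  fixes X :: "real^'n \<Rightarrow> real"
    and u0 :: "real^'n \<Rightarrow> complex"
    and w :: "real \<Rightarrow> (real^'n) \<times> (real^'n) \<Rightarrow> complex"
    and \<alpha> :: "real \<Rightarrow> real^'n \<Rightarrow> complex"
    and w0 :: "(real^'n) \<times> (real^'n) \<Rightarrow> complex"
    and \<alpha>0 :: "real^'n \<Rightarrow> complex"
  assumes "test_function X"
    and "\<And>k. X (- k) = X k"
    and "schwartz u0"
    and "w0 = fourier_wigner u0"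
    and "smooth_rapidly_decreasing w"
    and "smooth_rapidly_decreasing \<alpha>"
    and "mkg_system X w \<alpha>"
    and "w 0 = w0"
    and "\<alpha> 0 = \<alpha>0"
  shows "(\<forall>t. (LINT \<eta>|lborel. LINT k|lborel. (norm (w t (k, \<eta>)))\<^sup>2) =
              (LINT \<eta>|lborel. LINT k|lborel. (norm (w0 (k, \<eta>)))\<^sup>2))
       \<and> (LINT \<eta>|lborel. LINT k|lborel. (norm (w0 (k, \<eta>)))\<^sup>2) = (2 * pi) ^ CARD('n) * L2norm u0 ^ 4
       \<and> (\<forall>t. w t (0, 0) = w0 (0, 0))
       \<and> w0 (0, 0) = complex_of_real ((L2norm u0)\<^sup>2)
       \<and> (\<forall>t. mkg_energy X w \<alpha> t = mkg_energy X w \<alpha> 0)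
       \<and> (\<forall>u A w' \<alpha>'.
            smooth_rapidly_decreasing u \<and> smooth_rapidly_decreasing A \<and>
            smooth_rapidly_decreasing (dt A) \<and> skg_system X u A \<and> comes_from w' \<alpha>' u A \<longrightarrow>
            (\<forall>t. mkg_energy X w' \<alpha>' t = skg_energy X u A t))"
proof -
  interpret mkg_solution X w \<alpha>
    using assms fourier_wigner_hermitian[OF assms(3)] by unfold_locales auto
  show ?thesis
  proof (intro conjI allI impI)
    show "(LINT \<eta>|lborel. LINT k|lborel. (norm (w t (k, \<eta>)))\<^sup>2) = (LINT \<eta>|lborel. LINT k|lborel. (norm (w0 (k, \<eta>)))\<^sup>2)" for t
      using L2_conserved[of t] unfolding assms(8) .
    show "(LINT \<eta>|lborel. LINT k|lborel. (norm (w0 (k, \<eta>)))\<^sup>2) = (2 * pi) ^ CARD('n) * L2norm u0 ^ 4"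
      unfolding assms(4) by (rule fourier_wigner_L2[OF assms(3)])
    show "w t (0, 0) = w0 (0, 0)" for t
      using mass_conserved[of t] unfolding assms(8) .
    show "w0 (0, 0) = complex_of_real ((L2norm u0)\<^sup>2)"
      unfolding assms(4) by (rule fourier_wigner_0[OF assms(3)])
    show "mkg_energy X w \<alpha> t = mkg_energy X w \<alpha> 0" for t by (rule energy_conserved)
    fix u A w' \<alpha>' t
    assume "smooth_rapidly_decreasing u \<and> smooth_rapidly_decreasing A \<and>
            smooth_rapidly_decreasing (dt A) \<and> skg_system X u A \<and> comes_from w' \<alpha>' u A"
    then show "mkg_energy X w' \<alpha>' t = skg_energy X u A t"
      by (intro energy_in_wigner_variables assms(1) smooth_rapidly_decreasing_schwartz) auto
  qed
qed

end
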